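(* Assume (A2)–(A4) of the context. Let $v_t$ ($t\ge1$) be the hybrid stochastic policy gradient estimator $$v_t=\beta v_{t-1}+\frac{\beta}{B}\sum_{\tau\in\mathcal B_t}\big[g(\tau|\theta_t)-\omega(\tau|\theta_t,\theta_{t-1})g(\tau|\theta_{t-1})\big]+\frac{1-\beta}{B}\sum_{\hat\tau\in\widehat{\mathcal B}_t}g(\hat\tau|\theta_t),$$ and let $\Delta v_t:=v_t-\nabla J(\theta_t)$. Then $$\mathbb E_{\tau,\hat\tau\sim p_{\theta_t}}[v_t]=\nabla J(\theta_t)+\beta\,\Delta v_{t-1}.$$ If $\beta\ne0$, then $v_t$ is a biased estimator of $\nabla J(\theta_t)$ (its bias, conditionally on the past, being $\beta\Delta v_{t-1}$). In addition, $$\mathbb E_{\tau,\hat\tau\sim p_{\theta_t}}\big[\|\Delta v_t\|^2\big]\le\beta^2\|\Delta v_{t-1}\|^2+\frac{\beta^2\overline C}{B}\|\theta_t-\theta_{t-1}\|^2+\frac{(1-\beta)^2\sigma^2}{B},$$ where $\overline C>0$ is the constant given in the context.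
   Context: **Model.** A Markov decision process has state space $\mathcal S$, action space $\mathcal A$, transition probabilities, reward $\mathcal R(s,a)$, discount factor $\gamma\in(0,1)$ and an initial state distribution. For $\theta\in\mathbb R^q$, $\pi_\theta(a|s)$ (also written $\pi_\theta(s,a)$) is a parameterized policy density, twice differentiable in $\theta$. A trajectory $\tau=\{s_0,a_0,\dots,s_{H-1},a_{H-1}\}$ of length $H$ is drawn by following $\pi_\theta$; $p_\theta(\cdot)$ is the resulting density over trajectories. Put $\mathcal R(\tau)=\sum_{t=0}^{H-1}\gamma^t\mathcal R(s_t,a_t)$ and $J(\theta)=\mathbb E_{\tau\sim p_\theta}[\mathcal R(\tau)]$. $\|\cdot\|$ is the $\ell_2$-norm. **Assumptions.** (A2) There is $R>0$ with $|\mathcal R(s,a)|\le R$ for all $s\in\mathcal S,a\in\mathcal A$. (A3) There are $G,M>0$ with $\|\nabla\log\pi_\theta(s,a)\|\le G$ and $\|\nabla^2\log\pi_\theta(s,a)\|\le M$ for all $s\in\mathcal S$, $a\in\mathcal A$ (and all $\theta$). (A4) With $\omega(\tau|\theta_1,\theta_2)=p_{\theta_2}(\tau)/p_{\theta_1}(\tau)$ the importance weight, there is $W\in(0,\infty)$ such that, for each pair of policies (parameters $\theta_1,\theta_2\in\mathbb R^q$) encountered in the algorithm, $\mathrm{Var}[\omega(\tau|\theta_1,\theta_2)]\le W$ for $\tau\sim p_{\theta_1}$. **Stochastic gradient.** $g(\tau|\theta)=\sum_{t=0}^{H-1}\nabla\log\pi_\theta(a_t|s_t)\,(\mathcal R(\tau)-b_t)$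 is the REINFORCE estimator with baseline $b_t$ depending at most on $s_t$, and $|b|$ denotes a bound on the baseline: $|b_t|\le|b|$. It satisfies $\mathbb E_{\tau\sim p_\theta}[g(\tau|\theta)]=\nabla J(\theta)$. **Constants.** Under (A2)–(A3) it is known that there is $\sigma>0$ depending only on $R,G,M,H,\gamma,b$ with $\|g(\tau|\theta)-\nabla J(\theta)\|^2\le\sigma^2$ for all $\theta,\tau$. Further $\overline C:=C_g^2C_\omega+L_g^2$, where $L_g=\frac{HM(R+|b|)}{1-\gamma}$, $C_g=\frac{HG(R+|b|)}{1-\gamma}$, $C_\omega=H(2HG^2+M)(W+1)$. **Setting.** $\beta\in[0,1]$ and $B\ge1$ is an integer. The iterates $\theta_0,\theta_1,\dots$ are produced by an iterative algorithm in which $v_0=\frac1N\sum_{\tau\in\tilde{\mathcal B}}g(\tau|\theta_0)$ with $\tilde{\mathcal B}$ a batch of $N$ independent trajectories from $p_{\theta_0}$, and, given the past (in particular given $\theta_{t-1},\theta_t,v_{t-1}$), $\mathcal B_t$ and $\widehat{\mathcal B}_t$ are two independent batches of $B$ independent trajectories each sampled from $p_{\theta_t}$. The update computes $\theta_{t+1}=(1-\alpha)\theta_t+\alpha\,\mathrm{prox}_{\eta Q}(\theta_t+\eta v_t)$, where $\alpha\in(0,1]$, $\eta>0$, $Q:\mathbb R^q\to\mathbb R\cup\{+\infty\}$ is proper, closed and convex, and $\mathrm{prox}_Q(\theta)=\arg\min_{\theta'}\{Q(\theta')+\frac12\|\theta'-\theta\|^2\}$. $\mathbb E_{\tau,\hat\tau\sim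 p_{\theta_t}}$ is the expectation over $\mathcal B_t,\widehat{\mathcal B}_t$ conditionally on the past (the $\sigma$-field generated by $\tilde{\mathcal B},\mathcal B_1,\widehat{\mathcal B}_1,\dots,\mathcal B_{t-1},\widehat{\mathcal B}_{t-1}$). *)

theory Defs
  imports "HOL-Probability.Probability"
begin

section \<open>Gradients, Hessians and proximal operators\<close>

definition grad :: "('x::real_inner \<Rightarrow> real) \<Rightarrow> 'x \<Rightarrow> 'x" where
  "grad f x = (THE D. GDERIV f x :> D)"

text \<open>The Hessian is kept as a linear map, so that its \<open>onorm\<close> is the norm induced by the Euclidean
  norm (the \<open>norm\<close> of a matrix type would be the Frobenius norm).\<close>

definition hessian :: "('x::real_inner \<Rightarrow> real) \<Rightarrow> 'x \<Rightarrow> 'x \<Rightarrow> 'x" where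
  "hessian f x = frechet_derivative (grad f) (at x)"

definition twice_differentiable :: "('x::real_inner \<Rightarrow> real) \<Rightarrow> bool" where
  "twice_differentiable f \<longleftrightarrow>
     (\<forall>x. f differentiable (at x)) \<and> (\<forall>x. grad f differentiable (at x))"

definition ext_epigraph :: "('x \<Rightarrow> ereal) \<Rightarrow> ('x \<times> real) set" where
  "ext_epigraph Q = {(x, r). Q x \<le> ereal r}"

definition proper_closed_convex :: "('x::euclidean_space \<Rightarrow> ereal) \<Rightarrow> bool" where
  "proper_closed_convex Q \<longleftrightarrow>
     (\<forall>x. Q x \<noteq> -\<infinity>) \<and> (\<exists>x. Q x \<noteq> \<infinity>) \<and>
     closed (ext_epigraph Q) \<and> convex (ext_epigraph Q)"

definition prox :: "('x::euclidean_space \<Rightarrow> ereal) \<Rightarrow> 'x \<Rightarrow> 'x" where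
  "prox Q x = arg_min (\<lambda>y. Q y + ereal ((norm (y - x))\<^sup>2 / 2)) (\<lambda>_. True)"


section \<open>Policy gradient model\<close>

text \<open>The state and action spaces carry reference measures (counting measure, Lebesgue measure, ...).
  Initial distribution, transition probabilities and policy are given by densities with respect to
  these: \<open>trans_dens X s a s'\<close> stands for $P(s' \mid s, a)$ and \<open>policy X \<theta> s a\<close> for
  $\pi_\theta(a \mid s)$.\<close>

record ('s, 'a, 'q) pg_model =
  states :: "'s measure"
  actions :: "'a measure"
  init_dens :: "'s \<Rightarrow> real"
  trans_dens :: "'s \<Rightarrow> 'a \<Rightarrow> 's \<Rightarrow> real"
  reward :: "'s \<Rightarrow> 'a \<Rightarrow> real"
  discount :: real
  horizon :: nat
  policy :: "real ^ 'q \<Rightarrow> 's \<Rightarrow> 'a \<Rightarrow> real"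
  baseline :: "nat \<Rightarrow> 's \<Rightarrow> real"

text \<open>The policy density is strictly positive because $\log \pi_\theta(a \mid s)$ has to make sense
  for all \<open>s\<close> and \<open>a\<close>.\<close>

definition wf_model :: "('s, 'a, 'q::finite) pg_model \<Rightarrow> bool" where
  "wf_model X \<longleftrightarrow>
     sigma_finite_measure (states X) \<and> sigma_finite_measure (actions X) \<and>
     0 < discount X \<and> discount X < 1 \<and> 1 \<le> horizon X \<and>
     init_dens X \<in> borel_measurable (states X) \<and>
     (\<forall>s\<in>space (states X). 0 \<le> init_dens X s) \<and>
     (\<integral>\<^sup>+ s. ennreal (init_dens X s) \<partial>states X) = 1 \<and>
     (\<lambda>(s, a, s'). trans_dens X s a s')
        \<in> borel_measurable (states X \<Otimes>\<^sub>M actions X \<Otimes>\<^sub>M states X) \<and>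
     (\<forall>s\<in>space (states X). \<forall>a\<in>space (actions X).
        (\<forall>s'\<in>space (states X). 0 \<le> trans_dens X s a s') \<and>
        (\<integral>\<^sup>+ s'. ennreal (trans_dens X s a s') \<partial>states X) = 1) \<and>
     (\<lambda>(s, a). reward X s a) \<in> borel_measurable (states X \<Otimes>\<^sub>M actions X) \<and>
     (\<forall>\<theta>. (\<lambda>(s, a). policy X \<theta> s a) \<in> borel_measurable (states X \<Otimes>\<^sub>M actions X)) \<and>
     (\<forall>\<theta>. \<forall>s\<in>space (states X).
        (\<forall>a\<in>space (actions X). 0 < policy X \<theta> s a) \<and>
        (\<integral>\<^sup>+ a. ennreal (policy X \<theta> s a) \<partial>actions X) = 1) \<and>
     (\<forall>s\<in>space (states X). \<forall>a\<in>space (actions X). twice_differentiable (\<lambda>\<theta>. policy X \<theta> s a)) \<and>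
     (\<forall>t. baseline X t \<in> borel_measurable (states X))"

text \<open>A trajectory maps \<open>t < H\<close> to the pair $(s_t, a_t)$.\<close>

type_synonym ('s, 'a) traj = "nat \<Rightarrow> 's \<times> 'a"

abbreviation st :: "('s, 'a) traj \<Rightarrow> nat \<Rightarrow> 's" where
  "st \<tau> t \<equiv> fst (\<tau> t)"

abbreviation act :: "('s, 'a) traj \<Rightarrow> nat \<Rightarrow> 'a" where
  "act \<tau> t \<equiv> snd (\<tau> t)"

definition traj_space :: "('s, 'a, 'q::finite) pg_model \<Rightarrow> ('s, 'a) traj measure" where
  "traj_space X = PiM {..<horizon X} (\<lambda>_. states X \<Otimes>\<^sub>M actions X)"

definition traj_dens ::
  "('s, 'a, 'q::finite) pg_model \<Rightarrow> real ^ 'q \<Rightarrow> ('s, 'a) traj \<Rightarrow> real" where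
  "traj_dens X \<theta> \<tau> =
     init_dens X (st \<tau> 0) *
     (\<Prod>t<horizon X. policy X \<theta> (st \<tau> t) (act \<tau> t)) *
     (\<Prod>t<horizon X - 1. trans_dens X (st \<tau> t) (act \<tau> t) (st \<tau> (Suc t)))"

definition traj_law ::
  "('s, 'a, 'q::finite) pg_model \<Rightarrow> real ^ 'q \<Rightarrow> ('s, 'a) traj measure" where
  "traj_law X \<theta> = density (traj_space X) (\<lambda>\<tau>. ennreal (traj_dens X \<theta> \<tau>))"

definition total_reward :: "('s, 'a, 'q::finite) pg_model \<Rightarrow> ('s, 'a) traj \<Rightarrow> real" where
  "total_reward X \<tau> = (\<Sum>t<horizon X. discount X ^ t * reward X (st \<tau> t) (act \<tau> t))"

definition objective :: "('s, 'a, 'q::finite) pg_model \<Rightarrow> real ^ 'q \<Rightarrow> real" where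
  "objective X \<theta> = (\<integral>\<tau>. total_reward X \<tau> \<partial>traj_law X \<theta>)"

definition log_policy ::
  "('s, 'a, 'q::finite) pg_model \<Rightarrow> 's \<Rightarrow> 'a \<Rightarrow> real ^ 'q \<Rightarrow> real" where
  "log_policy X s a \<theta> = ln (policy X \<theta> s a)"

definition reinforce ::
  "('s, 'a, 'q::finite) pg_model \<Rightarrow> ('s, 'a) traj \<Rightarrow> real ^ 'q \<Rightarrow> real ^ 'q" where
  "reinforce X \<tau> \<theta> =
     (\<Sum>t<horizon X. (total_reward X \<tau> - baseline X t (st \<tau> t)) *\<^sub>R
        grad (log_policy X (st \<tau> t) (act \<tau> t)) \<theta>)"

text \<open>\<open>imp_weight X \<tau> \<theta>\<^sub>1 \<theta>\<^sub>2\<close> is $\omega(\tau \mid \theta_1, \theta_2)$, with $\theta_1$ in the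
  denominator. Points with $p_{\theta_1}(\tau) = 0$ form a null set of \<open>traj_law X \<theta>\<^sub>1\<close>.\<close>

definition imp_weight ::
  "('s, 'a, 'q::finite) pg_model \<Rightarrow> ('s, 'a) traj \<Rightarrow> real ^ 'q \<Rightarrow> real ^ 'q \<Rightarrow> real" where
  "imp_weight X \<tau> \<theta>\<^sub>1 \<theta>\<^sub>2 = traj_dens X \<theta>\<^sub>2 \<tau> / traj_dens X \<theta>\<^sub>1 \<tau>"


section \<open>Constants\<close>

text \<open>\<open>b\<close> is the bound $|b|$ on the baseline.\<close>

definition L_g :: "nat \<Rightarrow> real \<Rightarrow> real \<Rightarrow> real \<Rightarrow> real \<Rightarrow> real" where
  "L_g H \<gamma> M R b = real H * M * (R + b) / (1 - \<gamma>)"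

definition C_g :: "nat \<Rightarrow> real \<Rightarrow> real \<Rightarrow> real \<Rightarrow> real \<Rightarrow> real" where
  "C_g H \<gamma> G R b = real H * G * (R + b) / (1 - \<gamma>)"

definition C_\<omega> :: "nat \<Rightarrow> real \<Rightarrow> real \<Rightarrow> real \<Rightarrow> real" where
  "C_\<omega> H G M W = real H * (2 * real H * G\<^sup>2 + M) * (W + 1)"

definition C_bar :: "nat \<Rightarrow> real \<Rightarrow> real \<Rightarrow> real \<Rightarrow> real \<Rightarrow> real \<Rightarrow> real \<Rightarrow> real" where
  "C_bar H \<gamma> R G M W b = (C_g H \<gamma> G R b)\<^sup>2 * C_\<omega> H G M W + (L_g H \<gamma> M R b)\<^sup>2"


section \<open>Samples, past and conditional expectation\<close>

text \<open>\<open>\<B>0 j\<close> (\<open>j < N\<close>) is the initial batch, \<open>\<B> s j\<close> and \<open>\<B>' s j\<close> (\<open>j < B\<close>) are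
  the two batches drawn in iteration \<open>s \<ge> 1\<close>.\<close>

definition past_samples ::
  "nat \<Rightarrow> nat \<Rightarrow> (nat \<Rightarrow> 'w \<Rightarrow> 'x) \<Rightarrow> (nat \<Rightarrow> nat \<Rightarrow> 'w \<Rightarrow> 'x) \<Rightarrow>
     (nat \<Rightarrow> nat \<Rightarrow> 'w \<Rightarrow> 'x) \<Rightarrow> nat \<Rightarrow> ('w \<Rightarrow> 'x) set" where
  "past_samples N B \<B>0 \<B> \<B>' t =
     {\<B>0 j | j. j < N} \<union> {\<B> s j | s j. 1 \<le> s \<and> s < t \<and> j < B} \<union>
     {\<B>' s j | s j. 1 \<le> s \<and> s < t \<and> j < B}"

definition gen_field :: "'w measure \<Rightarrow> 'x measure \<Rightarrow> ('w \<Rightarrow> 'x) set \<Rightarrow> 'w measure" where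
  "gen_field \<Omega> T Xs = sigma (space \<Omega>) {Y -` A \<inter> space \<Omega> | Y A. Y \<in> Xs \<and> A \<in> sets T}"

definition past ::
  "('s, 'a, 'q::finite) pg_model \<Rightarrow> 'w measure \<Rightarrow> nat \<Rightarrow> nat \<Rightarrow> (nat \<Rightarrow> 'w \<Rightarrow> ('s, 'a) traj) \<Rightarrow>
     (nat \<Rightarrow> nat \<Rightarrow> 'w \<Rightarrow> ('s, 'a) traj) \<Rightarrow> (nat \<Rightarrow> nat \<Rightarrow> 'w \<Rightarrow> ('s, 'a) traj) \<Rightarrow> nat \<Rightarrow> 'w measure" where
  "past X \<Omega> N B \<B>0 \<B> \<B>' t = gen_field \<Omega> (traj_space X) (past_samples N B \<B>0 \<B> \<B>' t)"

definition grad_error ::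
  "('s, 'a, 'q::finite) pg_model \<Rightarrow> (nat \<Rightarrow> 'w \<Rightarrow> real ^ 'q) \<Rightarrow> (nat \<Rightarrow> 'w \<Rightarrow> real ^ 'q) \<Rightarrow>
     nat \<Rightarrow> 'w \<Rightarrow> real ^ 'q" where
  "grad_error X \<theta> v t w = v t w - grad (objective X) (\<theta> t w)"

text \<open>The library only has conditional expectations of real functions.\<close>

definition vec_cond_exp ::
  "'w measure \<Rightarrow> 'w measure \<Rightarrow> ('w \<Rightarrow> real ^ 'q::finite) \<Rightarrow> 'w \<Rightarrow> real ^ 'q" where
  "vec_cond_exp \<Omega> F Y w = (\<chi> i. real_cond_exp \<Omega> F (\<lambda>w. Y w $ i) w)"

definition cond_bias ::
  "'w measure \<Rightarrow> 'w measure \<Rightarrow> ('w \<Rightarrow> real ^ 'q::finite) \<Rightarrow> ('w \<Rightarrow> real ^ 'q) \<Rightarrow> 'w \<Rightarrow> real ^ 'q" where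
  "cond_bias \<Omega> F Y target w = vec_cond_exp \<Omega> F Y w - target w"

end

theory Submission
  imports Defs
begin

text \<open>
  Conditionally on the past, the error \<open>v\<^sub>t - \<nabla>J(\<theta>\<^sub>t) - \<beta> \<Delta>v\<^sub>t\<^sub>-\<^sub>1\<close> is a sum of \<open>2 B\<close> pairwise
  independent centred terms, so its second moment is the sum of theirs. Everything reduces to the
  bound \<open>E \<parallel>g - \<omega> g'\<parallel>\<^sup>2 \<le> C \<parallel>\<theta> - \<theta>'\<parallel>\<^sup>2\<close> for a single trajectory, where \<open>g\<close>, \<open>g'\<close> are the
  estimators at \<open>\<theta> = \<theta>\<^sub>t\<close>, \<open>\<theta>' = \<theta>\<^sub>t\<^sub>-\<^sub>1\<close> and \<open>\<omega>\<close> is the importance weight.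

  The inequality \<open>\<parallel>x + y\<parallel>\<^sup>2 \<le> 2 \<parallel>x\<parallel>\<^sup>2 + 2 \<parallel>y\<parallel>\<^sup>2\<close> is too weak for the stated constant. Instead
  \<open>\<parallel>g - \<omega> g'\<parallel>\<^sup>2 = \<omega> \<parallel>g - g'\<parallel>\<^sup>2 + (1 - \<omega>) (\<parallel>g\<parallel>\<^sup>2 - \<parallel>g'\<parallel>\<^sup>2) + (1 - \<omega>)\<^sup>2 \<parallel>g'\<parallel>\<^sup>2\<close> is used. The first term is
  governed by \<open>E \<omega> = 1\<close>, the last one by the boundedness of \<open>ln \<omega>\<close> along with (A4), which is only
  needed at the pair \<open>(\<theta>, \<theta>')\<close> itself. For horizon at least two the middle term is controlled by
  \<open>E \<bar>1 - \<omega>\<bar> \<le> H G \<parallel>\<theta> - \<theta>'\<parallel> / 2\<close>, where the factor 1/2 comes from the martingale structure of the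
  weights. For horizon one this bound is off by a factor two, and one has to exploit that
  the score has mean zero under both policies.
\<close>

section \<open>Importance weights with unit moments\<close>

text \<open>The constant leaves almost no room. With \<open>d = norm (\<theta> - \<theta>')\<close>,
  \<open>k = H G d\<close>, \<open>C = C_g\<close> and \<open>l = L_g d\<close>, the target is
  exactly \<open>l^2 + (k C l + 2 k^2 C^2) (1 + W)\<close>. The middle term of the expansion is at
  most \<open>2 C l |1 - \<omega>|\<close>, so the mean of \<open>|1 - \<omega>|\<close> has to be
  at most \<open>k / 2\<close>. One ratio of mean one in \<open>[exp (- k), exp k]\<close> only
  guarantees \<open>2 tanh (k / 2)\<close>, about \<open>k\<close>. When two factors each move by
  \<open>z\<close> or \<open>1 / z\<close>, the mixed moves cancel in the product, and this gains
  the half. The variance term does have a surplus: for \<open>k \<le> 1\<close> it is at most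
  \<open>1.23 k^2\<close> instead of \<open>2 k^2\<close>, and horizon one lives on the difference.
  For \<open>k > 1\<close> the bound \<open>W\<close> is already below \<open>2 k^2 (1 + W)\<close>.
  A further obstacle is that the random step between consecutive parameters need not be square
  integrable. Conditional second moments therefore also receive a constant bound, which serves
  integrability only.\<close>

lemma two_diff_quotient_le_ln:
  fixes z :: real
  assumes "1 \<le> z"
  shows "2 * (z - 1) / (z + 1) \<le> ln z"
proof -
  \<comment> \<open>With \<open>s = ln z\<close> the claim reads
    \<open>2 tanh (s / 2) \<le> s\<close>. Its left side is the mean of \<open>|1 - w|\<close> under
    the two-point law of mean one on \<open>1 / z\<close> and \<open>z\<close>.\<close>
  have "(\<lambda>t. ln t - 2 * (t - 1) / (t + 1)) 1 \<le> (\<lambda>t. ln t - 2 * (t - 1) / (t + 1)) z"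
  proof (rule DERIV_nonneg_imp_nondecreasing[OF assms])
    fix t :: real assume t: "1 \<le> t" "t \<le> z"
    have "((\<lambda>t. ln t - 2 * (t - 1) / (t + 1)) has_real_derivative
        1 / t - (2 * (t + 1) - 2 * (t - 1)) / ((t + 1) * (t + 1))) (at t)"
      using t by (auto intro!: derivative_eq_intros simp: field_simps)
    moreover have "1 / t - (2 * (t + 1) - 2 * (t - 1)) / ((t + 1) * (t + 1))
        = (t - 1)\<^sup>2 / (t * (t + 1)\<^sup>2)"
      using t by (simp add: divide_simps power2_eq_square) (simp add: algebra_simps)
    ultimately show "\<exists>y. ((\<lambda>t. ln t - 2 * (t - 1) / (t + 1)) has_real_derivative y) (at t) \<and> 0 \<le> y"
      using t by (intro exI[of _ "(t - 1)\<^sup>2 / (t * (t + 1)\<^sup>2)"]) auto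
  qed
  then show ?thesis by simp
qed

text \<open>Writes \<open>1 - z\<close> exactly as a multiple of \<open>ln z * (1 + z)\<close>, for
  both signs of \<open>ln z\<close>. The factor is \<open>tanh (s / 2) / (s / 2)\<close> with
  \<open>s = ln z\<close>, and the case \<open>z < 1\<close> is the case \<open>1 / z\<close>
  reflected. Gradients control \<open>ln z\<close>, and of \<open>c\<close> only its range matters
  later.\<close>

lemma ln_scaled_tanh:
  fixes z :: real
  assumes "0 < z"
  obtains c where "0 \<le> c" "c \<le> 1" "2 * (z - 1) / (z + 1) = c * ln z"
proof (cases "z = 1")
  case True
  then show ?thesis using that[of 0] by simp
next
  case False
  let ?m = "2 * (z - 1) / (z + 1)"
  have "0 \<le> ?m / ln z \<and> ?m / ln z \<le> 1"
  proof (cases "1 < z")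
    case True
    then show ?thesis using two_diff_quotient_le_ln[of z] by (auto simp: divide_simps mult.commute)
  next
    case f: False
    then have z: "z < 1" "ln z < 0" using False assms by auto
    have "2 * (1/z - 1) / (1/z + 1) \<le> ln (1/z)"
      using z assms by (intro two_diff_quotient_le_ln) auto
    moreover have "2 * (1/z - 1) / (1/z + 1) = - ?m"
      using assms by (simp add: divide_simps)
    ultimately have "ln z \<le> ?m" using assms by (simp add: ln_div)
    moreover have "?m < 0" using z assms by (simp add: divide_simps)
    moreover have "0 \<le> m / L \<and> m / L \<le> 1" if "L \<le> m" "m < 0" for m L :: real
      using that by (simp add: divide_le_eq_1_neg divide_nonpos_neg)
    ultimately show ?thesis by blast
  qed
  moreover have "?m = ?m / ln z * ln z" using False assms by simp
  ultimately show ?thesis using that by blast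
qed

text \<open>Odd Taylor terms cancel, and the quartic remainder is at most
  \<open>2 * 2.72 / 24 < 0.23\<close> times \<open>k^4 \<le> k^2\<close>. The constant has to stay
  below 1.25, because horizon one adds another \<open>3/4 * k^2\<close> and the budget is
  \<open>2 * k^2\<close>.\<close>

lemma exp_plus_exp_minus_le:
  fixes k :: real
  assumes "0 \<le> k" "k \<le> 1"
  shows "exp k + exp (- k) - 2 \<le> 123/100 * k\<^sup>2"
proof -
  obtain t where t: "\<bar>t\<bar> \<le> \<bar>k\<bar>" "exp k = (\<Sum>m<4. k^m / fact m) + exp t / fact 4 * k^4"
    using Maclaurin_exp_le[of k 4] by auto
  obtain u where u: "\<bar>u\<bar> \<le> \<bar>-k\<bar>" "exp (-k) = (\<Sum>m<4. (-k)^m / fact m) + exp u / fact 4 * (-k)^4"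
    using Maclaurin_exp_le[of "-k" 4] by auto
  have e: "exp (1::real) \<le> 272/100"
    using e_approx_32 by (simp add: abs_if split: if_splits)
  have "t \<le> 1" "u \<le> 1" using t u assms by auto
  then have "exp t \<le> exp 1" "exp u \<le> exp 1" by auto
  then have tu: "exp t + exp u \<le> 544/100" using e by linarith
  have "exp k + exp (-k) - 2 = k\<^sup>2 + (exp t + exp u) / 24 * k^4"
    using t(2) u(2) by (simp add: fact_numeral eval_nat_numeral field_simps)
  also have "\<dots> \<le> k\<^sup>2 + (exp t + exp u) / 24 * k^2"
    using assms by (intro add_left_mono mult_left_mono power_decreasing) auto
  also have "\<dots> \<le> k\<^sup>2 + (544/100) / 24 * k^2"
    using tu by (intro add_left_mono mult_right_mono) auto
  also have "\<dots> \<le> 123/100 * k\<^sup>2" by simp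
  finally show ?thesis by linarith
qed

text \<open>The right-hand side is the bilinear interpolant of the left-hand side at the corners of the
  square; only its value at \<open>(1, 1)\<close> matters for the expectation.\<close>

lemma abs_one_minus_mult_le_bilinear:
  fixes a b z :: real
  assumes "1 < z" "1 / z \<le> a" "a \<le> z" "1 / z \<le> b" "b \<le> z"
  shows "\<bar>1 - a * b\<bar> \<le> ((z\<^sup>2 + 1) * (1 + a * b) - 2 * z * (a + b)) / (z\<^sup>2 - 1)"
proof -
  have z: "0 < z\<^sup>2 - 1" using assms(1) by (simp add: one_less_power)
  \<comment> \<open>Twice these products are the gaps between the numerator of the bound and
    \<open>(1 - a * b) * (z^2 - 1)\<close> or its negative.\<close>
  have "0 \<le> (z * a - 1) * (z * b - 1)" "0 \<le> (z - a) * (z - b)"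
    using assms by (auto intro!: mult_nonneg_nonneg simp: divide_simps mult.commute)
  then have "(1 - a * b) * (z\<^sup>2 - 1) \<le> (z\<^sup>2 + 1) * (1 + a * b) - 2 * z * (a + b)"
    "(a * b - 1) * (z\<^sup>2 - 1) \<le> (z\<^sup>2 + 1) * (1 + a * b) - 2 * z * (a + b)"
    by (auto simp: algebra_simps power2_eq_square)
  then have "\<bar>1 - a * b\<bar> * (z\<^sup>2 - 1) \<le> (z\<^sup>2 + 1) * (1 + a * b) - 2 * z * (a + b)"
    by (auto simp: abs_if)
  then show ?thesis using z by (simp add: pos_le_divide_eq)
qed

text \<open>Convexity in \<open>a\<close>: on \<open>[1 / z, z]\<close> the function stays below its
  chord, and the weights are the barycentric coordinates of \<open>a\<close>. Applied to one
  variable after the other, this produces multi-affine bounds, whose means are known.\<close>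

lemma abs_one_minus_mult_le_chord:
  fixes a y z :: real
  assumes "1 < z" "1 / z \<le> a" "a \<le> z"
  shows "\<bar>1 - a * y\<bar> \<le> (a - 1 / z) / (z - 1 / z) * \<bar>1 - z * y\<bar> + (z - a) / (z - 1 / z) * \<bar>1 - y / z\<bar>"
proof -
  have z: "0 < z - 1 / z" using assms(1) by (simp add: field_simps less_1_mult)
  let ?l = "(a - 1 / z) / (z - 1 / z)" and ?r = "(z - a) / (z - 1 / z)"
  have lr: "0 \<le> ?l" "0 \<le> ?r" using z assms by auto
  have s: "?l + ?r = 1" using z by (simp add: add_divide_distrib[symmetric])
  have "?l * z + ?r / z = ((a - 1 / z) * z + (z - a) / z) / (z - 1 / z)"
    by (simp add: add_divide_distrib)
  also have "(a - 1 / z) * z + (z - a) / z = a * (z - 1 / z)"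
    using assms(1) by (simp add: field_simps)
  finally have e: "?l * z + ?r / z = a" using z by simp
  have "1 - a * y = (?l + ?r) - (?l * z + ?r / z) * y" unfolding e s by simp
  also have "\<dots> = ?l * (1 - z * y) + ?r * (1 - y / z)"
  proof -
    have "(l + r) - (l * z + r / z) * y = l * (1 - z * y) + r * (1 - y / z)" for l r :: real
      by (simp add: algebra_simps)
    then show ?thesis .
  qed
  also have "\<bar>\<dots>\<bar> \<le> \<bar>?l * (1 - z * y)\<bar> + \<bar>?r * (1 - y / z)\<bar>" by (rule abs_triangle_ineq)
  finally show ?thesis using lr by (simp only: abs_mult abs_of_nonneg)
qed

text \<open>\<open>moments\<close> takes the place of independence: successive policy ratios depend
  on each other through the visited states, yet every product over distinct steps has mean one. So
  the mean of a multi-affine function of the weights is its value where all weights are one.\<close>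

locale unit_moment_weights = prob_space +
  fixes w :: "nat \<Rightarrow> 'a \<Rightarrow> real" and n :: nat and z :: real
  assumes w_meas [measurable]: "\<And>i. i < n \<Longrightarrow> w i \<in> borel_measurable M"
    and z_gt_1: "1 < z"
    and w_lower: "\<And>i x. i < n \<Longrightarrow> x \<in> space M \<Longrightarrow> 1 / z \<le> w i x"
    and w_upper: "\<And>i x. i < n \<Longrightarrow> x \<in> space M \<Longrightarrow> w i x \<le> z"
    and moments: "\<And>A. A \<subseteq> {..<n} \<Longrightarrow> expectation (\<lambda>x. \<Prod>i\<in>A. w i x) = 1"
begin

lemma w_pos: "i < n \<Longrightarrow> x \<in> space M \<Longrightarrow> 0 < w i x"
  using w_lower[of i x] z_gt_1 by (smt (verit) divide_pos_pos)

lemma prod_w_nonneg: "A \<subseteq> {..<n} \<Longrightarrow> x \<in> space M \<Longrightarrow> 0 \<le> (\<Prod>i\<in>A. w i x)"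
  using w_pos by (intro prod_nonneg) (auto simp: less_imp_le subset_iff)

lemma prod_w_le:
  assumes "A \<subseteq> {..<n}" "x \<in> space M" shows "(\<Prod>i\<in>A. w i x) \<le> z ^ n"
proof -
  have "(\<Prod>i\<in>A. w i x) \<le> (\<Prod>i\<in>A. z)"
    using assms w_pos w_upper by (intro prod_mono) (auto simp: less_imp_le subset_iff)
  also have "\<dots> = z ^ card A" by simp
  also have "\<dots> \<le> z ^ n"
    using assms card_mono[of "{..<n}" A] z_gt_1 by (intro power_increasing) auto
  finally show ?thesis .
qed

lemma prod_w_meas [measurable]: "A \<subseteq> {..<n} \<Longrightarrow> (\<lambda>x. \<Prod>i\<in>A. w i x) \<in> borel_measurable M"
  by (intro borel_measurable_prod) auto

lemma integrable_prod_w: "A \<subseteq> {..<n} \<Longrightarrow> integrable M (\<lambda>x. \<Prod>i\<in>A. w i x)"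
  using prod_w_nonneg prod_w_le
  by (intro integrable_const_bound[where B="z ^ n"] AE_I2) auto

text \<open>Multiplied by the product over \<open>A\<close>, the bilinear bound is still a
  combination of products over distinct indices. Its mean is thus the value at
  \<open>(1, 1)\<close>, namely \<open>2 * (z - 1)^2 / (z^2 - 1)\<close>; the extra product acts as
  a change of measure that costs nothing.\<close>

lemma expectation_prod_abs_one_minus_mult_le:
  assumes A: "A \<subseteq> {..<n}" and ij: "i < n" "j < n" "i \<noteq> j" "i \<notin> A" "j \<notin> A"
  shows "integrable M (\<lambda>x. (\<Prod>i\<in>A. w i x) * \<bar>1 - w i x * w j x\<bar>)"
    and "expectation (\<lambda>x. (\<Prod>i\<in>A. w i x) * \<bar>1 - w i x * w j x\<bar>) \<le> ln z"
proof -
  have fin: "finite A" using A finite_subset by blast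
  let ?q = "\<lambda>A x. \<Prod>i\<in>A. w i x"
  have sub: "insert i A \<subseteq> {..<n}" "insert j A \<subseteq> {..<n}" "insert i (insert j A) \<subseteq> {..<n}" using A ij by auto
  note I = integrable_prod_w[OF A] sub[THEN integrable_prod_w]
  note E = moments[OF A] sub[THEN moments]
  let ?b = "\<lambda>x. ((z\<^sup>2 + 1) * (?q A x + ?q (insert i (insert j A)) x)
              - 2 * z * (?q (insert i A) x + ?q (insert j A) x)) / (z\<^sup>2 - 1)"
  have le: "?q A x * \<bar>1 - w i x * w j x\<bar> \<le> ?b x" if x: "x \<in> space M" for x
  proof -
    have "?q A x * \<bar>1 - w i x * w j x\<bar> \<le> ?q A x * (((z\<^sup>2 + 1) * (1 + w i x * w j x) - 2 * z * (w i x + w j x)) / (z\<^sup>2 - 1))"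
      using ij x w_lower w_upper z_gt_1 prod_w_nonneg[OF A]
      by (intro mult_left_mono abs_one_minus_mult_le_bilinear) auto
    also have "\<dots> = ?b x"
      using ij fin by (simp add: algebra_simps)
    finally show ?thesis .
  qed
  have bI: "integrable M ?b" using I by auto
  show int: "integrable M (\<lambda>x. ?q A x * \<bar>1 - w i x * w j x\<bar>)"
    using A ij le prod_w_nonneg by (intro Bochner_Integration.integrable_bound[OF bI])
      (auto intro!: AE_I2 order_trans[OF _ abs_ge_self] simp: abs_mult simp del: abs_divide)
  have "expectation (\<lambda>x. ?q A x * \<bar>1 - w i x * w j x\<bar>) \<le> expectation ?b"
    using int bI le by (intro integral_mono) auto
  also have "expectation ?b = (2 * (z\<^sup>2 + 1) - 4 * z) / (z\<^sup>2 - 1)"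
    using I E by simp
  also have "\<dots> = 2 * (z - 1) / (z + 1)"
  proof -
    have "z\<^sup>2 - 1 \<noteq> 0" "z + 1 \<noteq> 0" using z_gt_1 by (auto simp: power2_eq_1_iff)
    then show ?thesis by (simp add: divide_simps) (simp add: algebra_simps power2_eq_square)
  qed
  also have "\<dots> \<le> ln z" using z_gt_1 by (intro two_diff_quotient_le_ln) auto
  finally show "expectation (\<lambda>x. ?q A x * \<bar>1 - w i x * w j x\<bar>) \<le> ln z" .
qed

lemma integrable_abs_one_minus:
  assumes "A \<subseteq> {..<n}" shows "integrable M (\<lambda>x. \<bar>1 - (\<Prod>i\<in>A. w i x)\<bar>)"
  using integrable_prod_w[OF assms] by auto

text \<open>The expansion has eight monomials, all of mean one, so each affine factor is simply
  evaluated at 1.\<close>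

lemma expectation_affine3:
  assumes n: "3 \<le> n"
  shows "integrable M (\<lambda>x. (p + q * w 0 x) * (p' + q' * w 1 x) * (p'' + q'' * w 2 x))"
    and "expectation (\<lambda>x. (p + q * w 0 x) * (p' + q' * w 1 x) * (p'' + q'' * w 2 x))
      = (p + q) * (p' + q') * (p'' + q'')"
proof -
  have "{0} \<subseteq> {..<n}" "{1} \<subseteq> {..<n}" "{2} \<subseteq> {..<n}" "{0,1} \<subseteq> {..<n}" "{0,2} \<subseteq> {..<n}" "{1,2} \<subseteq> {..<n}" "{0,1,2} \<subseteq> {..<n}"
    using n by auto
  note S = this[THEN integrable_prod_w] this[THEN moments]
  have I: "integrable M (w 0)" "integrable M (w 1)" "integrable M (w 2)" "integrable M (\<lambda>x. w 0 x * w 1 x)"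
     "integrable M (\<lambda>x. w 0 x * w 2 x)" "integrable M (\<lambda>x. w 1 x * w 2 x)" "integrable M (\<lambda>x. w 0 x * (w 1 x * w 2 x))"
    using S(1-7) by auto
  have E: "expectation (w 0) = 1" "expectation (w 1) = 1" "expectation (w 2) = 1" "expectation (\<lambda>x. w 0 x * w 1 x) = 1"
     "expectation (\<lambda>x. w 0 x * w 2 x) = 1" "expectation (\<lambda>x. w 1 x * w 2 x) = 1" "expectation (\<lambda>x. w 0 x * (w 1 x * w 2 x)) = 1"
    using S(8-14) by auto
  have eq: "(\<lambda>x. (p + q * w 0 x) * (p' + q' * w 1 x) * (p'' + q'' * w 2 x))
    = (\<lambda>x. p * p' * p'' + q * p' * p'' * w 0 x + p * q' * p'' * w 1 x + p * p' * q'' * w 2 x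
        + q * q' * p'' * (w 0 x * w 1 x) + q * p' * q'' * (w 0 x * w 2 x) + p * q' * q'' * (w 1 x * w 2 x)
        + q * q' * q'' * (w 0 x * (w 1 x * w 2 x)))"
    by (auto simp: algebra_simps)
  show "integrable M (\<lambda>x. (p + q * w 0 x) * (p' + q' * w 1 x) * (p'' + q'' * w 2 x))"
    unfolding eq using I by simp
  show "expectation (\<lambda>x. (p + q * w 0 x) * (p' + q' * w 1 x) * (p'' + q'' * w 2 x))
      = (p + q) * (p' + q') * (p'' + q'')"
    unfolding eq using I E by (simp add: prob_space algebra_simps)
qed

text \<open>Trilinear interpolation from the corners of the cube, evaluated at
  \<open>(1, 1, 1)\<close>. The result is the two-factor bound times
  \<open>(z^2 + 4 z + 1) / (z + 1)^2\<close>, and \<open>(z - 1)^2 \<ge> 0\<close> says that this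
  factor is at most \<open>3/2\<close>.\<close>

lemma expectation_abs_one_minus_prod3:
  assumes n: "3 \<le> n"
  shows "expectation (\<lambda>x. \<bar>1 - (\<Prod>i<3. w i x)\<bar>) \<le> 3 / 2 * ln z"
proof -
  have three: "{..<3} = {0, 1, 2::nat}" by auto
  define l where "l a = (a - 1 / z) / (z - 1 / z)" for a
  define r where "r a = (z - a) / (z - 1 / z)" for a
  have z: "0 < z - 1 / z" using z_gt_1 by (simp add: field_simps less_1_mult)
  have l': "l a = - (1 / z) / (z - 1 / z) + 1 / (z - 1 / z) * a"
   and r': "r a = z / (z - 1 / z) + (- 1 / (z - 1 / z)) * a" for a
    by (auto simp: l_def r_def diff_divide_distrib)
  \<comment> \<open>The values of \<open>l\<close> and \<open>r\<close> at 1, written as sums of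
    coefficients to match \<open>expectation_affine3\<close>.\<close>
  have l1: "- (1 / z) / (z - 1 / z) + 1 / (z - 1 / z) = 1 / (z + 1)" and r1: "z / (z - 1 / z) + (- 1 / (z - 1 / z)) = z / (z + 1)"
    using z_gt_1 z by (simp_all add: divide_simps) (simp_all add: algebra_simps)
  \<comment> \<open>At a corner the product of the three weights is \<open>z^3\<close>,
    \<open>z\<close>, \<open>1 / z\<close> or \<open>1 / z^3\<close>, according to the number of
    coordinates equal to \<open>z\<close>.\<close>
  let ?b = "\<lambda>x. (z ^ 3 - 1) * (l (w 0 x) * l (w 1 x) * l (w 2 x))
    + (z - 1) * (l (w 0 x) * l (w 1 x) * r (w 2 x)) + (z - 1) * (l (w 0 x) * r (w 1 x) * l (w 2 x)) + (z - 1) * (r (w 0 x) * l (w 1 x) * l (w 2 x))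
    + (1 - 1 / z) * (l (w 0 x) * r (w 1 x) * r (w 2 x)) + (1 - 1 / z) * (r (w 0 x) * l (w 1 x) * r (w 2 x)) + (1 - 1 / z) * (r (w 0 x) * r (w 1 x) * l (w 2 x))
    + (1 - 1 / z ^ 3) * (r (w 0 x) * r (w 1 x) * r (w 2 x))"
  have le: "\<bar>1 - (\<Prod>i<3. w i x)\<bar> \<le> ?b x" if x: "x \<in> space M" for x
  proof -
    define a b c where abc: "a = w 0 x" "b = w 1 x" "c = w 2 x"
    have bd: "1 / z \<le> a" "a \<le> z" "1 / z \<le> b" "b \<le> z" "1 / z \<le> c" "c \<le> z"
      using n x w_lower w_upper by (auto simp: abc)
    then have lr: "0 \<le> l a" "0 \<le> l b" "0 \<le> l c" "0 \<le> r a" "0 \<le> r b" "0 \<le> r c"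
      using z by (auto simp: l_def r_def)
    note ch = abs_one_minus_mult_le_chord[OF z_gt_1, folded l_def r_def]
    have 1: "\<bar>1 - c * y\<bar> \<le> l c * \<bar>1 - z * y\<bar> + r c * \<bar>1 - y / z\<bar>" for y using ch bd by auto
    have 2: "\<bar>1 - b * (c * y)\<bar> \<le> l b * (l c * \<bar>1 - z * (z * y)\<bar> + r c * \<bar>1 - (z * y) / z\<bar>) + r b * (l c * \<bar>1 - z * (y / z)\<bar> + r c * \<bar>1 - (y / z) / z\<bar>)" for y
    proof -
      have "\<bar>1 - b * (c * y)\<bar> \<le> l b * \<bar>1 - z * (c * y)\<bar> + r b * \<bar>1 - (c * y) / z\<bar>"
        using ch bd by auto
      also have "z * (c * y) = c * (z * y)" by simp
      also have "(c * y) / z = c * (y / z)" by simp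
      also have "l b * \<bar>1 - c * (z * y)\<bar> + r b * \<bar>1 - c * (y / z)\<bar> \<le> l b * (l c * \<bar>1 - z * (z * y)\<bar> + r c * \<bar>1 - (z * y) / z\<bar>) + r b * (l c * \<bar>1 - z * (y / z)\<bar> + r c * \<bar>1 - (y / z) / z\<bar>)"
        using lr by (intro add_mono mult_left_mono 1) auto
      finally show ?thesis .
    qed
    have "\<bar>1 - a * (b * c)\<bar> \<le> l a * \<bar>1 - z * (b * c)\<bar> + r a * \<bar>1 - (b * c) / z\<bar>"
      using ch bd by auto
    also have "z * (b * c) = b * (c * z)" by simp
    also have "(b * c) / z = b * (c * (1 / z))" by simp
    also have "l a * \<bar>1 - b * (c * z)\<bar> + r a * \<bar>1 - b * (c * (1 / z))\<bar> \<le>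
      l a * (l b * (l c * \<bar>1 - z * (z * z)\<bar> + r c * \<bar>1 - (z * z) / z\<bar>) + r b * (l c * \<bar>1 - z * (z / z)\<bar> + r c * \<bar>1 - (z / z) / z\<bar>))
      + r a * (l b * (l c * \<bar>1 - z * (z * (1 / z))\<bar> + r c * \<bar>1 - (z * (1 / z)) / z\<bar>) + r b * (l c * \<bar>1 - z * ((1 / z) / z)\<bar> + r c * \<bar>1 - ((1 / z) / z) / z\<bar>))"
      using lr by (intro add_mono mult_left_mono 2) auto
    also have "\<bar>1 - z * (z * z)\<bar> = z ^ 3 - 1" using z_gt_1 by (simp add: abs_if power3_eq_cube less_1_mult not_less mult.assoc less_imp_le)
    also have "\<bar>1 - (z * z) / z\<bar> = z - 1" using z_gt_1 by simp
    also have "\<bar>1 - z * (z / z)\<bar> = z - 1" using z_gt_1 by simp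
    also have "\<bar>1 - (z / z) / z\<bar> = 1 - 1 / z" using z_gt_1 by simp
    also have "\<bar>1 - z * (z * (1 / z))\<bar> = z - 1" using z_gt_1 by simp
    also have "\<bar>1 - (z * (1 / z)) / z\<bar> = 1 - 1 / z" using z_gt_1 by simp
    also have "\<bar>1 - z * ((1 / z) / z)\<bar> = 1 - 1 / z" using z_gt_1 by simp
    also have "\<bar>1 - ((1 / z) / z) / z\<bar> = 1 - 1 / z ^ 3" using z_gt_1 by (simp add: power3_eq_cube abs_if not_less divide_simps less_1_mult less_imp_le)
    also note calc = calculation
    have "(\<Prod>i<3. w i x) = a * (b * c)"
      by (simp add: abc three)
    with calc show ?thesis unfolding abc(1)[symmetric] abc(2)[symmetric] abc(3)[symmetric]
      by (simp add: algebra_simps)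
  qed
  note A = expectation_affine3[OF n]
  have bI: "integrable M ?b" unfolding l' r' by (intro Bochner_Integration.integrable_add integrable_mult_right A)
  have "expectation (\<lambda>x. \<bar>1 - (\<Prod>i<3. w i x)\<bar>) \<le> expectation ?b"
    using integrable_abs_one_minus[of "{..<3}"] n le by (intro integral_mono bI) auto
  also have "expectation ?b = (z ^ 3 - 1) * (1 / (z + 1)) ^ 3 + 3 * ((z - 1) * ((1 / (z + 1)) ^ 2 * (z / (z + 1))))
    + 3 * ((1 - 1 / z) * ((1 / (z + 1)) * (z / (z + 1)) ^ 2)) + (1 - 1 / z ^ 3) * (z / (z + 1)) ^ 3"
    unfolding l' r'
    apply (simp only: Bochner_Integration.integral_add Bochner_Integration.integrable_add integrable_mult_right A integral_mult_right_zero l1 r1)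
    apply (simp only: power2_eq_square power3_eq_cube mult.assoc mult.commute mult.left_commute)
    apply (simp add: algebra_simps add_divide_distrib[symmetric])
    done
  also have "\<dots> = 2 * (z - 1) / (z + 1) * ((z\<^sup>2 + 4 * z + 1) / (z + 1)\<^sup>2)"
  proof -
    define q where "q = 1 / (z + 1)"
    have q: "x / (z + 1) = x * q" "x / (z + 1)\<^sup>2 = x * q\<^sup>2" for x
      by (simp_all add: q_def power_divide)
    have "(1 - 1 / z) * (q * (z * q)\<^sup>2) = (z - 1) * z * q ^ 3" "(1 - 1 / z ^ 3) * (z * q) ^ 3 = (z ^ 3 - 1) * q ^ 3"
      using z_gt_1 by (simp_all add: field_simps power2_eq_square power3_eq_cube)
    then show ?thesis unfolding q by (simp add: algebra_simps power2_eq_square power3_eq_cube)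
  qed
  also have "\<dots> \<le> ln z * (3 / 2)"
  proof (intro mult_mono two_diff_quotient_le_ln)
    have "0 \<le> (z - 1)\<^sup>2" by simp
    then have "z * 2 \<le> 1 + z * z" by (simp add: power2_eq_square algebra_simps)
    then show "(z\<^sup>2 + 4 * z + 1) / (z + 1)\<^sup>2 \<le> 3 / 2"
      using z_gt_1 by (simp add: divide_simps) (simp add: algebra_simps power2_eq_square)
  qed (use z_gt_1 in auto)
  finally show ?thesis by simp
qed

text \<open>Telescoping over blocks of two factors; an odd number of factors needs one block of three.\<close>

lemma expectation_abs_one_minus_prod_le:
  assumes "2 \<le> m" "m \<le> n"
  shows "expectation (\<lambda>x. \<bar>1 - (\<Prod>i<m. w i x)\<bar>) \<le> real m / 2 * ln z"
  using assms
proof (induction m rule: less_induct)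
  case (less m)
  consider "m = 2" | "m = 3" | "4 \<le> m" using less.prems by linarith
  then show ?case
  proof cases
    case 1
    have two: "{..<2} = {0, 1::nat}" by auto
    from 1 show ?thesis
      using expectation_prod_abs_one_minus_mult_le(2)[of "{}" 0 1] less.prems
      by (simp add: two)
  next
    case 2
    then show ?thesis using expectation_abs_one_minus_prod3 less.prems by simp
  next
    case 3
    define l where "l = m - 2"
    have m: "m = Suc (Suc l)" "2 \<le> l" "l < m" "Suc l < n" "l < n" "l \<le> n" using 3 less.prems by (auto simp: l_def)
    let ?q = "\<lambda>x. \<Prod>i<l. w i x"
    have sub: "{..<l} \<subseteq> {..<n}" "{..<m} \<subseteq> {..<n}" using m less.prems by auto
    note B = expectation_prod_abs_one_minus_mult_le[OF sub(1), of l "Suc l"]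
    have "expectation (\<lambda>x. \<bar>1 - (\<Prod>i<m. w i x)\<bar>)
      \<le> expectation (\<lambda>x. \<bar>1 - ?q x\<bar> + ?q x * \<bar>1 - w l x * w (Suc l) x\<bar>)"
    proof (rule integral_mono)
      show "integrable M (\<lambda>x. \<bar>1 - (\<Prod>i<m. w i x)\<bar>)" using sub integrable_abs_one_minus by auto
      show "integrable M (\<lambda>x. \<bar>1 - ?q x\<bar> + ?q x * \<bar>1 - w l x * w (Suc l) x\<bar>)"
        using B(1) sub m integrable_abs_one_minus by auto
      fix x assume x: "x \<in> space M"
      have "1 - (\<Prod>i<m. w i x) = (1 - ?q x) + ?q x * (1 - w l x * w (Suc l) x)"
        by (simp add: m algebra_simps)
      also have "\<bar>\<dots>\<bar> \<le> \<bar>1 - ?q x\<bar> + \<bar>?q x * (1 - w l x * w (Suc l) x)\<bar>" by (rule abs_triangle_ineq)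
      also have "\<bar>?q x * (1 - w l x * w (Suc l) x)\<bar> = ?q x * \<bar>1 - w l x * w (Suc l) x\<bar>"
        using prod_w_nonneg[OF sub(1) x] by (simp add: abs_mult)
      finally show "\<bar>1 - (\<Prod>i<m. w i x)\<bar> \<le> \<bar>1 - ?q x\<bar> + ?q x * \<bar>1 - w l x * w (Suc l) x\<bar>" .
    qed
    also have "\<dots> = expectation (\<lambda>x. \<bar>1 - ?q x\<bar>) + expectation (\<lambda>x. ?q x * \<bar>1 - w l x * w (Suc l) x\<bar>)"
      using B(1) sub m integrable_abs_one_minus by (intro Bochner_Integration.integral_add) auto
    also have "\<dots> \<le> real l / 2 * ln z + ln z"
      using B(2) m less.IH[of l] by (intro add_mono) auto
    finally show ?thesis by (simp add: m field_simps)
  qed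
qed

end

section \<open>Variance of a bounded weight of mean one\<close>

context prob_space
begin

text \<open>Bhatia--Davis: the expectation of \<open>(exp k - \<omega>) (\<omega> - exp (- k))\<close> is nonnegative.\<close>

lemma expectation_square_weight_le:
  fixes \<omega> :: "'a \<Rightarrow> real" and k :: real
  assumes [measurable]: "\<omega> \<in> borel_measurable M"
    and bounds: "\<And>x. x \<in> space M \<Longrightarrow> exp (- k) \<le> \<omega> x" "\<And>x. x \<in> space M \<Longrightarrow> \<omega> x \<le> exp k"
    and E: "expectation \<omega> = 1"
  shows "integrable M \<omega>" "integrable M (\<lambda>x. (\<omega> x)\<^sup>2)"
    and "expectation (\<lambda>x. (\<omega> x)\<^sup>2) \<le> exp k + exp (- k) - 1"
proof -
  have pos: "0 < \<omega> x" if "x \<in> space M" for x using bounds(1)[OF that] less_le_trans[OF exp_gt_zero] by blast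
  show i1: "integrable M \<omega>"
    using bounds pos by (intro integrable_const_bound[where B="exp k"] AE_I2) (auto simp: less_imp_le)
  show i2: "integrable M (\<lambda>x. (\<omega> x)\<^sup>2)"
    using bounds pos by (intro integrable_const_bound[where B="(exp k)\<^sup>2"] AE_I2) (auto intro!: power_mono simp: less_imp_le)
  have "0 \<le> expectation (\<lambda>x. (exp k - \<omega> x) * (\<omega> x - exp (- k)))"
    using bounds by (intro integral_nonneg_AE AE_I2 mult_nonneg_nonneg) auto
  also have "(\<lambda>x. (exp k - \<omega> x) * (\<omega> x - exp (- k))) = (\<lambda>x. (exp k + exp (- k)) * \<omega> x - 1 - (\<omega> x)\<^sup>2)"
    by (auto simp: algebra_simps power2_eq_square exp_minus_inverse)
  finally show "expectation (\<lambda>x. (\<omega> x)\<^sup>2) \<le> exp k + exp (- k) - 1"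
    using i1 i2 E by (simp add: prob_space)
qed

text \<open>Two regimes. For \<open>k \<le> 1\<close> the range of the weight alone gives a variance
  of order \<open>k^2\<close>; for larger \<open>k\<close> the bound \<open>W\<close> is used, which
  fits because \<open>1 \<le> k^2\<close>. The last claim covers both at once. \<open>W\<close> is
  nonnegative because it bounds a variance.\<close>

lemma expectation_one_minus_weight_square:
  fixes \<omega> :: "'a \<Rightarrow> real" and k W :: real
  assumes meas: "\<omega> \<in> borel_measurable M" and k: "0 \<le> k"
    and bounds: "\<And>x. x \<in> space M \<Longrightarrow> exp (- k) \<le> \<omega> x" "\<And>x. x \<in> space M \<Longrightarrow> \<omega> x \<le> exp k"
    and E: "expectation \<omega> = 1" and W: "expectation (\<lambda>x. (\<omega> x)\<^sup>2) \<le> 1 + W"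
  shows "integrable M (\<lambda>x. (1 - \<omega> x)\<^sup>2)"
    and "expectation (\<lambda>x. (1 - \<omega> x)\<^sup>2) = expectation (\<lambda>x. (\<omega> x)\<^sup>2) - 1"
    and "expectation (\<lambda>x. (1 - \<omega> x)\<^sup>2) \<le> W"
    and "k \<le> 1 \<Longrightarrow> expectation (\<lambda>x. (1 - \<omega> x)\<^sup>2) \<le> 123/100 * k\<^sup>2"
    and "0 \<le> W" and "expectation (\<lambda>x. (1 - \<omega> x)\<^sup>2) \<le> 2 * k\<^sup>2 * (1 + W)"
proof -
  note B = expectation_square_weight_le[OF meas bounds E]
  have eq: "(\<lambda>x. (1 - \<omega> x)\<^sup>2) = (\<lambda>x. 1 - 2 * \<omega> x + (\<omega> x)\<^sup>2)"
    by (auto simp: power2_eq_square algebra_simps)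
  show "integrable M (\<lambda>x. (1 - \<omega> x)\<^sup>2)" unfolding eq using B by auto
  show e: "expectation (\<lambda>x. (1 - \<omega> x)\<^sup>2) = expectation (\<lambda>x. (\<omega> x)\<^sup>2) - 1"
    unfolding eq using B E by (simp add: prob_space)
  show le: "expectation (\<lambda>x. (1 - \<omega> x)\<^sup>2) \<le> W" using e W by simp
  show le1: "expectation (\<lambda>x. (1 - \<omega> x)\<^sup>2) \<le> 123/100 * k\<^sup>2" if "k \<le> 1"
    using e B(3) exp_plus_exp_minus_le[OF k that] by linarith
  have "0 \<le> expectation (\<lambda>x. (1 - \<omega> x)\<^sup>2)" by simp
  with le show W0: "0 \<le> W" by linarith
  show "expectation (\<lambda>x. (1 - \<omega> x)\<^sup>2) \<le> 2 * k\<^sup>2 * (1 + W)"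
  proof (cases "k \<le> 1")
    case True
    have "123/100 * k\<^sup>2 * 1 \<le> 2 * k\<^sup>2 * (1 + W)"
      using W0 by (intro mult_mono) auto
    with le1[OF True] show ?thesis by simp
  next
    case False
    then have "1 \<le> k\<^sup>2" by (simp add: one_le_power)
    then have "1 * W \<le> 2 * k\<^sup>2 * (1 + W)" using W0 by (intro mult_mono) auto
    with le show ?thesis by simp
  qed
qed

end

text \<open>The middle term is written with \<open>inner (g - g') (g + g')\<close> to expose
  \<open>g - g'\<close>, which a Lipschitz bound makes small. No inequality is spent on splitting
  the square.\<close>

lemma norm_square_diff_scaled:
  fixes g g' :: "'v::real_inner"
  shows "(norm (g - u *\<^sub>R g'))\<^sup>2
    = u * (norm (g - g'))\<^sup>2 + (1 - u) * inner (g - g') (g + g') + (1 - u)\<^sup>2 * (norm g')\<^sup>2"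
  unfolding power2_norm_eq_inner
  by (simp add: power2_eq_square inner_diff_left inner_diff_right inner_add_left
      inner_add_right inner_commute algebra_simps)

section \<open>Second moment of the weighted difference\<close>

context prob_space
begin

text \<open>After integration the three terms are at most \<open>l^2\<close>, \<open>2 C l\<close>
  times the mean of \<open>|1 - \<omega>|\<close>, and \<open>C^2\<close> times the variance. The
  hypothesis \<open>abs\<close> is tuned to turn the second into \<open>k C l\<close>.\<close>

lemma expectation_norm_square_weighted_difference_le:
  fixes g g' :: "'a \<Rightarrow> 'v::euclidean_space" and \<omega> :: "'a \<Rightarrow> real" and k W C l :: real
  assumes meas [measurable]: "\<omega> \<in> borel_measurable M" "g \<in> borel_measurable M" "g' \<in> borel_measurable M"
    and k: "0 \<le> k"
    and bounds: "\<And>x. x \<in> space M \<Longrightarrow> exp (- k) \<le> \<omega> x" "\<And>x. x \<in> space M \<Longrightarrow> \<omega> x \<le> exp k"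
    and E: "expectation \<omega> = 1" and W: "expectation (\<lambda>x. (\<omega> x)\<^sup>2) \<le> 1 + W"
    and g: "\<And>x. x \<in> space M \<Longrightarrow> norm (g x) \<le> C" and g': "\<And>x. x \<in> space M \<Longrightarrow> norm (g' x) \<le> C"
    and l: "\<And>x. x \<in> space M \<Longrightarrow> norm (g x - g' x) \<le> l"
    and abs: "expectation (\<lambda>x. \<bar>1 - \<omega> x\<bar>) \<le> k / 2"
  shows "expectation (\<lambda>x. (norm (g x - \<omega> x *\<^sub>R g' x))\<^sup>2) \<le> l\<^sup>2 + (k * C * l + 2 * k\<^sup>2 * C\<^sup>2) * (1 + W)"
proof -
  note B = expectation_square_weight_le[OF meas(1) bounds E]
  note B' = expectation_one_minus_weight_square[OF meas(1) k bounds E W]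
  obtain x0 where "x0 \<in> space M" using not_empty by blast
  then have C: "0 \<le> C" and l0: "0 \<le> l" using g[of x0] l[of x0] norm_ge_zero order_trans by blast+
  have pos: "0 < \<omega> x" if "x \<in> space M" for x using bounds(1)[OF that] less_le_trans[OF exp_gt_zero] by blast
  let ?b = "\<lambda>x. l\<^sup>2 * \<omega> x + 2 * C * l * \<bar>1 - \<omega> x\<bar> + C\<^sup>2 * (1 - \<omega> x)\<^sup>2"
  have le: "(norm (g x - \<omega> x *\<^sub>R g' x))\<^sup>2 \<le> ?b x" if x: "x \<in> space M" for x
  proof -
    have "(1 - \<omega> x) * inner (g x - g' x) (g x + g' x) \<le> \<bar>1 - \<omega> x\<bar> * \<bar>inner (g x - g' x) (g x + g' x)\<bar>"
      by (metis abs_ge_self abs_mult)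
    also have "\<dots> \<le> \<bar>1 - \<omega> x\<bar> * (norm (g x - g' x) * norm (g x + g' x))"
      by (intro mult_left_mono Cauchy_Schwarz_ineq2) auto
    also have "\<dots> \<le> \<bar>1 - \<omega> x\<bar> * (l * (C + C))"
      using l[OF x] g[OF x] g'[OF x] l0 by (intro mult_left_mono mult_mono norm_triangle_mono) auto
    finally have 1: "(1 - \<omega> x) * inner (g x - g' x) (g x + g' x) \<le> 2 * C * l * \<bar>1 - \<omega> x\<bar>"
      by (simp add: algebra_simps)
    have 2: "\<omega> x * (norm (g x - g' x))\<^sup>2 \<le> \<omega> x * l\<^sup>2"
      using l[OF x] pos[OF x] by (intro mult_left_mono power_mono) auto
    have 3: "(1 - \<omega> x)\<^sup>2 * (norm (g' x))\<^sup>2 \<le> (1 - \<omega> x)\<^sup>2 * C\<^sup>2"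
      using g'[OF x] by (intro mult_left_mono power_mono) auto
    show ?thesis unfolding norm_square_diff_scaled using 1 2 3 by (simp add: algebra_simps)
  qed
  have I: "integrable M ?b" using B B' by auto
  have "expectation (\<lambda>x. (norm (g x - \<omega> x *\<^sub>R g' x))\<^sup>2) \<le> expectation ?b"
  proof (rule integral_mono[OF _ I le])
    show "integrable M (\<lambda>x. (norm (g x - \<omega> x *\<^sub>R g' x))\<^sup>2)"
      using le by (intro Bochner_Integration.integrable_bound[OF I]) (auto intro!: AE_I2 order_trans[OF _ abs_ge_self])
  qed
  also have "\<dots> = l\<^sup>2 + 2 * C * l * expectation (\<lambda>x. \<bar>1 - \<omega> x\<bar>) + C\<^sup>2 * expectation (\<lambda>x. (1 - \<omega> x)\<^sup>2)"
    using B B' E by simp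
  also have "\<dots> \<le> l\<^sup>2 + 2 * C * l * (k / 2) + C\<^sup>2 * (2 * k\<^sup>2 * (1 + W))"
    using abs B'(6) C l0 by (intro add_mono mult_left_mono) auto
  also have "\<dots> \<le> l\<^sup>2 + (k * C * l) * (1 + W) + C\<^sup>2 * (2 * k\<^sup>2 * (1 + W))"
  proof -
    have "(k * C * l) * 1 \<le> (k * C * l) * (1 + W)" using B'(5) k C l0 by (intro mult_left_mono) auto
    then show ?thesis by (simp add: mult.commute mult.left_commute)
  qed
  finally show ?thesis by (simp add: algebra_simps)
qed

end

text \<open>The term \<open>k * inner e Z\<close> has expectation zero and compensates the correlation between the change of
  the score and the importance weight.\<close>

lemma single_step_pointwise:
  fixes a a' e :: "'v::real_inner" and u k x :: real
  assumes k: "0 \<le> k" "k \<le> 1" and e: "norm e = 1" and a: "norm a \<le> 1" "norm a' \<le> 1" and x: "norm (a - a') \<le> x"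
    and u: "exp (- k) \<le> u" "u \<le> exp k"
    and err: "\<bar>ln u - k * inner e ((a + a') /\<^sub>R 2)\<bar> \<le> k / 2 * sqrt (x\<^sup>2 - (norm (a - a'))\<^sup>2)"
  shows "(norm (a - u *\<^sub>R a'))\<^sup>2 + k * inner e (a - u *\<^sub>R a')
    \<le> x\<^sup>2 * u + (1 - u)\<^sup>2 + x * k / 2 * (1 + u) + 3/4 * k\<^sup>2"
proof -
  \<comment> \<open>Midpoint and difference of the scores: the hypothesis \<open>err\<close> speaks
    about \<open>s\<close>, while the cross terms to be bounded contain \<open>D\<close>.\<close>
  define s where "s = (a + a') /\<^sub>R 2"
  define D where "D = a - a'"
  define eps where "eps = sqrt (x\<^sup>2 - (norm D)\<^sup>2)"
  define r where "r = ln u - k * inner e s"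
  have u0: "0 < u" using u(1) less_le_trans[OF exp_gt_zero] by blast
  obtain c where c: "0 \<le> c" "c \<le> 1" "2 * (u - 1) / (u + 1) = c * ln u" using ln_scaled_tanh[OF u0] .
  define p where "p = inner e s"
  have r: "\<bar>r\<bar> \<le> k / 2 * eps" "ln u = k * p + r" using err by (auto simp: r_def eps_def s_def D_def p_def)
  have u1: "1 - u = - (c * ln u * (1 + u) / 2)" using c(3) u0 by (simp add: field_simps)
  have D0: "norm D \<le> x" "0 \<le> x" using x order_trans[OF norm_ge_zero x] by (auto simp: D_def)
  have eps2: "eps\<^sup>2 = x\<^sup>2 - (norm D)\<^sup>2" "0 \<le> eps" using D0 by (auto simp: eps_def power_mono)
  have s1: "norm s \<le> 1" using norm_triangle_le[of a a' 2] a by (simp add: s_def)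
  have p1: "\<bar>p\<bar> \<le> 1" using Cauchy_Schwarz_ineq2[of e s] e s1 by (simp add: p_def)
  have aa: "a = s + D /\<^sub>R 2" "a' = s - D /\<^sub>R 2"
    by (simp_all add: s_def D_def algebra_simps scaleR_2[symmetric] flip: scaleR_add_left)
  \<comment> \<open>The parallelogram law bounds \<open>(norm D)^2 + 4 * (norm s)^2\<close> by 4,
    and the arithmetic-geometric mean inequality passes to the product.\<close>
  have Ds: "norm D * norm s \<le> 1"
  proof -
    have "(norm D)\<^sup>2 + 4 * (norm s)\<^sup>2 = 2 * (norm a)\<^sup>2 + 2 * (norm a')\<^sup>2"
      unfolding aa by (simp add: power2_norm_eq_inner inner_add_left inner_add_right inner_diff_left inner_diff_right inner_commute)
    also have "\<dots> \<le> 2 * 1 + 2 * 1"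
      using a by (intro add_mono mult_left_mono) (auto simp: power_le_one)
    finally have "(norm D)\<^sup>2 + 4 * (norm s)\<^sup>2 \<le> 4" by simp
    moreover have "0 \<le> (norm D - 2 * norm s)\<^sup>2" by simp
    ultimately show ?thesis by (simp add: power2_eq_square algebra_simps)
  qed
  \<comment> \<open>\<open>?v\<close> is what pairs with \<open>D\<close> up to the remainder
    \<open>r\<close>. Without the compensator there would only be \<open>c * k * p\<close> times
    \<open>s\<close>, of norm up to \<open>k\<close>. Subtracting it from \<open>k / 2\<close> times
    \<open>e\<close> leaves norm at most \<open>k / 2\<close>, because \<open>p\<close> is the
    component of \<open>s\<close> along \<open>e\<close>.\<close>
  let ?v = "(k / 2) *\<^sub>R e - (c * k * p) *\<^sub>R s"
  have v: "norm ?v \<le> k / 2"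
  proof (rule power2_le_imp_le)
    have "(norm ?v)\<^sup>2 = k\<^sup>2 / 4 * (norm e)\<^sup>2 - c * k\<^sup>2 * p\<^sup>2 + c\<^sup>2 * k\<^sup>2 * p\<^sup>2 * (norm s)\<^sup>2"
      unfolding power2_norm_eq_inner
      by (simp add: inner_diff_left inner_diff_right inner_commute p_def power2_eq_square algebra_simps)
    also have "\<dots> = k\<^sup>2 / 4 - c * k\<^sup>2 * p\<^sup>2 * (1 - c * (norm s)\<^sup>2)"
      using e by (simp add: power2_eq_square algebra_simps)
    also have "\<dots> \<le> k\<^sup>2 / 4"
    proof -
      have "c * (norm s)\<^sup>2 \<le> 1 * 1" using c s1 by (intro mult_mono) (auto simp: power_le_one)
      then show ?thesis using c by (simp add: mult_nonneg_nonneg)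
    qed
    finally show "(norm ?v)\<^sup>2 \<le> (k / 2)\<^sup>2" by (simp add: power_divide)
  qed (use k in auto)
  \<comment> \<open>The remainder enters twice: paired with \<open>D\<close> it costs
    \<open>k / 2 * eps\<close>, paired with \<open>p\<close> it costs \<open>k / 4 * eps\<close>.
    The term quadratic in \<open>p\<close> has the favourable sign and is dropped.\<close>
  have main: "inner D ?v - c * r * inner D s - k / 2 * c * (k * p + r) * p \<le> x * k / 2 + 3/4 * k * eps"
  proof -
    have "inner D ?v \<le> norm D * norm ?v" by (rule norm_cauchy_schwarz)
    also have "\<dots> \<le> x * (k / 2)" using D0 v by (intro mult_mono) auto
    finally have 1: "inner D ?v \<le> x * (k / 2)" .
    have "- (c * r * inner D s) \<le> \<bar>c * r * inner D s\<bar>" by (metis abs_ge_minus_self)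
    also have "\<dots> = c * \<bar>r\<bar> * \<bar>inner D s\<bar>" using c by (simp add: abs_mult)
    also have "\<dots> \<le> 1 * (k / 2 * eps) * 1"
      using c r(1) Ds Cauchy_Schwarz_ineq2[of D s] k eps2 by (intro mult_mono) auto
    finally have 2: "- (c * r * inner D s) \<le> k / 2 * eps" by simp
    have "- (k / 2 * c * r * p) \<le> \<bar>k / 2 * c * r * p\<bar>" by (metis abs_ge_minus_self)
    also have "\<dots> = k / 2 * c * \<bar>r\<bar> * \<bar>p\<bar>" using c k by (simp add: abs_mult)
    also have "\<dots> \<le> 1 / 2 * 1 * (k / 2 * eps) * 1"
      using c r(1) p1 k eps2 by (intro mult_mono) auto
    finally have 3: "- (k / 2 * c * r * p) \<le> k / 4 * eps" by simp
    have 4: "0 \<le> k / 2 * c * (k * p\<^sup>2)" using c k by (intro mult_nonneg_nonneg) auto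
    have 5: "k / 2 * c * (k * p + r) * p = k / 2 * c * (k * p\<^sup>2) + k / 2 * c * r * p"
      by (simp add: power2_eq_square algebra_simps)
    have "x * (k / 2) = x * k / 2" "k / 2 * eps + k / 4 * eps = 3/4 * k * eps" by simp_all
    then show ?thesis using 1 2 3 4 unfolding 5 by linarith
  qed
  have "(norm (a - u *\<^sub>R a'))\<^sup>2 + k * inner e (a - u *\<^sub>R a')
     = u * (norm D)\<^sup>2 + (1 - u)\<^sup>2 * (norm a')\<^sup>2 + ((1 - u) * inner D (a + a') + k * inner e (a - u *\<^sub>R a'))"
    unfolding norm_square_diff_scaled D_def[symmetric] by simp
  also have "(1 - u) * inner D (a + a') + k * inner e (a - u *\<^sub>R a')
     = (1 + u) * (inner D ?v - c * r * inner D s - k / 2 * c * (k * p + r) * p)"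
  proof -
    have "a + a' = 2 *\<^sub>R s" by (simp add: s_def)
    moreover have "a - u *\<^sub>R a' = ((1 + u) / 2) *\<^sub>R D + (1 - u) *\<^sub>R s"
      unfolding aa by (simp add: algebra_simps add_divide_distrib)
    ultimately have "(1 - u) * inner D (a + a') + k * inner e (a - u *\<^sub>R a')
      = 2 * (1 - u) * inner D s + k * ((1 + u) / 2 * inner e D + (1 - u) * p)"
      by (simp add: inner_add_right p_def)
    also have "\<dots> = (1 + u) * (- (c * ln u) * inner D s + k / 2 * inner e D - k / 2 * (c * ln u) * p)"
      unfolding u1 by (simp add: field_simps)
    finally have "(1 - u) * inner D (a + a') + k * inner e (a - u *\<^sub>R a')
      = (1 + u) * (- (c * ln u) * inner D s + k / 2 * inner e D - k / 2 * (c * ln u) * p)" .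
    moreover have "inner D ?v = k / 2 * inner e D - c * k * p * inner D s"
      by (simp add: inner_diff_right inner_commute)
    moreover have "k / 2 * (c * ln u) * p = k / 2 * c * ln u * p" "c * ln u * inner D s = c * k * p * inner D s + c * r * inner D s"
      unfolding r(2) by (simp_all add: algebra_simps)
    ultimately show ?thesis unfolding r(2) by simp
  qed
  also have "(1 + u) * (inner D ?v - c * r * inner D s - k / 2 * c * (k * p + r) * p)
     \<le> (1 + u) * (x * k / 2 + 3/4 * k * eps)"
    using main u0 by (intro mult_left_mono) auto
  also have "(1 - u)\<^sup>2 * (norm a')\<^sup>2 \<le> (1 - u)\<^sup>2 * 1"
    using a by (intro mult_left_mono) (auto simp: power_le_one)
  finally have A: "(norm (a - u *\<^sub>R a'))\<^sup>2 + k * inner e (a - u *\<^sub>R a')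
    \<le> u * (norm D)\<^sup>2 + (1 - u)\<^sup>2 + (1 + u) * (x * k / 2 + 3/4 * k * eps)" by simp
  \<comment> \<open>From the range of \<open>u\<close>,
    \<open>u + 1 / u \<le> exp k + exp (- k) \<le> 3.23\<close>.\<close>
  have u2: "(1 + u)\<^sup>2 \<le> u * (523/100)"
  proof -
    have "0 \<le> (exp k - u) * (u - exp (- k))" using u by simp
    then have "u\<^sup>2 + 1 \<le> u * (exp k + exp (- k))" by (simp add: algebra_simps power2_eq_square exp_minus_inverse)
    also have "\<dots> \<le> u * (323/100)"
    proof -
      have "k\<^sup>2 \<le> 1" using k by (simp add: power_le_one)
      then show ?thesis using exp_plus_exp_minus_le[OF k] u0 by (intro mult_left_mono) auto
    qed
    finally show ?thesis by (simp add: power2_eq_square algebra_simps)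
  qed
  \<comment> \<open>Young's inequality, multiplied by \<open>u\<close> beforehand so that
    \<open>(1 + u)^2\<close> can be replaced by \<open>5.23 * u\<close>. The term
    \<open>u * eps^2\<close> is precisely the slack between \<open>u * (norm D)^2\<close> and
    \<open>u * x^2\<close>; what remains is \<open>9/64 * 5.23 < 3/4\<close> times
    \<open>k^2\<close>.\<close>
  have "(1 + u) * (3/4 * k * eps) * u = 2 * (u * eps) * (3/8 * k * (1 + u))" by simp
  also have "\<dots> \<le> (u * eps)\<^sup>2 + (3/8 * k * (1 + u))\<^sup>2" by (rule sum_squares_bound)
  also have "\<dots> = (u * eps\<^sup>2) * u + 9/64 * k\<^sup>2 * (1 + u)\<^sup>2"
    by (simp add: power_mult_distrib) (simp add: power2_eq_square)
  also have "\<dots> \<le> (u * eps\<^sup>2) * u + 9/64 * k\<^sup>2 * (u * (523/100))"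
    using u2 by (intro add_left_mono mult_left_mono) auto
  also have "\<dots> = (u * eps\<^sup>2 + 9/64 * k\<^sup>2 * (523/100)) * u" by (simp add: distrib_right)
  finally have "(1 + u) * (3/4 * k * eps) \<le> u * eps\<^sup>2 + 9/64 * k\<^sup>2 * (523/100)"
    using u0 by (simp only: mult_le_cancel_right_pos)
  moreover have "9/64 * k\<^sup>2 * (523/100) \<le> 3/4 * k\<^sup>2" by simp
  ultimately have "(1 + u) * (3/4 * k * eps) \<le> u * eps\<^sup>2 + 3/4 * k\<^sup>2" by linarith
  then show ?thesis using A unfolding eps2 by (simp add: algebra_simps)
qed

context prob_space
begin

text \<open>For \<open>k \<le> 1\<close> the pointwise inequality is integrated; the compensator
  vanishes since \<open>a\<close> and the weighted \<open>a'\<close> both have mean zero. The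
  variance \<open>1.23 * k^2\<close> and the extra \<open>3/4 * k^2\<close> together stay within
  \<open>2 * k^2\<close>. For \<open>k > 1\<close> the triangle inequality and the variance bound
  \<open>W\<close> suffice.\<close>

lemma expectation_norm_square_single_step_le:
  fixes a a' :: "'a \<Rightarrow> 'v::euclidean_space" and e :: 'v and \<omega> :: "'a \<Rightarrow> real" and k W x :: real
  assumes meas [measurable]: "\<omega> \<in> borel_measurable M" "a \<in> borel_measurable M" "a' \<in> borel_measurable M"
    and k: "0 \<le> k"
    and bounds: "\<And>y. y \<in> space M \<Longrightarrow> exp (- k) \<le> \<omega> y" "\<And>y. y \<in> space M \<Longrightarrow> \<omega> y \<le> exp k"
    and E: "expectation \<omega> = 1" and W: "expectation (\<lambda>y. (\<omega> y)\<^sup>2) \<le> 1 + W"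
    and a: "\<And>y. y \<in> space M \<Longrightarrow> norm (a y) \<le> 1" and a': "\<And>y. y \<in> space M \<Longrightarrow> norm (a' y) \<le> 1"
    and x: "\<And>y. y \<in> space M \<Longrightarrow> norm (a y - a' y) \<le> x"
    and e: "norm e = 1"
    and Ea: "expectation a = 0" and Ea': "expectation (\<lambda>y. \<omega> y *\<^sub>R a' y) = 0"
    and err: "\<And>y. y \<in> space M \<Longrightarrow> \<bar>ln (\<omega> y) - k * inner e ((a y + a' y) /\<^sub>R 2)\<bar>
                \<le> k / 2 * sqrt (x\<^sup>2 - (norm (a y - a' y))\<^sup>2)"
  shows "expectation (\<lambda>y. (norm (a y - \<omega> y *\<^sub>R a' y))\<^sup>2) \<le> x\<^sup>2 + (x * k + 2 * k\<^sup>2) * (1 + W)"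
    and "integrable M (\<lambda>y. (norm (a y - \<omega> y *\<^sub>R a' y))\<^sup>2)"
proof -
  note B = expectation_square_weight_le[OF meas(1) bounds E]
  note B' = expectation_one_minus_weight_square[OF meas(1) k bounds E W]
  obtain y0 where "y0 \<in> space M" using not_empty by blast
  then have x0: "0 \<le> x" using x[of y0] norm_ge_zero order_trans by blast
  have pos: "0 < \<omega> y" if "y \<in> space M" for y using bounds(1)[OF that] less_le_trans[OF exp_gt_zero] by blast
  let ?Z = "\<lambda>y. a y - \<omega> y *\<^sub>R a' y"
  have Ia: "integrable M a" using a by (intro integrable_const_bound[where B=1] AE_I2) auto
  have Ia': "integrable M (\<lambda>y. \<omega> y *\<^sub>R a' y)"
    using a' pos by (intro Bochner_Integration.integrable_bound[OF B(1)]) (auto intro!: AE_I2 mult_left_le simp: less_imp_le)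
  have IZ: "integrable M ?Z" using Ia Ia' by auto
  have EZ: "expectation (\<lambda>y. inner e (?Z y)) = 0"
    using Ia Ia' Ea Ea' by (simp add: integral_inner_right)
  \<comment> \<open>\<open>2 * |1 - \<omega>| \<le> 1 + (1 - \<omega>)^2\<close> trades the absolute
    moment for the variance, so the cross term has mean at most \<open>x * (1 + W)\<close>.\<close>
  let ?b1 = "\<lambda>y. x\<^sup>2 + x * (1 + (1 - \<omega> y)\<^sup>2) + (1 - \<omega> y)\<^sup>2"
  have le1: "(norm (?Z y))\<^sup>2 \<le> ?b1 y" if y: "y \<in> space M" for y
  proof -
    have "?Z y = (a y - a' y) + (1 - \<omega> y) *\<^sub>R a' y" by (simp add: algebra_simps)
    also have "norm \<dots> \<le> norm (a y - a' y) + \<bar>1 - \<omega> y\<bar> * norm (a' y)"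
      by (metis norm_triangle_ineq norm_scaleR)
    also have "\<dots> \<le> x + \<bar>1 - \<omega> y\<bar>"
      using x[OF y] a'[OF y] by (intro add_mono mult_left_le) auto
    finally have "(norm (?Z y))\<^sup>2 \<le> (x + \<bar>1 - \<omega> y\<bar>)\<^sup>2" by (intro power_mono) auto
    also have "\<dots> = x\<^sup>2 + x * (2 * \<bar>1 - \<omega> y\<bar>) + (1 - \<omega> y)\<^sup>2" by (simp add: power2_eq_square algebra_simps)
    also have "2 * \<bar>1 - \<omega> y\<bar> \<le> 1 + (1 - \<omega> y)\<^sup>2"
      using zero_le_power2[of "1 - \<bar>1 - \<omega> y\<bar>"] by (simp add: power2_eq_square algebra_simps)
    finally show ?thesis using x0 by (simp add: mult_left_mono)
  qed
  have I1: "integrable M ?b1" using B' by auto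
  show I: "integrable M (\<lambda>y. (norm (?Z y))\<^sup>2)"
    using le1 by (intro Bochner_Integration.integrable_bound[OF I1]) (auto intro!: AE_I2 order_trans[OF _ abs_ge_self])
  show "expectation (\<lambda>y. (norm (?Z y))\<^sup>2) \<le> x\<^sup>2 + (x * k + 2 * k\<^sup>2) * (1 + W)"
  proof (cases "k \<le> 1")
    case False
    have "expectation (\<lambda>y. (norm (?Z y))\<^sup>2) \<le> expectation ?b1"
      by (intro integral_mono I I1 le1)
    also have "\<dots> \<le> x\<^sup>2 + x * (1 + W) + W"
    proof -
      have "x * expectation (\<lambda>y. (1 - \<omega> y)\<^sup>2) \<le> x * W" using B'(3) x0 by (intro mult_left_mono)
      then show ?thesis using B'(1,3) by (simp add: prob_space algebra_simps)
    qed
    also have "\<dots> \<le> x\<^sup>2 + x * k * (1 + W) + 2 * k\<^sup>2 * (1 + W)"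
    proof -
      have "1 \<le> k\<^sup>2" using False by (simp add: one_le_power)
      then have "1 * W \<le> 2 * k\<^sup>2 * (1 + W)" using B'(5) by (intro mult_mono) auto
      moreover have "x * 1 * (1 + W) \<le> x * k * (1 + W)" using False x0 B'(5) by (intro mult_mono) auto
      ultimately show ?thesis by simp
    qed
    finally show ?thesis by (simp add: algebra_simps)
  next
    case True
    let ?b2 = "\<lambda>y. x\<^sup>2 * \<omega> y + (1 - \<omega> y)\<^sup>2 + x * k / 2 * (1 + \<omega> y) + 3/4 * k\<^sup>2"
    have "expectation (\<lambda>y. (norm (?Z y))\<^sup>2) = expectation (\<lambda>y. (norm (?Z y))\<^sup>2 + k * inner e (?Z y))"
      using I IZ EZ by simp
    also have "\<dots> \<le> expectation ?b2"
      using I IZ B B' by (intro integral_mono single_step_pointwise k True e a a' x bounds err) auto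
    also have "\<dots> = x\<^sup>2 + expectation (\<lambda>y. (1 - \<omega> y)\<^sup>2) + x * k + 3/4 * k\<^sup>2"
      using B B' E by (simp add: prob_space)
    also have "\<dots> \<le> x\<^sup>2 + 123/100 * k\<^sup>2 + x * k + 3/4 * k\<^sup>2" using B'(4) True by simp
    also have "\<dots> \<le> x\<^sup>2 + (x * k + 2 * k\<^sup>2) * 1" by simp
    also have "\<dots> \<le> x\<^sup>2 + (x * k + 2 * k\<^sup>2) * (1 + W)"
      using B'(5) x0 k by (intro add_left_mono mult_left_mono) auto
    finally show ?thesis .
  qed
qed

end

lemma (in prob_space) expectation_norm_square_centered:
  fixes Z :: "'a \<Rightarrow> 'v::euclidean_space"
  assumes Z: "integrable M Z" and Z2: "integrable M (\<lambda>x. (norm (Z x))\<^sup>2)"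
  shows "integrable M (\<lambda>x. (norm (Z x - expectation Z))\<^sup>2)"
    and "expectation (\<lambda>x. (norm (Z x - expectation Z))\<^sup>2) \<le> expectation (\<lambda>x. (norm (Z x))\<^sup>2)"
proof -
  let ?m = "expectation Z"
  have eq: "(norm (Z x - ?m))\<^sup>2 = (norm (Z x))\<^sup>2 - 2 * inner ?m (Z x) + (norm ?m)\<^sup>2" for x
    unfolding power2_norm_eq_inner by (simp add: inner_diff_left inner_diff_right inner_commute)
  show "integrable M (\<lambda>x. (norm (Z x - ?m))\<^sup>2)" unfolding eq using Z Z2 by auto
  have "expectation (\<lambda>x. inner ?m (Z x)) = (norm ?m)\<^sup>2"
    using Z by (subst integral_inner_right) (auto simp: power2_norm_eq_inner)
  then have "expectation (\<lambda>x. (norm (Z x - ?m))\<^sup>2) = expectation (\<lambda>x. (norm (Z x))\<^sup>2) - (norm ?m)\<^sup>2"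
    unfolding eq using Z Z2 by (simp add: prob_space)
  then show "expectation (\<lambda>x. (norm (Z x - ?m))\<^sup>2) \<le> expectation (\<lambda>x. (norm (Z x))\<^sup>2)" by simp
qed

section \<open>The proximal operator\<close>

text \<open>A point strictly below the graph is separated from the closed convex epigraph. The
  hyperplane is not vertical, because the point of the graph right above lies on its other side;
  dividing by the last component \<open>s > 0\<close> gives the affine function. It makes the
  proximal objective coercive.\<close>

lemma ext_epigraph_affine_minorant:
  fixes Q :: "'x::euclidean_space \<Rightarrow> ereal"
  assumes Q: "proper_closed_convex Q"
  obtains a :: 'x and c :: real where "\<And>y r. (y, r) \<in> ext_epigraph Q \<Longrightarrow> inner a y + c \<le> r"
proof -
  obtain x0 where "Q x0 \<noteq> \<infinity>" using Q by (auto simp: proper_closed_convex_def)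
  then obtain q0 where q0: "Q x0 = ereal q0" using Q by (cases "Q x0") (auto simp: proper_closed_convex_def)
  have "(x0, q0 - 1) \<notin> ext_epigraph Q" by (simp add: ext_epigraph_def q0)
  then have "\<exists>n d. inner n (x0, q0 - 1) < d \<and> (\<forall>p\<in>ext_epigraph Q. d < inner n p)"
    using Q by (intro separating_hyperplane_closed_point) (auto simp: proper_closed_convex_def)
  then obtain n d where nd: "inner n (x0, q0 - 1) < d" "\<And>p. p \<in> ext_epigraph Q \<Longrightarrow> d < inner n p"
    by blast
  obtain u s where n: "n = (u, s)" by fastforce
  have "d < inner u x0 + s * q0" using nd(2)[of "(x0, q0)"] by (simp add: n ext_epigraph_def q0)
  then have s: "0 < s" using nd(1) by (simp add: n algebra_simps)
  show ?thesis
  proof (rule that[of "- (1 / s) *\<^sub>R u" "d / s"])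
    fix y r assume "(y, r) \<in> ext_epigraph Q"
    then have "d < inner u y + s * r" using nd(2)[of "(y, r)"] by (simp add: n)
    then show "inner (- (1 / s) *\<^sub>R u) y + d / s \<le> r" using s by (simp add: field_simps)
  qed
qed

text \<open>Minimising over the epigraph instead of the domain turns lower semicontinuity of \<open>Q\<close> into
  continuity of the objective.\<close>

lemma prox_minimizes:
  fixes Q :: "'x::euclidean_space \<Rightarrow> ereal"
  assumes Q: "proper_closed_convex Q"
  shows "Q (prox Q x) + ereal ((norm (prox Q x - x))\<^sup>2 / 2) \<le> Q y + ereal ((norm (y - x))\<^sup>2 / 2)"
proof -
  let ?E = "ext_epigraph Q"
  let ?h = "\<lambda>p :: 'x \<times> real. snd p + (norm (fst p - x))\<^sup>2 / 2"
  obtain a c where ac: "\<And>y r. (y, r) \<in> ?E \<Longrightarrow> inner a y + c \<le> r" using ext_epigraph_affine_minorant[OF Q] by blast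
  obtain x0 where "Q x0 \<noteq> \<infinity>" using Q by (auto simp: proper_closed_convex_def)
  then obtain q0 where q0: "Q x0 = ereal q0" using Q by (cases "Q x0") (auto simp: proper_closed_convex_def)
  let ?p0 = "(x0, q0)"
  define K where "K = ?h ?p0"
  define S where "S = ?E \<inter> {p. ?h p \<le> K}"
  have p0: "?p0 \<in> S" by (simp add: S_def K_def ext_epigraph_def q0)
  have "closed S" unfolding S_def using Q
    by (intro closed_Int closed_Collect_le continuous_intros) (auto simp: proper_closed_convex_def)
  moreover have "bounded S"
  proof -
    \<comment> \<open>The square outgrows the affine minorant: points of \<open>S\<close> satisfy
      \<open>n^2 \<le> 2 * norm a * n + 2 * L\<close> for their distance \<open>n\<close> to
      \<open>x\<close>, and \<open>\<rho>\<close> is chosen so that this fails for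
      \<open>n > \<rho>\<close>.\<close>
    define L where "L = K - c - inner a x"
    define \<rho> where "\<rho> = 1 + 2 * norm a + 2 * \<bar>L\<bar>"
    have "fst p \<in> cball x \<rho> \<and> snd p \<in> {- norm a * (norm x + \<rho>) + c .. K}" if "p \<in> S" for p
    proof -
      obtain y r where p: "p = (y, r)" by fastforce
      let ?n = "norm (y - x)"
      have 1: "inner a y + c \<le> r" "r + ?n\<^sup>2 / 2 \<le> K" using that ac p by (auto simp: S_def)
      have "inner a y = inner a x + inner a (y - x)" by (simp add: inner_diff_right)
      moreover have "- (norm a * ?n) \<le> inner a (y - x)" using Cauchy_Schwarz_ineq2[of a "y - x"] by linarith
      ultimately have 2: "?n * ?n \<le> 2 * norm a * ?n + 2 * L" using 1 by (simp add: L_def power2_eq_square)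
      have n: "?n \<le> \<rho>"
      proof (rule ccontr)
        assume "\<not> ?n \<le> \<rho>"
        moreover have "1 \<le> \<rho>" by (simp add: \<rho>_def)
        ultimately have b: "\<rho> < ?n" "1 \<le> ?n" by linarith+
        have "2 * \<bar>L\<bar> * 1 \<le> 2 * \<bar>L\<bar> * ?n" using b(2) by (intro mult_left_mono) auto
        then have "2 * norm a * ?n + 2 * L \<le> 2 * norm a * ?n + 2 * \<bar>L\<bar> * ?n" by linarith
        also have "\<dots> = (2 * norm a + 2 * \<bar>L\<bar>) * ?n" by (simp add: algebra_simps)
        also have "\<dots> < ?n * ?n" using b by (intro mult_strict_right_mono) (auto simp: \<rho>_def)
        finally show False using 2 by simp
      qed
      have "norm y \<le> norm x + \<rho>" using n norm_triangle_sub[of y x] by linarith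
      then have "norm a * norm y \<le> norm a * (norm x + \<rho>)" by (intro mult_left_mono) auto
      then have "- norm a * (norm x + \<rho>) + c \<le> r"
        using 1(1) Cauchy_Schwarz_ineq2[of a y] by linarith
      moreover have "r \<le> K" using 1(2) by (smt (verit) zero_le_power2 divide_nonneg_nonneg)
      ultimately show ?thesis using n by (simp add: p dist_norm norm_minus_commute)
    qed
    then have "S \<subseteq> cball x \<rho> \<times> {- norm a * (norm x + \<rho>) + c .. K}" by (auto simp: mem_Times_iff)
    then show ?thesis by (rule bounded_subset[rotated]) (intro bounded_Times bounded_cball bounded_closed_interval)
  qed
  ultimately have "compact S" by (simp add: compact_eq_bounded_closed)
  moreover have "continuous_on S ?h" by (intro continuous_intros) simp
  ultimately obtain p where p: "p \<in> S" "\<And>p'. p' \<in> S \<Longrightarrow> ?h p \<le> ?h p'"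
    using continuous_attains_inf[of S ?h] p0 by blast
  obtain z r where zr: "p = (z, r)" by fastforce
  let ?f = "\<lambda>y. Q y + ereal ((norm (y - x))\<^sup>2 / 2)"
  have min: "?f z \<le> ?f y" for y
  proof (cases "Q y")
    case (real q)
    have "?h p \<le> ?h (y, q)"
    proof (cases "?h (y, q) \<le> K")
      case True
      then show ?thesis using p(2)[of "(y, q)"] real by (auto simp: S_def ext_epigraph_def)
    next
      case False
      then show ?thesis using p(1) by (simp add: S_def)
    qed
    moreover have "?f z \<le> ereal (?h p)"
      using p(1) by (auto simp: zr S_def ext_epigraph_def intro!: add_right_mono simp flip: plus_ereal.simps(1))
    ultimately show ?thesis using real by (auto intro: order_trans)
  qed (use Q in \<open>auto simp: proper_closed_convex_def\<close>)
  \<comment> \<open>\<open>prox\<close> is a choice among the minimisers, so its value is meaningful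
    only once one exists.\<close>
  have "\<exists>z. is_arg_min ?f (\<lambda>_. True) z" using min by (auto simp: is_arg_min_def not_less)
  then have "is_arg_min ?f (\<lambda>_. True) (prox Q x)" unfolding prox_def arg_min_def by (rule someI_ex)
  then show ?thesis by (auto simp: is_arg_min_def not_less)
qed

text \<open>The minimiser is compared with points of the segment towards \<open>y\<close>: convexity
  bounds \<open>Q\<close> there, a factor \<open>u\<close> cancels, and \<open>u\<close> tends to 0.
  In other words, \<open>x - prox Q x\<close> is a subgradient of \<open>Q\<close> at
  \<open>prox Q x\<close>.\<close>

lemma prox_variational_inequality:
  fixes Q :: "'x::euclidean_space \<Rightarrow> ereal"
  assumes Q: "proper_closed_convex Q" and y: "(y, s) \<in> ext_epigraph Q"
  obtains r where "Q (prox Q x) = ereal r" "r + inner (x - prox Q x) (y - prox Q x) \<le> s"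
proof -
  let ?p = "prox Q x"
  have "Q y \<le> ereal s" using y by (simp add: ext_epigraph_def)
  then have "Q y + ereal ((norm (y - x))\<^sup>2 / 2) < \<infinity>" by (cases "Q y") auto
  then have "Q ?p \<noteq> \<infinity>" using prox_minimizes[OF Q, of x y] by auto
  then obtain r where r: "Q ?p = ereal r" using Q by (cases "Q ?p") (auto simp: proper_closed_convex_def)
  let ?d = "y - ?p"
  have ineq: "r + inner (x - ?p) ?d \<le> s + u / 2 * (norm ?d)\<^sup>2" if u: "0 < u" "u \<le> 1" for u
  proof -
    have "(1 - u) *\<^sub>R (?p, r) + u *\<^sub>R (y, s) \<in> ext_epigraph Q"
      using Q y u r by (intro convexD) (auto simp: proper_closed_convex_def ext_epigraph_def)
    then have "Q ((1 - u) *\<^sub>R ?p + u *\<^sub>R y) \<le> ereal ((1 - u) * r + u * s)"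
      by (simp add: ext_epigraph_def)
    then have "Q ((1 - u) *\<^sub>R ?p + u *\<^sub>R y) + ereal ((norm ((1 - u) *\<^sub>R ?p + u *\<^sub>R y - x))\<^sup>2 / 2)
      \<le> ereal ((1 - u) * r + u * s) + ereal ((norm ((1 - u) *\<^sub>R ?p + u *\<^sub>R y - x))\<^sup>2 / 2)"
      by (rule add_right_mono)
    from order_trans[OF prox_minimizes[OF Q] this]
    have "r + (norm (?p - x))\<^sup>2 / 2 \<le> (1 - u) * r + u * s + (norm ((1 - u) *\<^sub>R ?p + u *\<^sub>R y - x))\<^sup>2 / 2"
      by (simp add: r)
    also have "(1 - u) *\<^sub>R ?p + u *\<^sub>R y - x = u *\<^sub>R ?d - (x - ?p)" by (simp add: algebra_simps)
    also have "(norm (u *\<^sub>R ?d - (x - ?p)))\<^sup>2 = u\<^sup>2 * (norm ?d)\<^sup>2 - 2 * u * inner (x - ?p) ?d + (norm (?p - x))\<^sup>2"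
    proof -
      have "(norm (u *\<^sub>R d - e))\<^sup>2 = u\<^sup>2 * (norm d)\<^sup>2 - 2 * u * inner e d + (norm e)\<^sup>2" for d e :: 'x
        unfolding power2_norm_eq_inner
        by (simp add: inner_diff_left inner_diff_right inner_commute power2_eq_square algebra_simps)
      then show ?thesis by (simp only: norm_minus_commute[of ?p x])
    qed
    finally have "u * (r + inner (x - ?p) ?d) \<le> u * (s + u / 2 * (norm ?d)\<^sup>2)"
      by (simp add: field_simps power2_eq_square)
    then show ?thesis using u by simp
  qed
  have "((\<lambda>u. s + u / 2 * (norm ?d)\<^sup>2) \<longlongrightarrow> s + 0 / 2 * (norm ?d)\<^sup>2) (at_right 0)"
    by (intro tendsto_intros) simp
  moreover have "\<forall>\<^sub>F u in at_right 0. r + inner (x - ?p) ?d \<le> s + u / 2 * (norm ?d)\<^sup>2"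
    using ineq eventually_at_right_real[of 0 1] by (auto elim!: eventually_mono)
  ultimately have "r + inner (x - ?p) ?d \<le> s + 0 / 2 * (norm ?d)\<^sup>2"
    by (rule tendsto_lowerbound) simp
  then show ?thesis using that r by simp
qed

text \<open>The variational inequalities at the two points, each tested with the other, add up to
  monotonicity of the subgradient, and Cauchy-Schwarz finishes. The purpose is continuity of
  \<open>prox\<close>, which makes the iterates measurable.\<close>

lemma prox_nonexpansive:
  fixes Q :: "'x::euclidean_space \<Rightarrow> ereal"
  assumes Q: "proper_closed_convex Q"
  shows "dist (prox Q x) (prox Q y) \<le> dist x y"
proof -
  let ?p = "prox Q x" and ?q = "prox Q y"
  obtain x0 where "Q x0 \<noteq> \<infinity>" using Q by (auto simp: proper_closed_convex_def)
  then obtain q0 where "(x0, q0) \<in> ext_epigraph Q" using Q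
    by (cases "Q x0") (auto simp: proper_closed_convex_def ext_epigraph_def)
  then obtain r s where rs: "Q ?p = ereal r" "Q ?q = ereal s" using prox_variational_inequality[OF Q] by metis
  then have "(?p, r) \<in> ext_epigraph Q" "(?q, s) \<in> ext_epigraph Q" by (auto simp: ext_epigraph_def)
  then have "r + inner (x - ?p) (?q - ?p) \<le> s" "s + inner (y - ?q) (?p - ?q) \<le> r"
    using prox_variational_inequality[OF Q] rs by (metis ereal.inject)+
  then have "inner (x - ?p) (?q - ?p) + inner (y - ?q) (?p - ?q) \<le> 0" by linarith
  then have "inner (?p - ?q) (?p - ?q) \<le> inner (x - y) (?p - ?q)"
    by (simp add: inner_diff_left inner_diff_right inner_commute)
  also have "\<dots> \<le> norm (x - y) * norm (?p - ?q)" by (rule norm_cauchy_schwarz)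
  finally have "norm (?p - ?q) * norm (?p - ?q) \<le> norm (x - y) * norm (?p - ?q)"
    by (simp add: power2_norm_eq_inner[symmetric] power2_eq_square)
  then show ?thesis by (cases "norm (?p - ?q) = 0") (auto simp: dist_norm)
qed

lemma borel_measurable_prox:
  fixes Q :: "'x::euclidean_space \<Rightarrow> ereal"
  assumes "proper_closed_convex Q"
  shows "prox Q \<in> borel_measurable borel"
proof (rule borel_measurable_continuous_onI)
  show "continuous_on UNIV (prox Q)"
    unfolding continuous_on_iff using prox_nonexpansive[OF assms] by (meson le_less_trans)
qed

text \<open>The update uses the proximal operator of the scaled function. Its epigraph is a preimage
  of that of \<open>Q\<close> under a continuous linear map, so closedness and convexity carry
  over.\<close>

lemma proper_closed_convex_scale:
  fixes Q :: "'x::euclidean_space \<Rightarrow> ereal"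
  assumes Q: "proper_closed_convex Q" and \<eta>: "0 < \<eta>"
  shows "proper_closed_convex (\<lambda>x. ereal \<eta> * Q x)"
proof -
  let ?f = "\<lambda>p :: 'x \<times> real. (fst p, snd p / \<eta>)"
  have le: "ereal \<eta> * q \<le> ereal r \<longleftrightarrow> q \<le> ereal (r / \<eta>)" for q r
    using \<eta> by (cases q) (auto simp: field_simps)
  have E: "ext_epigraph (\<lambda>x. ereal \<eta> * Q x) = ?f -` ext_epigraph Q"
    by (auto simp: ext_epigraph_def le)
  have lin: "linear ?f" by (rule linearI) (auto simp: add_divide_distrib)
  have "closed (?f -` ext_epigraph Q)"
    using Q \<eta> by (intro continuous_closed_vimage) (auto simp: proper_closed_convex_def intro!: continuous_intros)
  moreover have "convex (?f -` ext_epigraph Q)"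
    using Q by (intro convex_linear_vimage lin) (auto simp: proper_closed_convex_def)
  moreover have "ereal \<eta> * Q x \<noteq> - \<infinity>" for x
    using Q \<eta> by (cases "Q x") (auto simp: proper_closed_convex_def)
  moreover have "\<exists>x. ereal \<eta> * Q x \<noteq> \<infinity>"
  proof -
    obtain x where "Q x \<noteq> \<infinity>" using Q by (auto simp: proper_closed_convex_def)
    then show ?thesis using \<eta> Q by (cases "Q x") (auto simp: proper_closed_convex_def intro!: exI[of _ x])
  qed
  ultimately show ?thesis by (simp add: proper_closed_convex_def E)
qed

section \<open>Joint measurability and conditional expectations\<close>

text \<open>Approximate the second argument by points of a grid.\<close>

lemma borel_measurable_caratheodory:
  fixes f :: "'x \<Rightarrow> real ^ 'q::finite \<Rightarrow> 'v::{second_countable_topology, metric_space}"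
  assumes meas: "\<And>\<theta>. (\<lambda>x. f x \<theta>) \<in> borel_measurable M"
    and cont: "\<And>x. x \<in> space M \<Longrightarrow> continuous_on UNIV (f x)"
  shows "(\<lambda>(x, \<theta>). f x \<theta>) \<in> borel_measurable (M \<Otimes>\<^sub>M borel)"
proof -
  define grid :: "nat \<Rightarrow> int ^ 'q \<Rightarrow> real ^ 'q" where "grid n k = (\<chi> i. real_of_int (k $ i) / real (Suc n))" for n k
  define idx :: "nat \<Rightarrow> real ^ 'q \<Rightarrow> int ^ 'q" where "idx n \<theta> = (\<chi> i. \<lfloor>real (Suc n) * \<theta> $ i\<rfloor>)" for n \<theta>
  have lim: "(\<lambda>n. grid n (idx n \<theta>)) \<longlonglongrightarrow> \<theta>" for \<theta>
  proof (rule vec_tendstoI)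
    fix i
    have "(\<lambda>n. grid n (idx n \<theta>) $ i - \<theta> $ i) \<longlonglongrightarrow> 0"
    proof (rule Lim_null_comparison[OF always_eventually LIMSEQ_inverse_real_of_nat], intro allI)
      fix n
      have "\<bar>real_of_int \<lfloor>real (Suc n) * \<theta> $ i\<rfloor> - real (Suc n) * \<theta> $ i\<bar> \<le> 1" by linarith
      then have "\<bar>(real_of_int \<lfloor>real (Suc n) * \<theta> $ i\<rfloor> - real (Suc n) * \<theta> $ i) / real (Suc n)\<bar> \<le> 1 / real (Suc n)"
        by (simp only: abs_divide abs_of_nat divide_right_mono of_nat_0_le_iff)
      then show "norm (grid n (idx n \<theta>) $ i - \<theta> $ i) \<le> inverse (real (Suc n))"
        by (simp add: grid_def idx_def diff_divide_distrib inverse_eq_divide del: of_nat_Suc)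
    qed
    then show "(\<lambda>n. grid n (idx n \<theta>) $ i) \<longlonglongrightarrow> \<theta> $ i" by (simp add: LIM_zero_iff)
  qed
  have cnt: "countable (UNIV :: (int ^ 'q) set)"
  proof -
    have "inj (\<lambda>k :: int ^ 'q. vec_nth k)" by (auto simp: inj_on_def vec_eq_iff)
    moreover have "countable (UNIV :: ('q \<Rightarrow> int) set)"
      using countable_PiE[of "UNIV :: 'q set" "\<lambda>_. UNIV :: int set"] by (simp add: PiE_UNIV_domain)
    ultimately show ?thesis using countable_image_inj_on countable_subset subset_UNIV by metis
  qed
  have idx_meas: "idx n \<in> measurable borel (count_space UNIV)" for n
  proof (rule measurable_count_space_eq_countable[OF cnt, THEN iffD2], intro conjI ballI)
    fix k :: "int ^ 'q"
    have "idx n -` {k} \<inter> space borel = (\<Inter>i. (\<lambda>\<theta>. \<lfloor>real (Suc n) * \<theta> $ i\<rfloor>) -` {k $ i} \<inter> space borel)"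
      by (auto simp: idx_def vec_eq_iff)
    also have "\<dots> \<in> sets borel"
    proof (intro sets.countable_INT'')
      fix i
      have "(\<lambda>\<theta> :: real ^ 'q. \<lfloor>real (Suc n) * \<theta> $ i\<rfloor>) \<in> measurable borel (count_space UNIV)" by measurable
      then show "(\<lambda>\<theta> :: real ^ 'q. \<lfloor>real (Suc n) * \<theta> $ i\<rfloor>) -` {k $ i} \<inter> space borel \<in> sets borel"
        by (rule measurable_sets) auto
    qed auto
    finally show "idx n -` {k} \<inter> space borel \<in> sets borel" .
  qed auto
  have "(\<lambda>p. f (fst p) (snd p)) \<in> borel_measurable (M \<Otimes>\<^sub>M borel)"
  proof (rule borel_measurable_LIMSEQ_metric)
    fix n
    show "(\<lambda>p. f (fst p) (grid n (idx n (snd p)))) \<in> borel_measurable (M \<Otimes>\<^sub>M borel)"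
    proof (rule measurable_compose_countable'[where g="\<lambda>p. idx n (snd p)" and I=UNIV])
      show "(\<lambda>p. idx n (snd p)) \<in> measurable (M \<Otimes>\<^sub>M borel) (count_space UNIV)"
        using idx_meas by (rule measurable_compose[OF measurable_snd])
      show "(\<lambda>p. f (fst p) (grid n k)) \<in> borel_measurable (M \<Otimes>\<^sub>M borel)" for k
        using meas by (rule measurable_compose[OF measurable_fst])
    qed (rule cnt)
  next
    fix p assume "p \<in> space (M \<Otimes>\<^sub>M (borel :: (real ^ 'q) measure))"
    then have "fst p \<in> space M" by (auto simp: space_pair_measure)
    then have "isCont (f (fst p)) (snd p)" using cont by (simp add: continuous_on_eq_continuous_at)
    then show "(\<lambda>n. f (fst p) (grid n (idx n (snd p)))) \<longlonglongrightarrow> f (fst p) (snd p)"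
      using lim by (rule isCont_tendsto_compose)
  qed
  then show ?thesis by (simp add: case_prod_beta')
qed

section \<open>Conditional laws as densities of joint laws\<close>

lemma measurable_id_restr_to_subalg:
  assumes "subalgebra M F"
  shows "(\<lambda>w. w) \<in> measurable M (restr_to_subalg M F)"
proof (rule measurableI)
  fix A assume "A \<in> sets (restr_to_subalg M F)"
  then have "A \<in> sets M" using assms by (auto simp: sets_restr_to_subalg subalgebra_def)
  then show "(\<lambda>w. w) -` A \<inter> space M \<in> sets M" by auto
qed (simp add: space_restr_to_subalg)

context prob_space
begin

text \<open>Conditional probabilities of events from a generator are condensed into a single
  identity of measures: the law of \<open>w\<close> itself, seen through \<open>F\<close>, paired
  with \<open>Y\<close>. As \<open>G\<close> is stable under intersections, rectangles suffice for
  the comparison. A random parameter then is merely a coordinate of the density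
  \<open>q\<close>.\<close>

lemma joint_law_eq_density:
  fixes q :: "'a \<times> 'b \<Rightarrow> ennreal" and F :: "'a measure"
  defines "P \<equiv> restr_to_subalg M F"
  assumes sub: "subalgebra M F" and N: "sigma_finite_measure N"
    and Y [measurable]: "Y \<in> measurable M N"
    and q [measurable]: "q \<in> borel_measurable (P \<Otimes>\<^sub>M N)"
    and G: "Int_stable G" "G \<subseteq> Pow (space N)" "sets N = sigma_sets (space N) G" "space N \<in> G"
    and cond: "\<And>E. E \<in> G \<Longrightarrow> AE w in M. ennreal (real_cond_exp M F (indicator (Y -` E \<inter> space M)) w)
                 = (\<integral>\<^sup>+ y. q (w, y) * indicator E y \<partial>N)"
  shows "distr M (P \<Otimes>\<^sub>M N) (\<lambda>w. (w, Y w)) = density (P \<Otimes>\<^sub>M N) q"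
proof -
  interpret S: finite_measure_subalgebra M F by unfold_locales (rule sub)
  interpret N: sigma_finite_measure N by fact
  interpret P: prob_space P unfolding P_def by (rule prob_space_restr_to_subalg[OF sub prob_space_axioms])
  have spP: "space P = space M" by (simp add: P_def space_restr_to_subalg)
  have setP: "sets P = sets F" unfolding P_def by (rule sets_restr_to_subalg[OF sub])
  have setPM: "A \<in> sets M" if "A \<in> sets P" for A using that sub by (auto simp: setP subalgebra_def)
  have PM: "(\<lambda>w. w) \<in> measurable M P"
    unfolding P_def by (rule measurable_id_restr_to_subalg[OF sub])
  have J [measurable]: "(\<lambda>w. (w, Y w)) \<in> measurable M (P \<Otimes>\<^sub>M N)" using PM Y by (rule measurable_Pair)
  let ?E = "{A \<times> B | A B. A \<in> sets P \<and> B \<in> G}"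
  have GN: "B \<in> sets N" if "B \<in> G" for B using that G by (auto simp: G(3) intro: sigma_sets.Basic)
  have sets_eq: "sets (P \<Otimes>\<^sub>M N) = sigma_sets (space M \<times> space N) ?E"
  proof -
    have "sets (P \<Otimes>\<^sub>M N) = sets (sigma (space P \<times> space N) {a \<times> b | a b. a \<in> sets P \<and> b \<in> G})"
      using G(2,3,4) sets.space_closed[of P] sets.sigma_sets_eq[of P] sets.top[of P]
      by (intro sets_pair_eq[where Ca="{space P}" and Cb="{space N}"]) auto
    also have "\<dots> = sigma_sets (space P \<times> space N) ?E"
      using G(2) by (intro sets_measure_of) (auto dest: sets.sets_into_space)
    finally show ?thesis by (simp add: spP)
  qed
  show ?thesis
  proof (rule measure_eqI_generator_eq[where E="?E" and \<Omega>="space M \<times> space N" and A="\<lambda>_. space M \<times> space N"])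
    show "Int_stable ?E"
    proof (rule Int_stableI, safe)
      fix A B C D assume "A \<in> sets P" "C \<in> G" "B \<in> sets P" "D \<in> G"
      then show "\<exists>A' B'. A \<times> C \<inter> B \<times> D = A' \<times> B' \<and> A' \<in> sets P \<and> B' \<in> G"
        using G(1) by (intro exI[of _ "A \<inter> B"] exI[of _ "C \<inter> D"]) (auto simp: Int_stable_def)
    qed
    show "?E \<subseteq> Pow (space M \<times> space N)" using G(2) sets.sets_into_space[OF setPM] by blast
    fix X assume "X \<in> ?E"
    then obtain A B where X: "X = A \<times> B" "A \<in> sets P" "B \<in> G" by auto
    have [measurable]: "A \<in> sets P" "A \<in> sets M" "A \<in> sets F" "B \<in> sets N" using X setPM GN setP by auto
    let ?ind = "indicator (Y -` B \<inter> space M) :: 'a \<Rightarrow> real"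
    have YB [measurable]: "Y -` B \<inter> space M \<in> sets M" by measurable
    have I: "integrable M ?ind" by (simp add: emeasure_eq_measure)
    have "emeasure (density (P \<Otimes>\<^sub>M N) q) X = (\<integral>\<^sup>+ z. q z * indicator (A \<times> B) z \<partial>(P \<Otimes>\<^sub>M N))"
      unfolding X by (intro emeasure_density) auto
    also have "\<dots> = (\<integral>\<^sup>+ w. \<integral>\<^sup>+ y. q (w, y) * indicator (A \<times> B) (w, y) \<partial>N \<partial>P)"
      by (subst N.nn_integral_fst[symmetric]) auto
    also have "\<dots> = (\<integral>\<^sup>+ w. (\<integral>\<^sup>+ y. q (w, y) * indicator B y \<partial>N) * indicator A w \<partial>P)"
      by (intro nn_integral_cong) (auto simp: indicator_def)
    also have "\<dots> = (\<integral>\<^sup>+ w. (\<integral>\<^sup>+ y. q (w, y) * indicator B y \<partial>N) * indicator A w \<partial>M)"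
    proof -
      have "(\<lambda>w. (\<integral>\<^sup>+ y. q (w, y) * indicator B y \<partial>N) * indicator A w) \<in> borel_measurable P" by measurable
      then show ?thesis unfolding P_def
        by (intro nn_integral_subalgebra2[OF sub] measurable_in_subalg'[OF sub])
    qed
    also have "\<dots> = (\<integral>\<^sup>+ w. ennreal (indicator A w * real_cond_exp M F ?ind w) \<partial>M)"
      using cond[OF X(3)] by (intro nn_integral_cong_AE) (auto simp: indicator_def elim!: eventually_mono)
    also have "\<dots> = ennreal (\<integral> w. indicator A w * real_cond_exp M F ?ind w \<partial>M)"
    proof (rule nn_integral_eq_integral)
      have "integrable M (\<lambda>w. indicator A w * ?ind w)"
        using integrable_mult_indicator[OF \<open>A \<in> sets M\<close> I] by simp
      then show "integrable M (\<lambda>w. indicator A w * real_cond_exp M F ?ind w)"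
        by (intro S.real_cond_exp_intg(1) borel_measurable_indicator \<open>A \<in> sets F\<close> YB)
      have "AE w in M. 0 \<le> real_cond_exp M F ?ind w"
        by (intro S.real_cond_exp_pos borel_measurable_indicator YB) simp
      then show "AE w in M. 0 \<le> indicator A w * real_cond_exp M F ?ind w"
        by eventually_elim simp
    qed
    also have "(\<integral> w. indicator A w * real_cond_exp M F ?ind w \<partial>M) = (\<integral> w. indicator A w * ?ind w \<partial>M)"
      using S.real_cond_exp_intA[OF I, of A] X setP by (simp add: set_lebesgue_integral_def)
    also have "(\<lambda>w. indicator A w * ?ind w) = indicator (A \<inter> (Y -` B \<inter> space M))"
      by (auto simp: indicator_def)
    also have "ennreal (\<integral> w. indicator (A \<inter> (Y -` B \<inter> space M)) w \<partial>M) = emeasure M (A \<inter> (Y -` B \<inter> space M))"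
      by (simp add: emeasure_eq_measure)
    also have "A \<inter> (Y -` B \<inter> space M) = (\<lambda>w. (w, Y w)) -` X \<inter> space M" by (auto simp: X)
    also have "emeasure M \<dots> = emeasure (distr M (P \<Otimes>\<^sub>M N) (\<lambda>w. (w, Y w))) X"
      unfolding X by (intro emeasure_distr[symmetric]) auto
    finally show "emeasure (distr M (P \<Otimes>\<^sub>M N) (\<lambda>w. (w, Y w))) X = emeasure (density (P \<Otimes>\<^sub>M N) q) X" ..
  next
    show "emeasure (distr M (P \<Otimes>\<^sub>M N) (\<lambda>w. (w, Y w))) (space M \<times> space N) \<noteq> \<infinity>"
      using prob_space.emeasure_space_1[OF prob_space_distr[OF J]] by (simp add: space_pair_measure spP)
    show "range (\<lambda>_. space M \<times> space N) \<subseteq> ?E" using G(4) sets.top[of P] by (auto simp: spP)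
  qed (auto simp: sets_eq spP)
qed

context
  fixes F :: "'a measure" and N :: "'b measure" and Y :: "'a \<Rightarrow> 'b" and p :: "'a \<times> 'b \<Rightarrow> real"
  assumes sub: "subalgebra M F" and N: "sigma_finite_measure N" and Y: "Y \<in> measurable M N"
    and p: "p \<in> borel_measurable (restr_to_subalg M F \<Otimes>\<^sub>M N)" and p_nonneg: "\<And>z. 0 \<le> p z"
    and law: "distr M (restr_to_subalg M F \<Otimes>\<^sub>M N) (\<lambda>w. (w, Y w))
                = density (restr_to_subalg M F \<Otimes>\<^sub>M N) (\<lambda>z. ennreal (p z))"
begin

lemma measurable_joint:
  "(\<lambda>w. (w, Y w)) \<in> measurable M (restr_to_subalg M F \<Otimes>\<^sub>M N)"
  by (rule measurable_Pair[OF measurable_id_restr_to_subalg[OF sub] Y])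

lemma nn_integral_joint:
  assumes f [measurable]: "f \<in> borel_measurable (restr_to_subalg M F \<Otimes>\<^sub>M N)"
  shows "(\<integral>\<^sup>+ w. f (w, Y w) \<partial>M) = (\<integral>\<^sup>+ w. \<integral>\<^sup>+ y. ennreal (p (w, y)) * f (w, y) \<partial>N \<partial>M)"
proof -
  interpret N: sigma_finite_measure N by (rule N)
  note measurable_joint [measurable] p [measurable]
  let ?P = "restr_to_subalg M F"
  have "(\<integral>\<^sup>+ w. f (w, Y w) \<partial>M) = (\<integral>\<^sup>+ z. f z \<partial>distr M (?P \<Otimes>\<^sub>M N) (\<lambda>w. (w, Y w)))"
    by (intro nn_integral_distr[symmetric]) auto
  also have "\<dots> = (\<integral>\<^sup>+ z. ennreal (p z) * f z \<partial>(?P \<Otimes>\<^sub>M N))"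
    unfolding law by (intro nn_integral_density) auto
  also have "\<dots> = (\<integral>\<^sup>+ w. \<integral>\<^sup>+ y. ennreal (p (w, y)) * f (w, y) \<partial>N \<partial>?P)"
    by (subst N.nn_integral_fst[symmetric]) auto
  also have "\<dots> = (\<integral>\<^sup>+ w. \<integral>\<^sup>+ y. ennreal (p (w, y)) * f (w, y) \<partial>N \<partial>M)"
  proof (rule nn_integral_subalgebra2[OF sub])
    have "(\<lambda>w. \<integral>\<^sup>+ y. ennreal (p (w, y)) * f (w, y) \<partial>N) \<in> borel_measurable ?P" by measurable
    then show "(\<lambda>w. \<integral>\<^sup>+ y. ennreal (p (w, y)) * f (w, y) \<partial>N) \<in> borel_measurable F"
      using measurable_in_subalg'[OF sub] by blast
  qed
  finally show ?thesis .
qed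

text \<open>Freezing: given \<open>F\<close>, the first argument counts as a constant and
  \<open>Y\<close> is integrated against its conditional density. Fubini on
  \<open>A \<times> space N\<close> with \<open>A\<close> in \<open>F\<close> verifies the
  characterising identity of the conditional expectation.\<close>

lemma real_cond_exp_joint:
  fixes h :: "'a \<times> 'b \<Rightarrow> real"
  assumes h [measurable]: "h \<in> borel_measurable (restr_to_subalg M F \<Otimes>\<^sub>M N)"
    and I: "integrable M (\<lambda>w. h (w, Y w))"
  shows "AE w in M. real_cond_exp M F (\<lambda>w. h (w, Y w)) w = (\<integral> y. p (w, y) * h (w, y) \<partial>N)"
    and "AE w in M. integrable N (\<lambda>y. p (w, y) * h (w, y))"
proof -
  interpret N: sigma_finite_measure N by (rule N)
  interpret S: finite_measure_subalgebra M F by unfold_locales (rule sub)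
  note measurable_joint [measurable] p [measurable]
  let ?P = "restr_to_subalg M F"
  interpret P: prob_space ?P by (rule prob_space_restr_to_subalg[OF sub prob_space_axioms])
  interpret PN: pair_sigma_finite ?P N by unfold_locales
  have Ih: "integrable (?P \<Otimes>\<^sub>M N) (\<lambda>z. p z * h z)"
  proof -
    have "integrable (distr M (?P \<Otimes>\<^sub>M N) (\<lambda>w. (w, Y w))) h" using I by (subst integrable_distr_eq) auto
    then show ?thesis unfolding law using p_nonneg by (subst (asm) integrable_density) auto
  qed
  show "AE w in M. integrable N (\<lambda>y. p (w, y) * h (w, y))"
    using PN.AE_integrable_fst'[OF Ih] by (rule AE_restr_to_subalg[OF sub])
  let ?g = "\<lambda>w. \<integral> y. p (w, y) * h (w, y) \<partial>N"
  have gP: "integrable ?P ?g" using PN.integrable_fst'[OF Ih] by simp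
  have gF: "?g \<in> borel_measurable F"
    using borel_measurable_integrable[OF gP] measurable_in_subalg'[OF sub] by blast
  show "AE w in M. real_cond_exp M F (\<lambda>w. h (w, Y w)) w = ?g w"
  proof (rule S.real_cond_exp_charact[OF _ I integrable_from_subalg[OF sub gP] gF])
    fix A assume A: "A \<in> sets F"
    have [measurable]: "A \<in> sets ?P" using A by (simp add: sets_restr_to_subalg[OF sub])
    let ?h = "\<lambda>z. indicator A (fst z) * h z"
    have "(\<integral>w\<in>A. h (w, Y w) \<partial>M) = (\<integral> w. ?h (w, Y w) \<partial>M)" by (simp add: set_lebesgue_integral_def)
    also have "\<dots> = (\<integral> z. ?h z \<partial>distr M (?P \<Otimes>\<^sub>M N) (\<lambda>w. (w, Y w)))"
      by (intro integral_distr[symmetric]) auto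
    also have "\<dots> = (\<integral> z. p z * ?h z \<partial>(?P \<Otimes>\<^sub>M N))"
      unfolding law using p_nonneg by (subst integral_density) auto
    also have "\<dots> = (\<integral> w. \<integral> y. p (w, y) * ?h (w, y) \<partial>N \<partial>?P)"
    proof (rule PN.integral_fst'[symmetric])
      have "integrable (?P \<Otimes>\<^sub>M N) (\<lambda>z. indicator (A \<times> space N) z *\<^sub>R (p z * h z))"
        by (intro integrable_mult_indicator Ih) auto
      then show "integrable (?P \<Otimes>\<^sub>M N) (\<lambda>z. p z * ?h z)"
        by (rule Bochner_Integration.integrable_cong[THEN iffD1, rotated 2])
          (auto simp: indicator_def space_pair_measure)
    qed
    also have "\<dots> = (\<integral> w. indicator A w * ?g w \<partial>?P)"
      by (intro Bochner_Integration.integral_cong) (auto simp: indicator_def)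
    also have "\<dots> = (\<integral> w. indicator A w * ?g w \<partial>M)"
      by (intro integral_subalgebra2[OF sub] borel_measurable_times borel_measurable_indicator A gF)
    finally show "(\<integral>w\<in>A. h (w, Y w) \<partial>M) = (\<integral>w\<in>A. ?g w \<partial>M)" by (simp add: set_lebesgue_integral_def)
  qed
qed

end

end

lemma (in sigma_finite_measure) nn_integral_pair_mult:
  assumes [measurable]: "f \<in> borel_measurable N" "g \<in> borel_measurable M"
  shows "(\<integral>\<^sup>+ y. f (fst y) * g (snd y) \<partial>(N \<Otimes>\<^sub>M M)) = (\<integral>\<^sup>+ y. f y \<partial>N) * (\<integral>\<^sup>+ y. g y \<partial>M)"
proof -
  have "(\<integral>\<^sup>+ y. f (fst y) * g (snd y) \<partial>(N \<Otimes>\<^sub>M M)) = (\<integral>\<^sup>+ y. \<integral>\<^sup>+ y'. f y * g y' \<partial>M \<partial>N)"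
    by (subst nn_integral_fst[symmetric]) auto
  then show ?thesis by (simp add: nn_integral_cmult nn_integral_multc)
qed

lemma (in finite_measure) finite_measure_subalgebraI: "subalgebra M F \<Longrightarrow> finite_measure_subalgebra M F"
  by unfold_locales

lemma (in sigma_finite_subalgebra) real_cond_exp_sum_on:
  fixes f :: "'b \<Rightarrow> 'a \<Rightarrow> real"
  assumes "\<And>i. i \<in> I \<Longrightarrow> integrable M (f i)"
  shows "AE x in M. real_cond_exp M F (\<lambda>x. \<Sum>i\<in>I. f i x) x = (\<Sum>i\<in>I. real_cond_exp M F (f i) x)"
  using real_cond_exp_sum[of "\<lambda>i. if i \<in> I then f i else (\<lambda>_. 0)" I] assms
  by (simp add: if_distrib[of "\<lambda>f. f _"] cong: sum.cong)

text \<open>Pairwise conditional independence suffices: the mixed terms of the expanded square vanish.\<close>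

lemma (in prob_space) conditional_second_moment_sum:
  fixes F :: "'a measure" and N :: "'b measure" and Y :: "'i \<Rightarrow> 'a \<Rightarrow> 'b" and p :: "'a \<times> 'b \<Rightarrow> real"
    and \<xi> :: "'i \<Rightarrow> 'a \<times> 'b \<Rightarrow> 'v::euclidean_space" and A :: "'a \<Rightarrow> 'v" and c :: "'i \<Rightarrow> 'a \<Rightarrow> real" and K :: real
  defines "P \<equiv> restr_to_subalg M F"
  assumes sub: "subalgebra M F" and N: "sigma_finite_measure N" and I: "finite I"
    and Y: "\<And>i. i \<in> I \<Longrightarrow> Y i \<in> measurable M N"
    and p: "p \<in> borel_measurable (P \<Otimes>\<^sub>M N)" and p_nonneg: "\<And>z. 0 \<le> p z"
    and law1: "\<And>i. i \<in> I \<Longrightarrow> distr M (P \<Otimes>\<^sub>M N) (\<lambda>w. (w, Y i w)) = density (P \<Otimes>\<^sub>M N) (\<lambda>z. ennreal (p z))"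
    and law2: "\<And>i j. i \<in> I \<Longrightarrow> j \<in> I \<Longrightarrow> i \<noteq> j \<Longrightarrow>
       distr M (P \<Otimes>\<^sub>M (N \<Otimes>\<^sub>M N)) (\<lambda>w. (w, (Y i w, Y j w)))
         = density (P \<Otimes>\<^sub>M (N \<Otimes>\<^sub>M N)) (\<lambda>z. ennreal (p (fst z, fst (snd z)) * p (fst z, snd (snd z))))"
    and A: "A \<in> borel_measurable F" and A2: "integrable M (\<lambda>w. (norm (A w))\<^sup>2)"
    and \<xi>: "\<And>i. i \<in> I \<Longrightarrow> \<xi> i \<in> borel_measurable (P \<Otimes>\<^sub>M N)"
    and mean: "\<And>i. i \<in> I \<Longrightarrow> AE w in M. (\<integral> y. p (w, y) *\<^sub>R \<xi> i (w, y) \<partial>N) = 0"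
    and second: "\<And>i. i \<in> I \<Longrightarrow> AE w in M. (\<integral>\<^sup>+ y. ennreal (p (w, y) * (norm (\<xi> i (w, y)))\<^sup>2) \<partial>N) \<le> ennreal (min K (c i w))"
    and c: "\<And>i w. 0 \<le> c i w" and K: "0 \<le> K"
  shows "integrable M (\<lambda>w. (norm (A w + (\<Sum>i\<in>I. \<xi> i (w, Y i w))))\<^sup>2)"
    and "AE w in M. real_cond_exp M F (\<lambda>w. (norm (A w + (\<Sum>i\<in>I. \<xi> i (w, Y i w))))\<^sup>2) w
           \<le> (norm (A w))\<^sup>2 + (\<Sum>i\<in>I. c i w)"
    and "AE w in M. real_cond_exp M F (\<lambda>w. inner e (A w + (\<Sum>i\<in>I. \<xi> i (w, Y i w)))) w = inner e (A w)"
    and "integrable M (\<lambda>w. A w + (\<Sum>i\<in>I. \<xi> i (w, Y i w)))"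
proof -
  interpret N: sigma_finite_measure N by (rule N)
  interpret S: finite_measure_subalgebra M F by unfold_locales (rule sub)
  interpret P: prob_space P unfolding P_def by (rule prob_space_restr_to_subalg[OF sub prob_space_axioms])
  interpret NN: pair_sigma_finite N N by unfold_locales
  have spP: "space P = space M" by (simp add: P_def space_restr_to_subalg)
  note [measurable] = p \<xi>
  have AP [measurable]: "A \<in> borel_measurable P"
    using A by (subst measurable_cong_sets[OF _ refl]) (auto simp: P_def sets_restr_to_subalg[OF sub])
  have AM: "A \<in> borel_measurable M" using A by (rule measurable_from_subalg[OF sub])
  define X where "X i w = \<xi> i (w, Y i w)" for i w
  have joint: "(\<lambda>w. (w, Y i w)) \<in> measurable M (P \<Otimes>\<^sub>M N)" if "i \<in> I" for i
    unfolding P_def by (rule measurable_Pair[OF measurable_id_restr_to_subalg[OF sub] Y[OF that]])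
  have XM: "X i \<in> borel_measurable M" if "i \<in> I" for i
    unfolding X_def using \<xi>[OF that] joint[OF that] by (rule measurable_compose[rotated])
  note cond1 = real_cond_exp_joint[OF sub N Y p[unfolded P_def] p_nonneg law1[unfolded P_def], folded P_def]
  note nn1 = nn_integral_joint[OF sub N Y p[unfolded P_def] p_nonneg law1[unfolded P_def], folded P_def]
  \<comment> \<open>The constant \<open>K\<close> is what yields square integrability, since
    \<open>c i\<close> may be unbounded and need not be integrable.\<close>
  have X2: "integrable M (\<lambda>w. (norm (X i w))\<^sup>2)" if i: "i \<in> I" for i
  proof (rule integrableI_bounded)
    have "(\<integral>\<^sup>+ w. ennreal (norm ((norm (X i w))\<^sup>2)) \<partial>M) = (\<integral>\<^sup>+ w. \<integral>\<^sup>+ y. ennreal (p (w, y)) * ennreal ((norm (\<xi> i (w, y)))\<^sup>2) \<partial>N \<partial>M)"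
      unfolding X_def using nn1[OF i i, of "\<lambda>z. ennreal ((norm (\<xi> i z))\<^sup>2)"] \<xi>[OF i] by simp
    also have "\<dots> \<le> (\<integral>\<^sup>+ w. ennreal K \<partial>M)"
      using second[OF i]
    proof (intro nn_integral_mono_AE, eventually_elim)
      case (elim w)
      then show ?case using p_nonneg by (simp add: ennreal_mult) (meson ennreal_leI min.cobounded1 order_trans)
    qed
    also have "\<dots> < \<infinity>" using emeasure_space_1 by simp
    finally show "(\<integral>\<^sup>+ w. ennreal (norm ((norm (X i w))\<^sup>2)) \<partial>M) < \<infinity>" .
  qed (use XM[OF i] in measurable)
  have inner_int: "integrable M (\<lambda>w. inner (u w) (u' w))"
    if "u \<in> borel_measurable M" "u' \<in> borel_measurable M" "integrable M (\<lambda>w. (norm (u w))\<^sup>2)" "integrable M (\<lambda>w. (norm (u' w))\<^sup>2)"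
    for u u' :: "'a \<Rightarrow> 'v"
  proof (rule Bochner_Integration.integrable_bound)
    show "integrable M (\<lambda>w. (norm (u w))\<^sup>2 + (norm (u' w))\<^sup>2)" using that by auto
    have "\<bar>inner x y\<bar> \<le> (norm x)\<^sup>2 + (norm y)\<^sup>2" for x y :: 'v
      using Cauchy_Schwarz_ineq2[of x y] sum_squares_bound[of "norm x" "norm y"]
        mult_nonneg_nonneg[OF norm_ge_zero[of x] norm_ge_zero[of y]] by linarith
    then show "AE w in M. norm (inner (u w) (u' w)) \<le> norm ((norm (u w))\<^sup>2 + (norm (u' w))\<^sup>2)" by simp
  qed (use that in measurable)
  have sq_int: "integrable M f" if "f \<in> borel_measurable M" "integrable M (\<lambda>w. (norm (f w))\<^sup>2)" for f :: "'a \<Rightarrow> 'v"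
  proof (rule Bochner_Integration.integrable_bound)
    show "integrable M (\<lambda>w. 1 + (norm (f w))\<^sup>2)" using that(2) by auto
    have "norm x \<le> norm (1 + (norm x)\<^sup>2)" for x :: 'v
    proof -
      have "norm x \<le> 1 + (norm x)\<^sup>2"
        using sum_squares_bound[of 1 "norm x"] norm_ge_zero[of x] unfolding one_power2 by linarith
      then show ?thesis by simp
    qed
    then show "AE w in M. norm (f w) \<le> norm (1 + (norm (f w))\<^sup>2)" by blast
  qed (rule that(1))
  have IA: "integrable M A" and IX: "\<And>i. i \<in> I \<Longrightarrow> integrable M (X i)"
    using sq_int[OF AM A2] sq_int[OF XM X2] by auto
  have p\<xi>_int: "AE w in M. integrable N (\<lambda>y. p (w, y) *\<^sub>R \<xi> i (w, y))" if i: "i \<in> I" for i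
  proof -
    have "AE w in M. integrable N (\<lambda>y. p (w, y) * norm (\<xi> i (w, y)))"
      using integrable_norm[OF IX[OF i], unfolded X_def] \<xi>[OF i]
      by (intro cond1(2)[OF i i, of "\<lambda>z. norm (\<xi> i z)"]) simp_all
    then show ?thesis using AE_space
    proof eventually_elim
      case (elim w)
      have m: "(\<lambda>y. p (w, y) *\<^sub>R \<xi> i (w, y)) \<in> borel_measurable N"
        using elim(2) by (intro borel_measurable_scaleR measurable_Pair2[OF p] measurable_Pair2[OF \<xi>[OF i]]) (simp_all add: spP)
      show ?case by (rule Bochner_Integration.integrable_bound[OF elim(1) m]) (simp add: p_nonneg)
    qed
  qed
  have diag: "AE w in M. real_cond_exp M F (\<lambda>w. (norm (X i w))\<^sup>2) w \<le> c i w" if i: "i \<in> I" for i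
  proof -
    let ?h = "\<lambda>z. (norm (\<xi> i z))\<^sup>2"
    have "?h \<in> borel_measurable (P \<Otimes>\<^sub>M N)" using i by measurable
    from cond1(1)[OF i i this X2[OF i, unfolded X_def]] second[OF i] show ?thesis
    proof eventually_elim
      case (elim w)
      have "(\<integral> y. p (w, y) * ?h (w, y) \<partial>N) \<le> min K (c i w)"
        using elim(2) c K p_nonneg by (intro integral_real_bounded) auto
      then show ?case using elim(1) by (simp add: X_def)
    qed
  qed
  have lin: "integrable M (\<lambda>w. inner (u w) (X i w))" "AE w in M. real_cond_exp M F (\<lambda>w. inner (u w) (X i w)) w = 0"
    if i: "i \<in> I" and u [measurable]: "u \<in> borel_measurable P" and uM: "u \<in> borel_measurable M"
      and u2: "integrable M (\<lambda>w. (norm (u w))\<^sup>2)" for i u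
  proof -
    let ?h = "\<lambda>z. inner (u (fst z)) (\<xi> i z)"
    have h: "?h \<in> borel_measurable (P \<Otimes>\<^sub>M N)" using i by measurable
    show int: "integrable M (\<lambda>w. inner (u w) (X i w))" by (rule inner_int[OF uM XM[OF i] u2 X2[OF i]])
    have "integrable M (\<lambda>w. ?h (w, Y i w))" using int by (simp add: X_def)
    from cond1(1)[OF i i h this] p\<xi>_int[OF i] mean[OF i]
    show "AE w in M. real_cond_exp M F (\<lambda>w. inner (u w) (X i w)) w = 0"
    proof eventually_elim
      case (elim w)
      have "(\<integral> y. p (w, y) * ?h (w, y) \<partial>N) = (\<integral> y. inner (u w) (p (w, y) *\<^sub>R \<xi> i (w, y)) \<partial>N)" by simp
      also have "\<dots> = 0" using elim(2,3) by (subst integral_inner_right) auto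
      finally show ?case using elim(1) by (simp add: X_def)
    qed
  qed
  have cross: "AE w in M. real_cond_exp M F (\<lambda>w. inner (X i w) (X j w)) w = 0"
    if i: "i \<in> I" and j: "j \<in> I" and ij: "i \<noteq> j" for i j
  proof -
    let ?p = "\<lambda>z. p (fst z, fst (snd z)) * p (fst z, snd (snd z))"
    let ?h = "\<lambda>z. inner (\<xi> i (fst z, fst (snd z))) (\<xi> j (fst z, snd (snd z)))"
    have Nm: "sigma_finite_measure (N \<Otimes>\<^sub>M N)" by unfold_locales
    have Ym: "(\<lambda>w. (Y i w, Y j w)) \<in> measurable M (N \<Otimes>\<^sub>M N)" using Y i j by simp
    have pm: "?p \<in> borel_measurable (P \<Otimes>\<^sub>M (N \<Otimes>\<^sub>M N))" by measurable
    have hm: "?h \<in> borel_measurable (P \<Otimes>\<^sub>M (N \<Otimes>\<^sub>M N))" using i j by measurable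
    have p0: "0 \<le> ?p z" for z using p_nonneg by simp
    have "integrable M (\<lambda>w. ?h (w, (Y i w, Y j w)))"
      using inner_int[OF XM XM X2 X2, OF i j i j] by (simp add: X_def)
    note C = real_cond_exp_joint[OF sub Nm Ym pm[unfolded P_def] p0 law2[OF i j ij, unfolded P_def] hm[unfolded P_def] this]
    from C p\<xi>_int[OF j] mean[OF j] show ?thesis
    proof eventually_elim
      case (elim w)
      have "(\<integral> y. ?p (w, y) * ?h (w, y) \<partial>(N \<Otimes>\<^sub>M N)) = (\<integral> y. \<integral> y'. ?p (w, (y, y')) * ?h (w, (y, y')) \<partial>N \<partial>N)"
        by (rule NN.integral_fst'[OF elim(2), symmetric])
      \<comment> \<open>For fixed \<open>y\<close> the integrand is linear in the centred factor
        with index \<open>j\<close>, so the inner integral already vanishes.\<close>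
      also have "\<dots> = (\<integral> y. \<integral> y'. inner (p (w, y) *\<^sub>R \<xi> i (w, y)) (p (w, y') *\<^sub>R \<xi> j (w, y')) \<partial>N \<partial>N)"
        by (simp add: mult_ac)
      also have "\<dots> = 0" using elim(3,4) by (subst integral_inner_right) auto
      finally show ?case using elim(1) by (simp add: X_def)
    qed
  qed
  have pair: "integrable M (\<lambda>w. inner (X i w) (X j w))" if "i \<in> I" "j \<in> I" for i j
    by (rule inner_int[OF XM XM X2 X2]) (rule that)+
  note linA = lin[OF _ AP AM A2]
  have expand: "(norm (A w + (\<Sum>i\<in>I. X i w)))\<^sup>2
    = (norm (A w))\<^sup>2 + ((\<Sum>i\<in>I. 2 * inner (A w) (X i w)) + (\<Sum>i\<in>I. \<Sum>j\<in>I. inner (X i w) (X j w)))" for w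
    by (simp add: power2_norm_eq_inner inner_add_left inner_add_right inner_sum_left inner_sum_right inner_commute
        sum_distrib_left[symmetric])
  have I1: "integrable M (\<lambda>w. \<Sum>i\<in>I. 2 * inner (A w) (X i w))" using linA by auto
  have I2: "integrable M (\<lambda>w. \<Sum>j\<in>I. inner (X i w) (X j w))" if "i \<in> I" for i using pair that by auto
  have I3: "integrable M (\<lambda>w. \<Sum>i\<in>I. \<Sum>j\<in>I. inner (X i w) (X j w))" using I2 by (rule Bochner_Integration.integrable_sum)
  show "integrable M (\<lambda>w. (norm (A w + (\<Sum>i\<in>I. \<xi> i (w, Y i w))))\<^sup>2)"
    unfolding X_def[symmetric] expand using A2 I1 I3 by auto
  have c0: "AE w in M. real_cond_exp M F (\<lambda>w. (norm (A w))\<^sup>2) w = (norm (A w))\<^sup>2"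
    by (intro S.real_cond_exp_F_meas A2 borel_measurable_power measurable_compose[OF A borel_measurable_norm])
  have c1: "AE w in M. real_cond_exp M F (\<lambda>w. \<Sum>i\<in>I. 2 * inner (A w) (X i w)) w = 0"
  proof -
    have "AE w in M. real_cond_exp M F (\<lambda>w. \<Sum>i\<in>I. 2 * inner (A w) (X i w)) w = (\<Sum>i\<in>I. real_cond_exp M F (\<lambda>w. 2 * inner (A w) (X i w)) w)"
      using linA by (intro S.real_cond_exp_sum_on) auto
    moreover have "AE w in M. \<forall>i\<in>I. real_cond_exp M F (\<lambda>w. 2 * inner (A w) (X i w)) w = 0"
    proof (rule AE_finite_allI[OF I])
      fix i assume "i \<in> I"
      note L = linA[OF this]
      show "AE w in M. real_cond_exp M F (\<lambda>w. 2 * inner (A w) (X i w)) w = 0"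
        using S.real_cond_exp_cmult[OF L(1), of 2] L(2) by eventually_elim simp
    qed
    ultimately show ?thesis by eventually_elim simp
  qed
  have c2: "AE w in M. real_cond_exp M F (\<lambda>w. \<Sum>i\<in>I. \<Sum>j\<in>I. inner (X i w) (X j w)) w \<le> (\<Sum>i\<in>I. c i w)"
  proof -
    have "AE w in M. real_cond_exp M F (\<lambda>w. \<Sum>i\<in>I. \<Sum>j\<in>I. inner (X i w) (X j w)) w
       = (\<Sum>i\<in>I. real_cond_exp M F (\<lambda>w. \<Sum>j\<in>I. inner (X i w) (X j w)) w)"
      using I2 by (rule S.real_cond_exp_sum_on)
    moreover have "AE w in M. \<forall>i\<in>I. real_cond_exp M F (\<lambda>w. \<Sum>j\<in>I. inner (X i w) (X j w)) w \<le> c i w"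
    proof (rule AE_finite_allI[OF I])
      fix i assume i: "i \<in> I"
      have "AE w in M. real_cond_exp M F (\<lambda>w. \<Sum>j\<in>I. inner (X i w) (X j w)) w = (\<Sum>j\<in>I. real_cond_exp M F (\<lambda>w. inner (X i w) (X j w)) w)"
        using pair[OF i] by (rule S.real_cond_exp_sum_on)
      \<comment> \<open>The case distinction merges diagonal and mixed terms into one bound, whose
        sum over \<open>j\<close> is \<open>c i w\<close>.\<close>
      moreover have "AE w in M. \<forall>j\<in>I. real_cond_exp M F (\<lambda>w. inner (X i w) (X j w)) w \<le> (if j = i then c i w else 0)"
      proof (rule AE_finite_allI[OF I])
        fix j assume j: "j \<in> I"
        show "AE w in M. real_cond_exp M F (\<lambda>w. inner (X i w) (X j w)) w \<le> (if j = i then c i w else 0)"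
        proof (cases "j = i")
          case True
          then show ?thesis using diag[OF i] by (simp add: power2_norm_eq_inner)
        next
          case False
          then show ?thesis using cross[OF i j] by (auto elim: eventually_mono)
        qed
      qed
      ultimately show "AE w in M. real_cond_exp M F (\<lambda>w. \<Sum>j\<in>I. inner (X i w) (X j w)) w \<le> c i w"
      proof eventually_elim
        case (elim w)
        then have "real_cond_exp M F (\<lambda>w. \<Sum>j\<in>I. inner (X i w) (X j w)) w \<le> (\<Sum>j\<in>I. if j = i then c i w else 0)"
          by (simp only:) (intro sum_mono, blast)
        then show ?case using I i by simp
      qed
    qed
    ultimately show ?thesis
    proof eventually_elim
      case (elim w)
      then show ?case by (simp only:) (intro sum_mono, blast)
    qed
  qed
  have "AE w in M. real_cond_exp M F (\<lambda>w. (norm (A w))\<^sup>2 + ((\<Sum>i\<in>I. 2 * inner (A w) (X i w)) + (\<Sum>i\<in>I. \<Sum>j\<in>I. inner (X i w) (X j w)))) w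
     = real_cond_exp M F (\<lambda>w. (norm (A w))\<^sup>2) w + real_cond_exp M F (\<lambda>w. (\<Sum>i\<in>I. 2 * inner (A w) (X i w)) + (\<Sum>i\<in>I. \<Sum>j\<in>I. inner (X i w) (X j w))) w"
    using A2 I1 I3 by (intro S.real_cond_exp_add Bochner_Integration.integrable_add)
  with S.real_cond_exp_add[OF I1 I3] c0 c1 c2
  show "AE w in M. real_cond_exp M F (\<lambda>w. (norm (A w + (\<Sum>i\<in>I. \<xi> i (w, Y i w))))\<^sup>2) w \<le> (norm (A w))\<^sup>2 + (\<Sum>i\<in>I. c i w)"
    unfolding X_def[symmetric] expand by eventually_elim simp
  from IA IX show "integrable M (\<lambda>w. A w + (\<Sum>i\<in>I. \<xi> i (w, Y i w)))"
    unfolding X_def[symmetric] by (intro Bochner_Integration.integrable_add Bochner_Integration.integrable_sum)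
  have linE: "integrable M (\<lambda>w. inner e (X i w))" "AE w in M. real_cond_exp M F (\<lambda>w. inner e (X i w)) w = 0"
    if "i \<in> I" for i using lin[OF that borel_measurable_const borel_measurable_const, of e] by simp_all
  have IeA: "integrable M (\<lambda>w. inner e (A w))" using IA by auto
  have "AE w in M. real_cond_exp M F (\<lambda>w. inner e (A w)) w = inner e (A w)"
    by (intro S.real_cond_exp_F_meas IeA borel_measurable_inner borel_measurable_const A)
  moreover have "AE w in M. real_cond_exp M F (\<lambda>w. \<Sum>i\<in>I. inner e (X i w)) w = (\<Sum>i\<in>I. real_cond_exp M F (\<lambda>w. inner e (X i w)) w)"
    using linE(1) by (rule S.real_cond_exp_sum_on)
  moreover have "AE w in M. \<forall>i\<in>I. real_cond_exp M F (\<lambda>w. inner e (X i w)) w = 0"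
    using linE by (intro AE_finite_allI I)
  moreover have "AE w in M. real_cond_exp M F (\<lambda>w. inner e (A w) + (\<Sum>i\<in>I. inner e (X i w))) w
     = real_cond_exp M F (\<lambda>w. inner e (A w)) w + real_cond_exp M F (\<lambda>w. \<Sum>i\<in>I. inner e (X i w)) w"
    using IeA linE by (intro S.real_cond_exp_add Bochner_Integration.integrable_sum) auto
  ultimately show "AE w in M. real_cond_exp M F (\<lambda>w. inner e (A w + (\<Sum>i\<in>I. \<xi> i (w, Y i w)))) w = inner e (A w)"
    unfolding X_def[symmetric] inner_add_right inner_sum_right by eventually_elim simp
qed

section \<open>Sigma-fields generated by samples\<close>

lemma space_gen_field: "space (gen_field \<Omega> T Xs) = space \<Omega>"
  and sets_gen_field: "sets (gen_field \<Omega> T Xs) = sigma_sets (space \<Omega>) {Y -` A \<inter> space \<Omega> | Y A. Y \<in> Xs \<and> A \<in> sets T}"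
proof -
  have "{Y -` A \<inter> space \<Omega> | Y A. Y \<in> Xs \<and> A \<in> sets T} \<subseteq> Pow (space \<Omega>)" by blast
  then show "space (gen_field \<Omega> T Xs) = space \<Omega>"
    "sets (gen_field \<Omega> T Xs) = sigma_sets (space \<Omega>) {Y -` A \<inter> space \<Omega> | Y A. Y \<in> Xs \<and> A \<in> sets T}"
    by (simp_all add: gen_field_def space_measure_of sets_measure_of)
qed

lemma subalgebra_gen_field:
  assumes "\<And>Y. Y \<in> Xs \<Longrightarrow> Y \<in> measurable \<Omega> T"
  shows "subalgebra \<Omega> (gen_field \<Omega> T Xs)"
  unfolding subalgebra_def space_gen_field sets_gen_field
  using assms by (auto intro!: sets.sigma_sets_subset measurable_sets)

lemma measurable_gen_field:
  assumes "Y \<in> Xs" "Y \<in> measurable \<Omega> T"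
  shows "Y \<in> measurable (gen_field \<Omega> T Xs) T"
proof (rule measurableI)
  show "Y w \<in> space T" if "w \<in> space (gen_field \<Omega> T Xs)" for w
    using measurable_space[OF assms(2)] that by (simp add: space_gen_field)
  show "Y -` A \<inter> space (gen_field \<Omega> T Xs) \<in> sets (gen_field \<Omega> T Xs)" if "A \<in> sets T" for A
    unfolding space_gen_field sets_gen_field using assms(1) that by (intro sigma_sets.Basic) blast
qed

lemma measurable_gen_field_mono:
  assumes "Xs \<subseteq> Xs'" "f \<in> measurable (gen_field \<Omega> T Xs) N"
  shows "f \<in> measurable (gen_field \<Omega> T Xs') N"
proof -
  have "sets (gen_field \<Omega> T Xs) \<subseteq> sets (gen_field \<Omega> T Xs')"
    unfolding sets_gen_field using assms(1) by (intro sigma_sets_mono') blast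
  then show ?thesis using assms(2) by (auto simp: measurable_def space_gen_field)
qed

section \<open>Gradients\<close>

text \<open>\<open>grad\<close> is a definite description, so every evaluation of it rests on
  uniqueness of the representing vector.\<close>

lemma grad_eqI:
  assumes "GDERIV f x :> D" shows "grad f x = D"
  unfolding grad_def
proof (rule the_equality)
  show "GDERIV f x :> D" by (rule assms)
  fix D' assume "GDERIV f x :> D'"
  then have "(\<lambda>h. inner h D') = (\<lambda>h. inner h D)"
    using assms unfolding gderiv_def by (rule has_derivative_unique)
  then have "inner (D' - D) D' = inner (D' - D) D" by metis
  then have "inner (D' - D) (D' - D) = 0" by (simp add: inner_diff_right)
  then show "D' = D" by simp
qed

lemma GDERIV_grad:
  fixes f :: "'x::euclidean_space \<Rightarrow> real"
  assumes "f differentiable (at x)" shows "GDERIV f x :> grad f x"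
proof -
  obtain f' where f': "(f has_derivative f') (at x)" using assms by (auto simp: differentiable_def)
  interpret bounded_linear f' using f' by (rule has_derivative_bounded_linear)
  have "f' h = inner h (\<Sum>b\<in>Basis. f' b *\<^sub>R b)" for h
  proof -
    have "f' h = f' (\<Sum>b\<in>Basis. inner h b *\<^sub>R b)" by (simp add: euclidean_representation)
    also have "\<dots> = (\<Sum>b\<in>Basis. inner h b * f' b)" by (simp add: sum scaleR)
    finally show ?thesis by (simp add: inner_sum_right mult.commute)
  qed
  then have "f' = (\<lambda>h. inner h (\<Sum>b\<in>Basis. f' b *\<^sub>R b))" by blast
  with f' have D: "GDERIV f x :> (\<Sum>b\<in>Basis. f' b *\<^sub>R b)" by (simp add: gderiv_def)
  then show ?thesis using grad_eqI[OF D] by simp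
qed

text \<open>A quadratic remainder estimate survives integration, which makes it a suitable criterion
  for differentiating an expectation.\<close>

lemma GDERIV_from_quadratic_remainder:
  fixes f :: "'x::real_inner \<Rightarrow> real"
  assumes C: "0 \<le> C" and r: "0 < r"
    and rem: "\<And>h. norm h \<le> r \<Longrightarrow> \<bar>f (x + h) - f x - inner h D\<bar> \<le> C * (norm h)\<^sup>2"
  shows "GDERIV f x :> D"
  unfolding gderiv_def has_derivative_at
proof (intro conjI bounded_linear_inner_left)
  show "(\<lambda>h. norm (f (x + h) - f x - inner h D) / norm h) \<midarrow>0\<rightarrow> 0"
  proof (rule Lim_null_comparison)
    show "\<forall>\<^sub>F h in at 0. norm (norm (f (x + h) - f x - inner h D) / norm h) \<le> C * norm h"
      unfolding eventually_at
    proof (intro exI[of _ r] conjI r ballI impI)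
      fix h :: 'x assume h: "h \<noteq> 0 \<and> dist h 0 < r"
      then have "\<bar>f (x + h) - f x - inner h D\<bar> / norm h \<le> C * (norm h)\<^sup>2 / norm h"
        using rem[of h] by (intro divide_right_mono) auto
      also have "\<dots> = C * norm h" using h by (simp add: power2_eq_square)
      finally show "norm (norm (f (x + h) - f x - inner h D) / norm h) \<le> C * norm h" by simp
    qed
    show "(\<lambda>h. C * norm h) \<midarrow>0\<rightarrow> 0" by (auto intro!: tendsto_eq_intros)
  qed
qed

lemma GDERIV_lipschitz:
  fixes f :: "'x::euclidean_space \<Rightarrow> real"
  assumes "\<And>x. GDERIV f x :> D x" "\<And>x. norm (D x) \<le> B"
  shows "\<bar>f x - f y\<bar> \<le> B * norm (x - y)"
proof -
  have "norm (f x - f y) \<le> B * norm (x - y)"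
  proof (rule differentiable_bound[of UNIV f "\<lambda>x h. inner h (D x)"])
    fix z
    show "(f has_derivative (\<lambda>h. inner h (D z))) (at z within UNIV)" using assms(1)[of z] by (simp add: gderiv_def)
    show "onorm (\<lambda>h. inner h (D z)) \<le> B"
    proof (rule onorm_le)
      fix h
      have "norm (inner h (D z)) \<le> norm h * norm (D z)" using Cauchy_Schwarz_ineq2 by auto
      also have "\<dots> \<le> norm h * B" using assms(2) by (intro mult_left_mono) auto
      finally show "norm (inner h (D z)) \<le> B * norm h" by (simp add: mult.commute)
    qed
  qed auto
  then show ?thesis by simp
qed

lemma GDERIV_along_line:
  fixes f :: "'x::euclidean_space \<Rightarrow> real"
  assumes "GDERIV f (x + u *\<^sub>R h) :> D"
  shows "((\<lambda>u. f (x + u *\<^sub>R h)) has_real_derivative inner h D) (at u)"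
proof -
  have "((\<lambda>u. f (x + u *\<^sub>R h)) has_derivative (\<lambda>t. inner (t *\<^sub>R h) D)) (at u)"
    using assms[unfolded gderiv_def]
    by (rule has_derivative_compose[rotated]) (auto intro!: derivative_eq_intros)
  then show ?thesis by (simp add: has_field_derivative_def mult.commute[of _ "inner h _"])
qed

text \<open>The mean value theorem is applied to \<open>f\<close> along the segment minus the
  integral of the linearly interpolated gradient. The increment of this difference is the error of
  the trapezoid rule; its derivative is the deviation of the gradient from the
  interpolation.\<close>

lemma GDERIV_mean_value:
  fixes f :: "'x::euclidean_space \<Rightarrow> real"
  assumes D: "\<And>x. GDERIV f x :> D x"
  obtains u where "0 < u" "u < 1"
    "f (x + h) - f x - inner h (D x + D (x + h)) / 2
       = inner h (D (x + u *\<^sub>R h) - ((1 - u) *\<^sub>R D x + u *\<^sub>R D (x + h)))"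
proof -
  let ?\<phi> = "\<lambda>u. f (x + u *\<^sub>R h) - (u * inner h (D x) + u\<^sup>2 / 2 * inner h (D (x + h) - D x))"
  have "(?\<phi> has_real_derivative inner h (D (x + u *\<^sub>R h)) - (inner h (D x) + u * inner h (D (x + h) - D x))) (at u)" for u
    using GDERIV_along_line[OF D] by (auto intro!: derivative_eq_intros)
  then obtain u where u: "0 < u" "u < 1"
    "?\<phi> 1 - ?\<phi> 0 = (1 - 0) * (inner h (D (x + u *\<^sub>R h)) - (inner h (D x) + u * inner h (D (x + h) - D x)))"
    using MVT2[of 0 1 ?\<phi> "\<lambda>u. inner h (D (x + u *\<^sub>R h)) - (inner h (D x) + u * inner h (D (x + h) - D x))"] by auto
  show ?thesis
    by (rule that[OF u(1,2)]) (use u(3) in \<open>simp add: inner_add_right inner_diff_right add_divide_distrib algebra_simps\<close>)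
qed

text \<open>The bound vanishes when the gradient changes at the maximal rate. This makes the error
  comparable to the slack in the Lipschitz bound for the score.\<close>

lemma GDERIV_trapezoid_error:
  fixes f :: "'x::euclidean_space \<Rightarrow> real"
  assumes D: "\<And>x. GDERIV f x :> D x" and lip: "\<And>x y. norm (D x - D y) \<le> L * norm (x - y)"
  shows "\<bar>f (x + h) - f x - inner h (D x + D (x + h)) / 2\<bar>
    \<le> norm h / 2 * sqrt ((L * norm h)\<^sup>2 - (norm (D x - D (x + h)))\<^sup>2)"
proof -
  obtain u where u: "0 < u" "u < 1"
    "f (x + h) - f x - inner h (D x + D (x + h)) / 2
       = inner h (D (x + u *\<^sub>R h) - ((1 - u) *\<^sub>R D x + u *\<^sub>R D (x + h)))"
    using GDERIV_mean_value[OF D] .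
  let ?a = "D x" and ?b = "D (x + h)" and ?p = "D (x + u *\<^sub>R h)"
  let ?E = "(L * norm h)\<^sup>2 - (norm (?a - ?b))\<^sup>2"
  have pa: "norm (?p - ?a) \<le> u * (L * norm h)" using lip[of "x + u *\<^sub>R h" x] u by (simp add: algebra_simps)
  have pb: "norm (?p - ?b) \<le> (1 - u) * (L * norm h)"
  proof -
    have "x + u *\<^sub>R h - (x + h) = - ((1 - u) *\<^sub>R h)" by (simp add: algebra_simps)
    then have "norm (x + u *\<^sub>R h - (x + h)) = (1 - u) * norm h" using u by simp
    then show ?thesis using lip[of "x + u *\<^sub>R h" "x + h"] by (simp only: mult.left_commute)
  qed
  \<comment> \<open>Stewart's theorem: the distance from a vertex to a point of the opposite side.
    With the two Lipschitz bounds the first two terms combine to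
    \<open>u * (1 - u) * (L * norm h)^2\<close>, and \<open>u * (1 - u) \<le> 1/4\<close> is the
    origin of the factor 1/2 in the result.\<close>
  have "(norm (p - ((1 - u) *\<^sub>R a + u *\<^sub>R b)))\<^sup>2
    = (1 - u) * (norm (p - a))\<^sup>2 + u * (norm (p - b))\<^sup>2 - u * (1 - u) * (norm (a - b))\<^sup>2" for p a b :: 'x
    unfolding power2_norm_eq_inner
    by (simp add: inner_diff_left inner_diff_right inner_add_left inner_add_right inner_commute algebra_simps)
  then have "(norm (?p - ((1 - u) *\<^sub>R ?a + u *\<^sub>R ?b)))\<^sup>2
    = (1 - u) * (norm (?p - ?a))\<^sup>2 + u * (norm (?p - ?b))\<^sup>2 - u * (1 - u) * (norm (?a - ?b))\<^sup>2" .
  also have "\<dots> \<le> (1 - u) * (u * (L * norm h))\<^sup>2 + u * ((1 - u) * (L * norm h))\<^sup>2 - u * (1 - u) * (norm (?a - ?b))\<^sup>2"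
    using pa pb u by (intro diff_right_mono add_mono mult_left_mono power_mono) auto
  also have "\<dots> = u * (1 - u) * ?E"
    by (simp add: power2_eq_square algebra_simps)
  also have "\<dots> \<le> 1 / 4 * ?E"
  proof (rule mult_right_mono)
    have "0 \<le> (1 / 2 - u)\<^sup>2" by simp
    then show "u * (1 - u) \<le> 1 / 4" by (simp add: power2_eq_square algebra_simps)
    have "norm (?a - ?b) \<le> L * norm h" using lip[of x "x + h"] by simp
    then show "0 \<le> ?E" by (simp add: power_mono)
  qed
  finally have "norm (?p - ((1 - u) *\<^sub>R ?a + u *\<^sub>R ?b)) \<le> sqrt (1 / 4 * ?E)"
    by (rule real_le_rsqrt)
  also have "\<dots> = 1 / 2 * sqrt ?E" by (simp add: real_sqrt_mult real_sqrt_divide)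
  finally have "norm h * norm (?p - ((1 - u) *\<^sub>R ?a + u *\<^sub>R ?b)) \<le> norm h * (1 / 2 * sqrt ?E)"
    by (intro mult_left_mono) auto
  moreover have "\<bar>inner h (?p - ((1 - u) *\<^sub>R ?a + u *\<^sub>R ?b))\<bar> \<le> norm h * norm (?p - ((1 - u) *\<^sub>R ?a + u *\<^sub>R ?b))"
    by (rule Cauchy_Schwarz_ineq2)
  ultimately show ?thesis unfolding u(3) by simp
qed

lemma abs_exp_minus_affine_le:
  fixes x :: real
  assumes "\<bar>x\<bar> \<le> 1" shows "\<bar>exp x - 1 - x\<bar> \<le> 2 * x\<^sup>2"
proof -
  obtain t where t: "\<bar>t\<bar> \<le> \<bar>x\<bar>" "exp x = (\<Sum>m<2. x ^ m / fact m) + exp t / fact 2 * x ^ 2"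
    using Maclaurin_exp_le[of x 2] by auto
  have "exp t \<le> exp 1" using t(1) assms by simp
  also have "\<dots> \<le> (3::real)" by (rule exp_le)
  finally have "exp t / 2 * x\<^sup>2 \<le> 2 * x\<^sup>2" by (intro mult_right_mono) auto
  moreover have "exp x - 1 - x = exp t / 2 * x\<^sup>2" using t(2) by (simp add: numeral_2_eq_2)
  moreover have "0 \<le> exp t / 2 * x\<^sup>2" by simp
  ultimately show ?thesis by linarith
qed

section \<open>The policy gradient model\<close>

locale policy_gradient =
  fixes X :: "('s, 'a, 'q::finite) pg_model" and R G M b :: real
  assumes model: "wf_model X"
    and baseline_bound: "\<And>k s. s \<in> space (states X) \<Longrightarrow> \<bar>baseline X k s\<bar> \<le> b"
    and R_pos: "R > 0"
    and reward_bound: "\<And>s a. \<lbrakk>s \<in> space (states X); a \<in> space (actions X)\<rbrakk> \<Longrightarrow> \<bar>reward X s a\<bar> \<le> R"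
    and G_pos: "G > 0" and M_pos: "M > 0"
    and score_bound: "\<And>\<theta> s a. \<lbrakk>s \<in> space (states X); a \<in> space (actions X)\<rbrakk> \<Longrightarrow>
         norm (grad (log_policy X s a) \<theta>) \<le> G"
    and hessian_bound: "\<And>\<theta> s a. \<lbrakk>s \<in> space (states X); a \<in> space (actions X)\<rbrakk> \<Longrightarrow>
         onorm (hessian (log_policy X s a) \<theta>) \<le> M"
begin

abbreviation "S \<equiv> states X"
abbreviation "Act \<equiv> actions X"
abbreviation "T \<equiv> traj_space X"
abbreviation "H \<equiv> horizon X"

definition score :: "real ^ 'q \<Rightarrow> 's \<times> 'a \<Rightarrow> real ^ 'q" where
  "score \<theta> y = grad (log_policy X (fst y) (snd y)) \<theta>"

lemma H_pos: "1 \<le> H" and discount_bounds: "0 < discount X" "discount X < 1"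
  and sigma_finite_S: "sigma_finite_measure S" and sigma_finite_Act: "sigma_finite_measure Act"
  using model by (auto simp: wf_model_def)

lemma policy_pos: "s \<in> space S \<Longrightarrow> a \<in> space Act \<Longrightarrow> 0 < policy X \<theta> s a"
  using model by (auto simp: wf_model_def)

lemma policy_diff:
  assumes "s \<in> space S" "a \<in> space Act"
  shows "(\<lambda>\<theta>. policy X \<theta> s a) differentiable (at \<theta>)" "grad (\<lambda>\<theta>. policy X \<theta> s a) differentiable (at \<theta>)"
  using model assms by (auto simp: wf_model_def twice_differentiable_def)

context
  fixes y :: "'s \<times> 'a"
  assumes y: "y \<in> space (S \<Otimes>\<^sub>M Act)"
begin

lemma y_parts: "fst y \<in> space S" "snd y \<in> space Act"
  using y by (auto simp: space_pair_measure)

lemma GDERIV_log_policy: "GDERIV (log_policy X (fst y) (snd y)) \<theta> :> score \<theta> y"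
  and score_eq: "score \<theta> y = (1 / policy X \<theta> (fst y) (snd y)) *\<^sub>R grad (\<lambda>\<theta>. policy X \<theta> (fst y) (snd y)) \<theta>"
proof -
  note pos = policy_pos[OF y_parts]
  have D: "GDERIV (log_policy X (fst y) (snd y)) \<theta> :> (1 / policy X \<theta> (fst y) (snd y)) *\<^sub>R grad (\<lambda>\<theta>. policy X \<theta> (fst y) (snd y)) \<theta>"
    unfolding log_policy_def
    by (rule GDERIV_DERIV_compose[OF GDERIV_grad[OF policy_diff(1)[OF y_parts]]]) (rule DERIV_ln_divide[OF pos])
  show "score \<theta> y = (1 / policy X \<theta> (fst y) (snd y)) *\<^sub>R grad (\<lambda>\<theta>. policy X \<theta> (fst y) (snd y)) \<theta>"
    unfolding score_def by (rule grad_eqI[OF D])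
  with D show "GDERIV (log_policy X (fst y) (snd y)) \<theta> :> score \<theta> y" by simp
qed

lemma norm_score_le: "norm (score \<theta> y) \<le> G"
  unfolding score_def by (rule score_bound[OF y_parts])

text \<open>Mean value inequality for the score, whose derivative is the Hessian of the log-policy.
  Smoothness is given for the policy and not for its logarithm, so differentiability of the score is
  obtained from its quotient form \<open>score_eq\<close>.\<close>

lemma score_lipschitz: "norm (score \<theta> y - score \<theta>' y) \<le> M * norm (\<theta> - \<theta>')"
proof (rule differentiable_bound[of UNIV "\<lambda>\<theta>. score \<theta> y" "\<lambda>\<theta>. hessian (log_policy X (fst y) (snd y)) \<theta>"])
  fix \<theta>
  have ne: "policy X \<theta> (fst y) (snd y) \<noteq> 0" for \<theta> using policy_pos[OF y_parts, of \<theta>] by simp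
  have "(\<lambda>\<theta>. (1 / policy X \<theta> (fst y) (snd y)) *\<^sub>R grad (\<lambda>\<theta>. policy X \<theta> (fst y) (snd y)) \<theta>) differentiable (at \<theta>)"
    using policy_diff[OF y_parts] ne by (intro differentiable_scaleR differentiable_divide differentiable_const) auto
  then have "(\<lambda>\<theta>. score \<theta> y) differentiable (at \<theta>)" by (simp add: score_eq)
  moreover have "(\<lambda>\<theta>. score \<theta> y) = grad (log_policy X (fst y) (snd y))" by (auto simp: score_def)
  ultimately show "((\<lambda>\<theta>. score \<theta> y) has_derivative hessian (log_policy X (fst y) (snd y)) \<theta>) (at \<theta> within UNIV)"
    by (simp add: hessian_def frechet_derivative_works)
  show "onorm (hessian (log_policy X (fst y) (snd y)) \<theta>) \<le> M" by (rule hessian_bound[OF y_parts])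
qed auto

lemma continuous_on_score: "continuous_on UNIV (\<lambda>\<theta>. score \<theta> y)"
proof -
  have "M-lipschitz_on UNIV (\<lambda>\<theta>. score \<theta> y)"
    using M_pos score_lipschitz by (intro lipschitz_onI) (auto simp: dist_norm)
  then show ?thesis by (rule lipschitz_on_continuous_on)
qed

lemma continuous_on_policy: "continuous_on UNIV (\<lambda>\<theta>. policy X \<theta> (fst y) (snd y))"
  using policy_diff(1)[OF y_parts] differentiable_imp_continuous_within
  by (auto simp: continuous_on_eq_continuous_within)

lemma log_policy_diff_le: "\<bar>log_policy X (fst y) (snd y) \<theta>' - log_policy X (fst y) (snd y) \<theta>\<bar> \<le> G * norm (\<theta>' - \<theta>)"
  by (rule GDERIV_lipschitz[OF GDERIV_log_policy norm_score_le])

lemma ln_policy_ratio: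
  "ln (policy X \<theta>' (fst y) (snd y) / policy X \<theta> (fst y) (snd y))
    = log_policy X (fst y) (snd y) \<theta>' - log_policy X (fst y) (snd y) \<theta>"
  using policy_pos[OF y_parts] by (simp add: log_policy_def ln_divide_pos)

lemma policy_ratio_bounds:
  "exp (- (G * norm (\<theta>' - \<theta>))) \<le> policy X \<theta>' (fst y) (snd y) / policy X \<theta> (fst y) (snd y)"
  "policy X \<theta>' (fst y) (snd y) / policy X \<theta> (fst y) (snd y) \<le> exp (G * norm (\<theta>' - \<theta>))"
proof -
  let ?r = "policy X \<theta>' (fst y) (snd y) / policy X \<theta> (fst y) (snd y)"
  have "0 < ?r" using policy_pos[OF y_parts] by simp
  then have "?r = exp (ln ?r)" by simp
  moreover have "- (G * norm (\<theta>' - \<theta>)) \<le> ln ?r \<and> ln ?r \<le> G * norm (\<theta>' - \<theta>)"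
    unfolding ln_policy_ratio using log_policy_diff_le[of \<theta>' \<theta>] by linarith
  ultimately show "exp (- (G * norm (\<theta>' - \<theta>))) \<le> ?r" "?r \<le> exp (G * norm (\<theta>' - \<theta>))"
    by (metis exp_le_cancel_iff)+
qed

end

section \<open>Measurability of the model data and of the score\<close>

lemma measurable_policy [measurable]:
  "(\<lambda>y. policy X \<theta> (fst y) (snd y)) \<in> borel_measurable (S \<Otimes>\<^sub>M Act)"
  using model by (simp add: wf_model_def case_prod_beta')

lemma measurable_reward [measurable]: "(\<lambda>y. reward X (fst y) (snd y)) \<in> borel_measurable (S \<Otimes>\<^sub>M Act)"
  using model by (simp add: wf_model_def case_prod_beta')

lemma measurable_baseline [measurable]: "baseline X k \<in> borel_measurable S"
  using model by (simp add: wf_model_def)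

lemma measurable_init [measurable]: "init_dens X \<in> borel_measurable S"
  using model by (simp add: wf_model_def)

lemma measurable_trans [measurable]:
  assumes [measurable]: "f \<in> measurable N S" "g \<in> measurable N Act" "h \<in> measurable N S"
  shows "(\<lambda>x. trans_dens X (f x) (g x) (h x)) \<in> borel_measurable N"
proof -
  have "(\<lambda>(s, a, s'). trans_dens X s a s') \<in> borel_measurable (S \<Otimes>\<^sub>M Act \<Otimes>\<^sub>M S)"
    using model by (simp add: wf_model_def)
  from measurable_compose[of "\<lambda>x. (f x, g x, h x)", OF _ this] show ?thesis by simp
qed

text \<open>Each component of the score is a limit of difference quotients.\<close>

lemma measurable_score [measurable]: "score \<theta> \<in> borel_measurable (S \<Otimes>\<^sub>M Act)"
proof -
  have "(\<lambda>y. score \<theta> y $ i) \<in> borel_measurable (S \<Otimes>\<^sub>M Act)" for i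
  proof (rule borel_measurable_LIMSEQ_real)
    let ?e = "\<lambda>n. \<theta> + (1 / real (Suc n)) *\<^sub>R axis i 1"
    let ?q = "\<lambda>n y. (ln (policy X (?e n) (fst y) (snd y)) - ln (policy X \<theta> (fst y) (snd y))) / (1 / real (Suc n))"
    show "?q n \<in> borel_measurable (S \<Otimes>\<^sub>M Act)" for n by measurable
    fix y assume y: "y \<in> space (S \<Otimes>\<^sub>M Act)"
    have "((\<lambda>t. log_policy X (fst y) (snd y) (\<theta> + t *\<^sub>R axis i 1)) has_real_derivative inner (axis i 1) (score \<theta> y)) (at 0)"
      by (rule GDERIV_along_line) (simp add: GDERIV_log_policy[OF y])
    then have "((\<lambda>t. log_policy X (fst y) (snd y) (\<theta> + t *\<^sub>R axis i 1)) has_real_derivative score \<theta> y $ i) (at 0)"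
      by (simp add: inner_axis')
    then have "((\<lambda>t. (log_policy X (fst y) (snd y) (\<theta> + t *\<^sub>R axis i 1) - log_policy X (fst y) (snd y) \<theta>) / t) \<longlongrightarrow> score \<theta> y $ i) (at 0)"
      by (simp add: has_field_derivative_iff)
    moreover have "filterlim (\<lambda>n. 1 / real (Suc n)) (at 0) sequentially"
      unfolding filterlim_at using LIMSEQ_inverse_real_of_nat by (auto simp: inverse_eq_divide)
    ultimately show "(\<lambda>n. ?q n y) \<longlonglongrightarrow> score \<theta> y $ i"
      unfolding log_policy_def by (rule filterlim_compose)
  qed
  then have "(\<lambda>y. inner (score \<theta> y) e) \<in> borel_measurable (S \<Otimes>\<^sub>M Act)" if "e \<in> Basis" for e
    using that by (auto simp: Basis_vec_def inner_axis)
  then show ?thesis by (subst borel_measurable_euclidean_space) auto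
qed

text \<open>Every step has its own policy parameter and the length is free. Replacing the policy at
  some steps thus stays inside one family of probability densities, and the steps can be integrated
  out from the end.\<close>

definition mix_dens :: "(nat \<Rightarrow> real ^ 'q) \<Rightarrow> nat \<Rightarrow> ('s, 'a) traj \<Rightarrow> real" where
  "mix_dens \<phi> n \<tau> = init_dens X (st \<tau> 0) * (\<Prod>t<n. policy X (\<phi> t) (st \<tau> t) (act \<tau> t)) *
     (\<Prod>t<n - 1. trans_dens X (st \<tau> t) (act \<tau> t) (st \<tau> (Suc t)))"

abbreviation "trajs (n::nat) \<equiv> PiM {..<n} (\<lambda>_. S \<Otimes>\<^sub>M Act)"

lemma traj_dens_eq_mix: "traj_dens X \<theta> = mix_dens (\<lambda>_. \<theta>) H"
  by (auto simp: traj_dens_def mix_dens_def)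

lemma traj_space_eq: "T = trajs H"
  by (simp add: traj_space_def)

lemma product_sigma_finite_SA: "product_sigma_finite (\<lambda>_::nat. S \<Otimes>\<^sub>M Act)"
proof -
  interpret pair_sigma_finite S Act
    by (intro pair_sigma_finite.intro sigma_finite_S sigma_finite_Act)
  show ?thesis by (intro product_sigma_finite.intro sigma_finite_measure_axioms)
qed

lemma sigma_finite_T: "sigma_finite_measure T"
proof -
  interpret product_sigma_finite "\<lambda>_::nat. S \<Otimes>\<^sub>M Act" by (rule product_sigma_finite_SA)
  show ?thesis unfolding traj_space_eq by (rule sigma_finite) simp
qed

lemma space_trajs: "\<tau> \<in> space (trajs n) \<Longrightarrow> t < n \<Longrightarrow> \<tau> t \<in> space (S \<Otimes>\<^sub>M Act)"
  by (auto simp: space_PiM)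

lemma space_trajs_parts:
  assumes "\<tau> \<in> space (trajs n)" "t < n" shows "st \<tau> t \<in> space S" "act \<tau> t \<in> space Act"
  using space_trajs[OF assms] by (auto simp: space_pair_measure)

lemma measurable_coord: "t < n \<Longrightarrow> (\<lambda>\<tau>. \<tau> t) \<in> measurable (trajs n) (S \<Otimes>\<^sub>M Act)"
  by (rule measurable_component_singleton) simp

lemma measurable_st: "t < n \<Longrightarrow> (\<lambda>\<tau>. st \<tau> t) \<in> measurable (trajs n) S"
  and measurable_act: "t < n \<Longrightarrow> (\<lambda>\<tau>. act \<tau> t) \<in> measurable (trajs n) Act"
  by (rule measurable_compose[OF measurable_coord], assumption, measurable)+

lemma measurable_mix_dens:
  assumes "1 \<le> n" shows "mix_dens \<phi> n \<in> borel_measurable (trajs n)"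
  unfolding mix_dens_def
proof (intro borel_measurable_times borel_measurable_prod)
  show "(\<lambda>\<tau>. init_dens X (st \<tau> 0)) \<in> borel_measurable (trajs n)"
    using assms by (intro measurable_compose[OF measurable_st measurable_init]) simp
  show "(\<lambda>\<tau>. policy X (\<phi> t) (st \<tau> t) (act \<tau> t)) \<in> borel_measurable (trajs n)" if "t \<in> {..<n}" for t
    using that by (intro measurable_compose[OF measurable_coord measurable_policy]) simp
  show "(\<lambda>\<tau>. trans_dens X (st \<tau> t) (act \<tau> t) (st \<tau> (Suc t))) \<in> borel_measurable (trajs n)" if "t \<in> {..<n - 1}" for t
    using that by (intro measurable_trans measurable_st measurable_act) auto
qed

lemma init_nonneg: "s \<in> space S \<Longrightarrow> 0 \<le> init_dens X s"
  and trans_nonneg: "s \<in> space S \<Longrightarrow> a \<in> space Act \<Longrightarrow> s' \<in> space S \<Longrightarrow> 0 \<le> trans_dens X s a s'"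
  using model by (auto simp: wf_model_def)

lemma mix_dens_nonneg:
  assumes \<tau>: "\<tau> \<in> space (trajs n)" and n: "1 \<le> n"
  shows "0 \<le> mix_dens \<phi> n \<tau>"
  unfolding mix_dens_def using n
  by (intro mult_nonneg_nonneg prod_nonneg init_nonneg trans_nonneg less_imp_le[OF policy_pos] ballI
      space_trajs_parts[OF \<tau>]) auto

lemma mix_dens_cong: "(\<And>t. t < n \<Longrightarrow> \<phi> t = \<phi>' t) \<Longrightarrow> mix_dens \<phi> n = mix_dens \<phi>' n"
  by (auto simp: mix_dens_def fun_eq_iff intro!: prod.cong)

lemma mix_dens_Suc:
  "mix_dens \<phi> (Suc (Suc j)) (\<tau>(Suc j := y)) = mix_dens \<phi> (Suc j) \<tau> *
     (trans_dens X (st \<tau> j) (act \<tau> j) (fst y) * policy X (\<phi> (Suc j)) (fst y) (snd y))"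
  by (simp add: mix_dens_def lessThan_Suc mult_ac)

lemma nn_integral_policy:
  assumes K [measurable]: "K \<in> borel_measurable S"
  shows "(\<integral>\<^sup>+ y. K (fst y) * ennreal (policy X \<theta> (fst y) (snd y)) \<partial>(S \<Otimes>\<^sub>M Act)) = (\<integral>\<^sup>+ s. K s \<partial>S)"
proof -
  interpret sigma_finite_measure Act by (rule sigma_finite_Act)
  have "(\<integral>\<^sup>+ y. K (fst y) * ennreal (policy X \<theta> (fst y) (snd y)) \<partial>(S \<Otimes>\<^sub>M Act))
    = (\<integral>\<^sup>+ s. \<integral>\<^sup>+ a. K s * ennreal (policy X \<theta> s a) \<partial>Act \<partial>S)"
    by (subst nn_integral_fst[symmetric]) auto
  also have "\<dots> = (\<integral>\<^sup>+ s. K s \<partial>S)"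
  proof (rule nn_integral_cong)
    fix s assume s: "s \<in> space S"
    have "(\<lambda>a. policy X \<theta> s a) \<in> borel_measurable Act"
      using measurable_compose[OF measurable_Pair1'[OF s] measurable_policy[of \<theta>]] by simp
    then have "(\<integral>\<^sup>+ a. K s * ennreal (policy X \<theta> s a) \<partial>Act) = K s * (\<integral>\<^sup>+ a. ennreal (policy X \<theta> s a) \<partial>Act)"
      by (intro nn_integral_cmult) simp
    also have "(\<integral>\<^sup>+ a. ennreal (policy X \<theta> s a) \<partial>Act) = 1" using model s by (simp add: wf_model_def)
    finally show "(\<integral>\<^sup>+ a. K s * ennreal (policy X \<theta> s a) \<partial>Act) = K s" by simp
  qed
  finally show ?thesis .
qed

text \<open>Integrating out the last pair: the action disappears because the policy is normalised,
  and so does the state unless \<open>f\<close> looks at it. In that case \<open>f\<close> is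
  replaced by its average over the transition, and the policy of the last step has left no
  trace.\<close>

lemma nn_integral_mix_dens_Suc:
  assumes f [measurable]: "f \<in> borel_measurable S" and i: "i < Suc (Suc j)"
  shows "(\<integral>\<^sup>+ \<tau>. f (st \<tau> i) * ennreal (mix_dens \<phi> (Suc (Suc j)) \<tau>) \<partial>trajs (Suc (Suc j)))
    = (\<integral>\<^sup>+ \<tau>. (if i = Suc j then \<integral>\<^sup>+ s. f s * ennreal (trans_dens X (st \<tau> j) (act \<tau> j) s) \<partial>S else f (st \<tau> i))
         * ennreal (mix_dens \<phi> (Suc j) \<tau>) \<partial>trajs (Suc j))"
proof -
  interpret product_sigma_finite "\<lambda>_::nat. S \<Otimes>\<^sub>M Act" by (rule product_sigma_finite_SA)
  let ?n = "Suc j"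
  have ins: "insert ?n {..<?n} = {..<Suc ?n}" by auto
  have meas: "(\<lambda>\<tau>. f (st \<tau> i) * ennreal (mix_dens \<phi> (Suc ?n) \<tau>)) \<in> borel_measurable (trajs (Suc ?n))"
    by (intro borel_measurable_times_ennreal measurable_compose[OF measurable_st f] i
        measurable_compose[OF measurable_mix_dens measurable_ennreal]) auto
  have "(\<integral>\<^sup>+ \<tau>. f (st \<tau> i) * ennreal (mix_dens \<phi> (Suc ?n) \<tau>) \<partial>trajs (Suc ?n))
    = (\<integral>\<^sup>+ \<tau>. \<integral>\<^sup>+ y. f (st (\<tau>(?n := y)) i) * ennreal (mix_dens \<phi> (Suc ?n) (\<tau>(?n := y))) \<partial>(S \<Otimes>\<^sub>M Act) \<partial>trajs ?n)"
    using product_nn_integral_insert[of "{..<?n}" ?n, unfolded ins, OF _ _ meas] by simp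
  also have "\<dots> = (\<integral>\<^sup>+ \<tau>. (if i = ?n then \<integral>\<^sup>+ s. f s * ennreal (trans_dens X (st \<tau> j) (act \<tau> j) s) \<partial>S else f (st \<tau> i))
         * ennreal (mix_dens \<phi> ?n \<tau>) \<partial>trajs ?n)"
  proof (rule nn_integral_cong)
    fix \<tau> assume \<tau>: "\<tau> \<in> space (trajs ?n)"
    have parts: "st \<tau> j \<in> space S" "act \<tau> j \<in> space Act" using space_trajs_parts[OF \<tau>] by auto
    let ?g = "\<lambda>s. if i = ?n then f s else f (st \<tau> i)"
    let ?p = "\<lambda>s. ennreal (trans_dens X (st \<tau> j) (act \<tau> j) s)"
    let ?m = "ennreal (mix_dens \<phi> ?n \<tau>)"
    have [measurable]: "(\<lambda>s. trans_dens X (st \<tau> j) (act \<tau> j) s) \<in> borel_measurable S"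
      using parts by (intro measurable_trans measurable_const) auto
    have "(\<integral>\<^sup>+ y. f (st (\<tau>(?n := y)) i) * ennreal (mix_dens \<phi> (Suc ?n) (\<tau>(?n := y))) \<partial>(S \<Otimes>\<^sub>M Act))
      = (\<integral>\<^sup>+ y. (?m * (?g (fst y) * ?p (fst y))) * ennreal (policy X (\<phi> ?n) (fst y) (snd y)) \<partial>(S \<Otimes>\<^sub>M Act))"
    proof (rule nn_integral_cong)
      fix y assume "y \<in> space (S \<Otimes>\<^sub>M Act)"
      then have y: "fst y \<in> space S" "snd y \<in> space Act" by (auto simp: space_pair_measure)
      have nn: "0 \<le> mix_dens \<phi> ?n \<tau>" "0 \<le> trans_dens X (st \<tau> j) (act \<tau> j) (fst y)" "0 \<le> policy X (\<phi> ?n) (fst y) (snd y)"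
        using mix_dens_nonneg[OF \<tau>] trans_nonneg[OF parts y(1)] policy_pos[OF y] by (auto intro: less_imp_le)
      show "f (st (\<tau>(?n := y)) i) * ennreal (mix_dens \<phi> (Suc ?n) (\<tau>(?n := y)))
        = (?m * (?g (fst y) * ?p (fst y))) * ennreal (policy X (\<phi> ?n) (fst y) (snd y))"
        unfolding mix_dens_Suc using nn by (simp add: ennreal_mult mult_ac)
    qed
    also have "\<dots> = (\<integral>\<^sup>+ s. ?m * (?g s * ?p s) \<partial>S)" by (rule nn_integral_policy) measurable
    also have "\<dots> = ?m * (\<integral>\<^sup>+ s. ?g s * ?p s \<partial>S)" by (rule nn_integral_cmult) measurable
    also have "(\<integral>\<^sup>+ s. ?g s * ?p s \<partial>S) = (if i = ?n then \<integral>\<^sup>+ s. f s * ?p s \<partial>S else f (st \<tau> i))"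
    proof (cases "i = ?n")
      case False
      have "(\<integral>\<^sup>+ s. ?p s \<partial>S) = 1" using model parts by (simp add: wf_model_def)
      then show ?thesis using False by (simp add: nn_integral_cmult)
    qed simp
    also have "?m * (if i = ?n then \<integral>\<^sup>+ s. f s * ?p s \<partial>S else f (st \<tau> i)) = (if i = ?n then \<integral>\<^sup>+ s. f s * ?p s \<partial>S else f (st \<tau> i)) * ?m"
      by (rule mult.commute)
    finally show "(\<integral>\<^sup>+ y. f (st (\<tau>(?n := y)) i) * ennreal (mix_dens \<phi> (Suc ?n) (\<tau>(?n := y))) \<partial>(S \<Otimes>\<^sub>M Act))
      = (if i = ?n then \<integral>\<^sup>+ s. f s * ?p s \<partial>S else f (st \<tau> i)) * ?m" .
  qed
  finally show ?thesis .
qed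

lemma nn_integral_mix_dens_1:
  assumes f [measurable]: "f \<in> borel_measurable S"
  shows "(\<integral>\<^sup>+ \<tau>. f (st \<tau> 0) * ennreal (mix_dens \<phi> 1 \<tau>) \<partial>trajs 1) = (\<integral>\<^sup>+ s. f s * ennreal (init_dens X s) \<partial>S)"
proof -
  interpret product_sigma_finite "\<lambda>_::nat. S \<Otimes>\<^sub>M Act" by (rule product_sigma_finite_SA)
  have one: "{..<1} = {0::nat}" by auto
  let ?g = "\<lambda>y. f (fst y) * ennreal (init_dens X (fst y)) * ennreal (policy X (\<phi> 0) (fst y) (snd y))"
  have "(\<integral>\<^sup>+ \<tau>. f (st \<tau> 0) * ennreal (mix_dens \<phi> 1 \<tau>) \<partial>trajs 1) = (\<integral>\<^sup>+ \<tau>. ?g (\<tau> 0) \<partial>trajs 1)"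
  proof (rule nn_integral_cong)
    fix \<tau> assume \<tau>: "\<tau> \<in> space (trajs 1)"
    have parts: "st \<tau> 0 \<in> space S" "act \<tau> 0 \<in> space Act" using space_trajs_parts[OF \<tau>] by auto
    show "f (st \<tau> 0) * ennreal (mix_dens \<phi> 1 \<tau>) = ?g (\<tau> 0)"
      using init_nonneg[OF parts(1)] policy_pos[OF parts, of "\<phi> 0"]
      by (simp add: mix_dens_def lessThan_Suc ennreal_mult less_imp_le mult_ac)
  qed
  also have "\<dots> = (\<integral>\<^sup>+ y. ?g y \<partial>(S \<Otimes>\<^sub>M Act))"
    unfolding one by (rule product_nn_integral_singleton) measurable
  also have "\<dots> = (\<integral>\<^sup>+ s. f s * ennreal (init_dens X s) \<partial>S)"
    by (rule nn_integral_policy) measurable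
  finally show ?thesis .
qed

text \<open>Causality: all steps after \<open>i\<close> integrate to one, so the law of the state at
  step \<open>i\<close> does not depend on the length of the trajectory.\<close>

lemma nn_integral_mix_dens_reduce:
  assumes f: "f \<in> borel_measurable S" and i: "i < n"
  shows "(\<integral>\<^sup>+ \<tau>. f (st \<tau> i) * ennreal (mix_dens \<phi> n \<tau>) \<partial>trajs n)
    = (\<integral>\<^sup>+ \<tau>. f (st \<tau> i) * ennreal (mix_dens \<phi> (Suc i) \<tau>) \<partial>trajs (Suc i))"
  using i
proof (induction n)
  case (Suc n)
  show ?case
  proof (cases "i = n")
    case False
    then obtain j where n: "n = Suc j" "i < n" using Suc.prems by (cases n) auto
    have "(\<integral>\<^sup>+ \<tau>. f (st \<tau> i) * ennreal (mix_dens \<phi> (Suc n) \<tau>) \<partial>trajs (Suc n))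
      = (\<integral>\<^sup>+ \<tau>. f (st \<tau> i) * ennreal (mix_dens \<phi> n \<tau>) \<partial>trajs n)"
      using nn_integral_mix_dens_Suc[OF f, of i j \<phi>] n by simp
    then show ?thesis using Suc.IH[OF n(2)] by simp
  qed simp
qed simp

text \<open>The state of step \<open>i\<close> is drawn before the action of that step, so only the
  policies of earlier steps enter its law. For \<open>i = 0\<close> only the initial density is
  left.\<close>

lemma nn_integral_mix_dens_indep:
  assumes f: "f \<in> borel_measurable S" and i: "i < n" and \<phi>: "\<And>t. t < i \<Longrightarrow> \<phi> t = \<phi>' t"
  shows "(\<integral>\<^sup>+ \<tau>. f (st \<tau> i) * ennreal (mix_dens \<phi> n \<tau>) \<partial>trajs n)
    = (\<integral>\<^sup>+ \<tau>. f (st \<tau> i) * ennreal (mix_dens \<phi>' n \<tau>) \<partial>trajs n)"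
proof (cases i)
  case 0
  then show ?thesis using nn_integral_mix_dens_reduce[OF f i] nn_integral_mix_dens_1[OF f] by simp
next
  case (Suc j)
  have "mix_dens \<phi> (Suc j) = mix_dens \<phi>' (Suc j)" using \<phi> Suc by (intro mix_dens_cong) auto
  then show ?thesis
    unfolding nn_integral_mix_dens_reduce[OF f i] unfolding Suc using nn_integral_mix_dens_Suc[OF f, of "Suc j" j] by simp
qed

lemma nn_integral_mix_dens:
  assumes "1 \<le> n" shows "(\<integral>\<^sup>+ \<tau>. ennreal (mix_dens \<phi> n \<tau>) \<partial>trajs n) = 1"
proof -
  have "(\<integral>\<^sup>+ \<tau>. 1 * ennreal (mix_dens \<phi> n \<tau>) \<partial>trajs n) = (\<integral>\<^sup>+ s. 1 * ennreal (init_dens X s) \<partial>S)"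
    using assms nn_integral_mix_dens_reduce[of "\<lambda>_. 1" 0 n \<phi>] nn_integral_mix_dens_1[of "\<lambda>_. 1" \<phi>] by simp
  then show ?thesis using model by (simp add: wf_model_def)
qed

lemma integrable_mix_dens:
  assumes "1 \<le> n" shows "integrable (trajs n) (mix_dens \<phi> n)" "(\<integral> \<tau>. mix_dens \<phi> n \<tau> \<partial>trajs n) = 1"
proof -
  have eq: "(\<integral>\<^sup>+ \<tau>. ennreal (mix_dens \<phi> n \<tau>) \<partial>trajs n) = ennreal 1" using nn_integral_mix_dens[OF assms] by simp
  have nn: "AE \<tau> in trajs n. 0 \<le> mix_dens \<phi> n \<tau>" using mix_dens_nonneg assms by (intro AE_I2) auto
  show "integrable (trajs n) (mix_dens \<phi> n)"
    by (rule integrableI_nn_integral_finite[OF measurable_mix_dens[OF assms] nn eq])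
  show "(\<integral> \<tau>. mix_dens \<phi> n \<tau> \<partial>trajs n) = 1"
    by (rule nn_integral_eq_integrable[THEN iffD1, OF measurable_mix_dens[OF assms] nn _ eq, THEN conjunct2]) simp
qed

lemma prob_space_traj_law: "prob_space (traj_law X \<theta>)"
proof (rule prob_spaceI)
  have "emeasure (traj_law X \<theta>) (space (traj_law X \<theta>)) = (\<integral>\<^sup>+ \<tau>. ennreal (mix_dens (\<lambda>_. \<theta>) H \<tau>) \<partial>trajs H)"
    unfolding traj_law_def traj_dens_eq_mix traj_space_eq
    using measurable_mix_dens[OF H_pos, of "\<lambda>_. \<theta>"] by (subst emeasure_density) (auto intro!: nn_integral_cong)
  then show "emeasure (traj_law X \<theta>) (space (traj_law X \<theta>)) = 1" using nn_integral_mix_dens[OF H_pos] by simp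
qed

lemma measurable_traj_dens [measurable]: "traj_dens X \<theta> \<in> borel_measurable T"
  unfolding traj_dens_eq_mix traj_space_eq by (rule measurable_mix_dens[OF H_pos])

lemma traj_dens_nonneg: "\<tau> \<in> space T \<Longrightarrow> 0 \<le> traj_dens X \<theta> \<tau>"
  unfolding traj_dens_eq_mix traj_space_eq by (rule mix_dens_nonneg[OF _ H_pos])

lemma space_traj_law [simp]: "space (traj_law X \<theta>) = space T"
  and sets_traj_law [simp, measurable_cong]: "sets (traj_law X \<theta>) = sets T"
  by (auto simp: traj_law_def)

lemma integral_traj_law:
  fixes f :: "('s, 'a) traj \<Rightarrow> 'v::{banach, second_countable_topology}"
  assumes "f \<in> borel_measurable T"
  shows "(\<integral> \<tau>. f \<tau> \<partial>traj_law X \<theta>) = (\<integral> \<tau>. traj_dens X \<theta> \<tau> *\<^sub>R f \<tau> \<partial>T)"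
    and "integrable (traj_law X \<theta>) f \<longleftrightarrow> integrable T (\<lambda>\<tau>. traj_dens X \<theta> \<tau> *\<^sub>R f \<tau>)"
  unfolding traj_law_def using assms traj_dens_nonneg
  by (auto intro!: integral_density AE_I2 simp: integrable_density)

section \<open>Changing the policy on a set of steps\<close>

definition pratio :: "real ^ 'q \<Rightarrow> real ^ 'q \<Rightarrow> 's \<times> 'a \<Rightarrow> real" where
  "pratio \<theta> \<theta>' y = policy X \<theta>' (fst y) (snd y) / policy X \<theta> (fst y) (snd y)"

definition replace_at :: "nat set \<Rightarrow> real ^ 'q \<Rightarrow> real ^ 'q \<Rightarrow> nat \<Rightarrow> real ^ 'q" where
  "replace_at A \<theta> \<psi> i = (if i \<in> A then \<psi> else \<theta>)"

lemma replace_at_all: "A = {..<n} \<Longrightarrow> mix_dens (replace_at A \<theta> \<psi>) n = mix_dens (\<lambda>_. \<psi>) n"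
  and replace_at_same: "mix_dens (replace_at A \<theta> \<theta>) n = mix_dens (\<lambda>_. \<theta>) n"
  by (auto intro!: mix_dens_cong simp: replace_at_def)

lemma measurable_pratio [measurable]: "pratio \<theta> \<theta>' \<in> borel_measurable (S \<Otimes>\<^sub>M Act)"
  unfolding pratio_def by measurable

lemma measurable_coord_T: "i < H \<Longrightarrow> (\<lambda>\<tau>. \<tau> i) \<in> measurable T (S \<Otimes>\<^sub>M Act)"
  unfolding traj_space_eq by (rule measurable_coord)

lemma space_T: "\<tau> \<in> space T \<Longrightarrow> i < H \<Longrightarrow> \<tau> i \<in> space (S \<Otimes>\<^sub>M Act)"
  unfolding traj_space_eq by (rule space_trajs)

text \<open>Positivity of the policies allows factors to be exchanged by multiplying with ratios.
  Since \<open>A\<close> is arbitrary, this one formula serves the full importance weight, its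
  partial products and derivatives in the policy of a single step.\<close>

lemma mix_dens_replace:
  assumes A: "A \<subseteq> {..<H}" and \<tau>: "\<tau> \<in> space T"
  shows "mix_dens (replace_at A \<theta> \<psi>') H \<tau> = mix_dens (replace_at A \<theta> \<psi>) H \<tau> * (\<Prod>i\<in>A. pratio \<psi> \<psi>' (\<tau> i))"
proof -
  have ne: "policy X \<theta> (st \<tau> i) (act \<tau> i) \<noteq> 0" if "i < H" for \<theta> i
    using policy_pos[OF y_parts[OF space_T[OF \<tau> that]], of \<theta>] by simp
  have "(\<Prod>i\<in>A. pratio \<psi> \<psi>' (\<tau> i)) = (\<Prod>i<H. if i \<in> A then pratio \<psi> \<psi>' (\<tau> i) else 1)"
    using A by (subst prod.inter_restrict[symmetric]) (auto simp: Int_absorb1)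
  moreover have "(\<Prod>t<H. policy X (replace_at A \<theta> \<psi>' t) (st \<tau> t) (act \<tau> t))
    = (\<Prod>t<H. policy X (replace_at A \<theta> \<psi> t) (st \<tau> t) (act \<tau> t) * (if t \<in> A then pratio \<psi> \<psi>' (\<tau> t) else 1))"
    using ne by (intro prod.cong) (auto simp: replace_at_def pratio_def)
  ultimately show ?thesis unfolding mix_dens_def by (simp add: prod.distrib mult_ac)
qed

lemma mix_dens_T:
  "mix_dens \<phi> H \<in> borel_measurable T" "\<tau> \<in> space T \<Longrightarrow> 0 \<le> mix_dens \<phi> H \<tau>"
  "integrable T (mix_dens \<phi> H)" "(\<integral> \<tau>. mix_dens \<phi> H \<tau> \<partial>T) = 1"
  unfolding traj_space_eq using measurable_mix_dens[OF H_pos] mix_dens_nonneg[OF _ H_pos] integrable_mix_dens[OF H_pos] by auto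

text \<open>Half of the constant is the error of the trapezoid rule, the other half comes from
  replacing the mean of the two scores by the first one.\<close>

lemma log_policy_linearization:
  assumes y: "y \<in> space (S \<Otimes>\<^sub>M Act)"
  shows "\<bar>ln (pratio \<psi> (\<psi> + h) y) - inner h (score \<psi> y)\<bar> \<le> M * (norm h)\<^sup>2"
proof -
  let ?a = "score \<psi> y" and ?b = "score (\<psi> + h) y"
  have "\<bar>ln (pratio \<psi> (\<psi> + h) y) - inner h (?a + ?b) / 2\<bar> \<le> norm h / 2 * sqrt ((M * norm h)\<^sup>2 - (norm (?a - ?b))\<^sup>2)"
    unfolding pratio_def ln_policy_ratio[OF y]
    by (rule GDERIV_trapezoid_error[OF GDERIV_log_policy[OF y] score_lipschitz[OF y]])
  also have "\<dots> \<le> norm h / 2 * sqrt ((M * norm h)\<^sup>2)" by (intro mult_left_mono real_sqrt_le_mono) auto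
  also have "\<dots> = M * (norm h)\<^sup>2 / 2" using M_pos by (simp add: power2_eq_square)
  finally have 1: "\<bar>ln (pratio \<psi> (\<psi> + h) y) - inner h (?a + ?b) / 2\<bar> \<le> M * (norm h)\<^sup>2 / 2" .
  have "\<bar>inner h (?b - ?a)\<bar> \<le> norm h * norm (?b - ?a)" by (rule Cauchy_Schwarz_ineq2)
  also have "\<dots> \<le> norm h * (M * norm h)" using score_lipschitz[OF y, of "\<psi> + h" \<psi>] by (intro mult_left_mono) auto
  finally have 2: "\<bar>inner h (?b - ?a)\<bar> \<le> M * (norm h)\<^sup>2" by (simp add: power2_eq_square mult_ac)
  have "inner h (?a + ?b) / 2 - inner h ?a = inner h (?b - ?a) / 2" by (simp add: inner_add_right inner_diff_right field_simps)
  with 1 2 show ?thesis by linarith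
qed

lemma abs_ln_pratio_le:
  assumes y: "y \<in> space (S \<Otimes>\<^sub>M Act)" shows "\<bar>ln (pratio \<theta> \<theta>' y)\<bar> \<le> G * norm (\<theta>' - \<theta>)"
  unfolding pratio_def ln_policy_ratio[OF y] by (rule log_policy_diff_le[OF y])

lemma pratio_pos: "y \<in> space (S \<Otimes>\<^sub>M Act) \<Longrightarrow> 0 < pratio \<theta> \<theta>' y"
  unfolding pratio_def using policy_pos[OF y_parts] by simp

text \<open>The second-order remainder is uniform in the trajectory because the score is Lipschitz, so the
  expectation can be differentiated under the integral.\<close>

lemma GDERIV_integral_mix_dens:
  assumes A: "A \<subseteq> {..<H}" and f [measurable]: "f \<in> borel_measurable T" and fb: "\<And>\<tau>. \<tau> \<in> space T \<Longrightarrow> \<bar>f \<tau>\<bar> \<le> Kf"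
  shows "GDERIV (\<lambda>\<psi>. \<integral> \<tau>. mix_dens (replace_at A \<theta> \<psi>) H \<tau> * f \<tau> \<partial>T) \<psi> :>
      (\<integral> \<tau>. (mix_dens (replace_at A \<theta> \<psi>) H \<tau> * f \<tau>) *\<^sub>R (\<Sum>i\<in>A. score \<psi> (\<tau> i)) \<partial>T)"
    and "integrable T (\<lambda>\<tau>. (mix_dens (replace_at A \<theta> \<psi>) H \<tau> * f \<tau>) *\<^sub>R (\<Sum>i\<in>A. score \<psi> (\<tau> i)))"
proof -
  let ?m = "\<lambda>\<psi>. mix_dens (replace_at A \<theta> \<psi>) H"
  note [measurable] = mix_dens_T(1)
  have [measurable]: "(\<lambda>\<tau>. \<Sum>i\<in>A. score \<psi> (\<tau> i)) \<in> borel_measurable T" for \<psi>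
    using A by (intro borel_measurable_sum measurable_compose[OF measurable_coord_T measurable_score]) auto
  obtain \<tau>0 where "\<tau>0 \<in> space T" using prob_space.not_empty[OF prob_space_traj_law] by (auto simp del: all_not_in_conv)
  then have Kf: "0 \<le> Kf" using fb[of \<tau>0] by linarith
  have fin: "finite A" using A finite_subset by blast
  have card: "card A \<le> H" using A card_mono[of "{..<H}" A] by simp
  have sc: "norm (\<Sum>i\<in>A. score \<psi> (\<tau> i)) \<le> real H * G" if "\<tau> \<in> space T" for \<tau> \<psi>
  proof -
    have "norm (\<Sum>i\<in>A. score \<psi> (\<tau> i)) \<le> real (card A) * G"
      using A that by (intro sum_norm_bound norm_score_le space_T) auto
    also have "\<dots> \<le> real H * G" using card G_pos by (intro mult_right_mono) auto
    finally show ?thesis .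
  qed
  have I1: "integrable T (\<lambda>\<tau>. ?m \<psi> \<tau> * f \<tau>)" for \<psi>
  proof (rule Bochner_Integration.integrable_bound)
    show "integrable T (\<lambda>\<tau>. Kf * ?m \<psi> \<tau>)" using mix_dens_T(3) by simp
    show "AE \<tau> in T. norm (?m \<psi> \<tau> * f \<tau>) \<le> norm (Kf * ?m \<psi> \<tau>)"
      using fb Kf mix_dens_T(2) by (intro AE_I2) (auto simp: abs_mult mult.commute[of Kf] intro!: mult_left_mono)
  qed measurable
  show I2: "integrable T (\<lambda>\<tau>. (?m \<psi> \<tau> * f \<tau>) *\<^sub>R (\<Sum>i\<in>A. score \<psi> (\<tau> i)))" for \<psi>
  proof (rule Bochner_Integration.integrable_bound)
    show "integrable T (\<lambda>\<tau>. (real H * G) * (?m \<psi> \<tau> * f \<tau>))" using I1 by simp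
    show "AE \<tau> in T. norm ((?m \<psi> \<tau> * f \<tau>) *\<^sub>R (\<Sum>i\<in>A. score \<psi> (\<tau> i))) \<le> norm ((real H * G) * (?m \<psi> \<tau> * f \<tau>))"
      using sc G_pos by (intro AE_I2) (auto simp: abs_mult mult.commute[of "real H * G"] intro!: mult_left_mono)
  qed measurable
  \<comment> \<open>\<open>real H * M\<close> stems from linearising the log-ratios,
    \<open>2 * (real H * G)^2\<close> from the second-order term of the exponential. The radius
    \<open>1 / (real H * G)\<close> keeps the argument of the exponential within
    \<open>[-1, 1]\<close>.\<close>
  define C where "C = real H * M + 2 * (real H * G)\<^sup>2"
  have C0: "0 \<le> C" using M_pos by (simp add: C_def)
  have rem: "\<bar>?m (\<psi> + h) \<tau> - ?m \<psi> \<tau> - ?m \<psi> \<tau> * inner h (\<Sum>i\<in>A. score \<psi> (\<tau> i))\<bar> \<le> ?m \<psi> \<tau> * (C * (norm h)\<^sup>2)"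
    if h: "norm h \<le> 1 / (real H * G)" and \<tau>: "\<tau> \<in> space T" for h \<psi> \<tau>
  proof -
    define l where "l = (\<Sum>i\<in>A. ln (pratio \<psi> (\<psi> + h) (\<tau> i)))"
    have yi: "\<tau> i \<in> space (S \<Otimes>\<^sub>M Act)" if "i \<in> A" for i using A that space_T[OF \<tau>] by auto
    have "(\<Prod>i\<in>A. pratio \<psi> (\<psi> + h) (\<tau> i)) = exp l"
      unfolding l_def exp_sum[OF fin] using pratio_pos[OF yi] by (intro prod.cong) auto
    then have m: "?m (\<psi> + h) \<tau> = ?m \<psi> \<tau> * exp l" using mix_dens_replace[OF A \<tau>, of \<theta> "\<psi> + h" \<psi>] by simp
    have "l - inner h (\<Sum>i\<in>A. score \<psi> (\<tau> i)) = (\<Sum>i\<in>A. ln (pratio \<psi> (\<psi> + h) (\<tau> i)) - inner h (score \<psi> (\<tau> i)))"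
      by (simp add: l_def inner_sum_right sum_subtractf)
    also have "\<bar>\<dots>\<bar> \<le> real (card A) * (M * (norm h)\<^sup>2)"
      unfolding real_norm_def[symmetric] using log_policy_linearization[OF yi] by (intro sum_norm_bound) auto
    also have "\<dots> \<le> real H * (M * (norm h)\<^sup>2)" using card M_pos by (intro mult_right_mono) auto
    finally have l1: "\<bar>l - inner h (\<Sum>i\<in>A. score \<psi> (\<tau> i))\<bar> \<le> real H * M * (norm h)\<^sup>2" by (simp add: mult.assoc)
    have "\<bar>l\<bar> \<le> real (card A) * (G * norm h)"
      unfolding l_def real_norm_def[symmetric] using abs_ln_pratio_le[OF yi, of _ \<psi> "\<psi> + h"]
      by (intro sum_norm_bound) auto
    also have "\<dots> \<le> real H * (G * norm h)" using card G_pos by (intro mult_right_mono) auto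
    finally have l2: "\<bar>l\<bar> \<le> real H * G * norm h" by (simp add: mult.assoc)
    also have "\<dots> \<le> 1" using h H_pos G_pos by (simp add: field_simps)
    finally have "\<bar>exp l - 1 - l\<bar> \<le> 2 * l\<^sup>2" by (rule abs_exp_minus_affine_le)
    also have "2 * l\<^sup>2 \<le> 2 * (real H * G * norm h)\<^sup>2"
      using l2 power_mono[OF l2, of 2] by simp
    finally have l3: "\<bar>exp l - 1 - l\<bar> \<le> 2 * (real H * G)\<^sup>2 * (norm h)\<^sup>2" by (simp add: power_mult_distrib)
    have "?m (\<psi> + h) \<tau> - ?m \<psi> \<tau> - ?m \<psi> \<tau> * inner h (\<Sum>i\<in>A. score \<psi> (\<tau> i))
      = ?m \<psi> \<tau> * (exp l - 1 - inner h (\<Sum>i\<in>A. score \<psi> (\<tau> i)))" unfolding m by (simp add: algebra_simps)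
    also have "\<bar>\<dots>\<bar> = ?m \<psi> \<tau> * \<bar>exp l - 1 - inner h (\<Sum>i\<in>A. score \<psi> (\<tau> i))\<bar>"
      using mix_dens_T(2)[OF \<tau>] by (simp add: abs_mult)
    also have "\<dots> \<le> ?m \<psi> \<tau> * (C * (norm h)\<^sup>2)"
    proof (rule mult_left_mono[OF _ mix_dens_T(2)[OF \<tau>]])
      show "\<bar>exp l - 1 - inner h (\<Sum>i\<in>A. score \<psi> (\<tau> i))\<bar> \<le> C * (norm h)\<^sup>2"
        unfolding C_def distrib_right using l1 l3 by linarith
    qed
    finally show ?thesis .
  qed
  show "GDERIV (\<lambda>\<psi>. \<integral> \<tau>. ?m \<psi> \<tau> * f \<tau> \<partial>T) \<psi> :> (\<integral> \<tau>. (?m \<psi> \<tau> * f \<tau>) *\<^sub>R (\<Sum>i\<in>A. score \<psi> (\<tau> i)) \<partial>T)"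
  proof (rule GDERIV_from_quadratic_remainder)
    show "0 \<le> Kf * C" using Kf C0 by simp
    show "0 < 1 / (real H * G)" using H_pos G_pos by simp
    fix h :: "real ^ 'q" assume h: "norm h \<le> 1 / (real H * G)"
    let ?c = "\<lambda>\<tau>. \<Sum>i\<in>A. score \<psi> (\<tau> i)"
    have Ih: "integrable T (\<lambda>\<tau>. inner h ((?m \<psi> \<tau> * f \<tau>) *\<^sub>R ?c \<tau>))" using I2 by (rule integrable_inner_right)
    have "(\<integral> \<tau>. ?m (\<psi> + h) \<tau> * f \<tau> \<partial>T) - (\<integral> \<tau>. ?m \<psi> \<tau> * f \<tau> \<partial>T) - inner h (\<integral> \<tau>. (?m \<psi> \<tau> * f \<tau>) *\<^sub>R ?c \<tau> \<partial>T)
      = (\<integral> \<tau>. ?m (\<psi> + h) \<tau> * f \<tau> - ?m \<psi> \<tau> * f \<tau> - inner h ((?m \<psi> \<tau> * f \<tau>) *\<^sub>R ?c \<tau>) \<partial>T)"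
      using I1 I2 Ih by (simp only: Bochner_Integration.integral_diff Bochner_Integration.integrable_diff integral_inner_right)
    also have "\<bar>\<dots>\<bar> \<le> (\<integral> \<tau>. Kf * C * (norm h)\<^sup>2 * ?m \<psi> \<tau> \<partial>T)"
      unfolding real_norm_def[symmetric]
    proof (rule order_trans[OF Bochner_Integration.integral_norm_bound integral_mono[OF integrable_norm]])
      show "integrable T (\<lambda>\<tau>. ?m (\<psi> + h) \<tau> * f \<tau> - ?m \<psi> \<tau> * f \<tau> - inner h ((?m \<psi> \<tau> * f \<tau>) *\<^sub>R ?c \<tau>))"
        using I1 Ih by (intro Bochner_Integration.integrable_diff)
      show "integrable T (\<lambda>\<tau>. Kf * C * (norm h)\<^sup>2 * ?m \<psi> \<tau>)" using mix_dens_T(3) by simp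
      fix \<tau> assume \<tau>: "\<tau> \<in> space T"
      have "?m (\<psi> + h) \<tau> * f \<tau> - ?m \<psi> \<tau> * f \<tau> - inner h ((?m \<psi> \<tau> * f \<tau>) *\<^sub>R ?c \<tau>)
        = (?m (\<psi> + h) \<tau> - ?m \<psi> \<tau> - ?m \<psi> \<tau> * inner h (?c \<tau>)) * f \<tau>" by (simp add: algebra_simps)
      also have "norm \<dots> = \<bar>?m (\<psi> + h) \<tau> - ?m \<psi> \<tau> - ?m \<psi> \<tau> * inner h (?c \<tau>)\<bar> * \<bar>f \<tau>\<bar>" by (simp add: abs_mult)
      also have "\<dots> \<le> (?m \<psi> \<tau> * (C * (norm h)\<^sup>2)) * Kf"
        using rem[OF h \<tau>] fb[OF \<tau>] C0 mix_dens_T(2)[OF \<tau>] by (intro mult_mono) auto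
      finally show "norm (?m (\<psi> + h) \<tau> * f \<tau> - ?m \<psi> \<tau> * f \<tau> - inner h ((?m \<psi> \<tau> * f \<tau>) *\<^sub>R ?c \<tau>)) \<le> Kf * C * (norm h)\<^sup>2 * ?m \<psi> \<tau>"
        by (simp add: mult_ac)
    qed
    also have "\<dots> = Kf * C * (norm h)\<^sup>2" using mix_dens_T(4) by simp
    finally show "\<bar>(\<integral> \<tau>. ?m (\<psi> + h) \<tau> * f \<tau> \<partial>T) - (\<integral> \<tau>. ?m \<psi> \<tau> * f \<tau> \<partial>T) - inner h (\<integral> \<tau>. (?m \<psi> \<tau> * f \<tau>) *\<^sub>R ?c \<tau> \<partial>T)\<bar>
      \<le> Kf * C * (norm h)\<^sup>2" .
  qed
qed

text \<open>Changing the policy at step \<open>i\<close> alone does not change the law of \<open>s\<^sub>i\<close>, so the derivative vanishes.\<close>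

lemma integral_score_state_zero:
  assumes i: "i < H" and f [measurable]: "f \<in> borel_measurable S" and fb: "\<And>s. s \<in> space S \<Longrightarrow> \<bar>f s\<bar> \<le> Kf"
  shows "integrable T (\<lambda>\<tau>. (traj_dens X \<theta> \<tau> * f (st \<tau> i)) *\<^sub>R score \<theta> (\<tau> i))"
    and "(\<integral> \<tau>. (traj_dens X \<theta> \<tau> * f (st \<tau> i)) *\<^sub>R score \<theta> (\<tau> i) \<partial>T) = 0"
proof -
  let ?m = "\<lambda>\<psi>. mix_dens (replace_at {i} \<theta> \<psi>) H"
  have st: "(\<lambda>\<tau>. st \<tau> i) \<in> measurable T S" unfolding traj_space_eq by (rule measurable_st[OF i])
  have fT [measurable]: "(\<lambda>\<tau>. f (st \<tau> i)) \<in> borel_measurable T" using st f by (rule measurable_compose)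
  have fbT: "\<bar>f (st \<tau> i)\<bar> \<le> Kf" if "\<tau> \<in> space T" for \<tau> using fb y_parts[OF space_T[OF that i]] by blast
  note [measurable] = mix_dens_T(1)
  have sub: "{i} \<subseteq> {..<H}" using i by simp
  have D: "GDERIV (\<lambda>\<psi>. \<integral> \<tau>. ?m \<psi> \<tau> * f (st \<tau> i) \<partial>T) \<theta> :> (\<integral> \<tau>. (?m \<theta> \<tau> * f (st \<tau> i)) *\<^sub>R (\<Sum>i\<in>{i}. score \<theta> (\<tau> i)) \<partial>T)"
    "integrable T (\<lambda>\<tau>. (?m \<theta> \<tau> * f (st \<tau> i)) *\<^sub>R (\<Sum>i\<in>{i}. score \<theta> (\<tau> i)))"
    by (rule GDERIV_integral_mix_dens[OF sub fT], erule fbT)+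
  have eq: "?m \<theta> = traj_dens X \<theta>" unfolding replace_at_same traj_dens_eq_mix ..
  show "integrable T (\<lambda>\<tau>. (traj_dens X \<theta> \<tau> * f (st \<tau> i)) *\<^sub>R score \<theta> (\<tau> i))" using D(2) by (simp add: eq)
  \<comment> \<open>Laws of states are compared through integrals of nonnegative functions; adding
    \<open>Kf\<close> makes \<open>f\<close> nonnegative.\<close>
  have nn: "(\<integral>\<^sup>+ \<tau>. ennreal (f (st \<tau> i) + Kf) * ennreal (?m \<psi> \<tau>) \<partial>T) = (\<integral>\<^sup>+ \<tau>. ennreal (f (st \<tau> i) + Kf) * ennreal (?m \<theta> \<tau>) \<partial>T)" for \<psi>
    unfolding traj_space_eq by (rule nn_integral_mix_dens_indep[OF _ i]) (auto simp: replace_at_def)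
  have int: "integrable T (\<lambda>\<tau>. ?m \<psi> \<tau> * f (st \<tau> i))" for \<psi>
  proof (rule Bochner_Integration.integrable_bound)
    show "integrable T (\<lambda>\<tau>. Kf * ?m \<psi> \<tau>)" using mix_dens_T(3) by simp
    show "AE \<tau> in T. norm (?m \<psi> \<tau> * f (st \<tau> i)) \<le> norm (Kf * ?m \<psi> \<tau>)"
      using fbT mix_dens_T(2) order_trans[OF abs_ge_zero fbT]
      by (intro AE_I2) (auto simp: abs_mult mult.commute[of Kf] intro!: mult_left_mono)
  qed measurable
  have val: "(\<integral> \<tau>. ?m \<psi> \<tau> * f (st \<tau> i) \<partial>T) + Kf = enn2real (\<integral>\<^sup>+ \<tau>. ennreal (f (st \<tau> i) + Kf) * ennreal (?m \<psi> \<tau>) \<partial>T)" for \<psi>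
  proof -
    have "(\<integral> \<tau>. ?m \<psi> \<tau> * f (st \<tau> i) \<partial>T) + Kf = (\<integral> \<tau>. ?m \<psi> \<tau> * f (st \<tau> i) + Kf * ?m \<psi> \<tau> \<partial>T)"
      using int mix_dens_T(3,4) by simp
    also have "(\<integral> \<tau>. ?m \<psi> \<tau> * f (st \<tau> i) + Kf * ?m \<psi> \<tau> \<partial>T) = enn2real (\<integral>\<^sup>+ \<tau>. ennreal (?m \<psi> \<tau> * f (st \<tau> i) + Kf * ?m \<psi> \<tau>) \<partial>T)"
    proof (rule integral_eq_nn_integral)
      show "AE \<tau> in T. 0 \<le> ?m \<psi> \<tau> * f (st \<tau> i) + Kf * ?m \<psi> \<tau>"
      proof (rule AE_I2)
        fix \<tau> assume \<tau>: "\<tau> \<in> space T"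
        have "0 \<le> (f (st \<tau> i) + Kf) * ?m \<psi> \<tau>" using fbT[OF \<tau>] mix_dens_T(2)[OF \<tau>] by (intro mult_nonneg_nonneg) linarith+
        then show "0 \<le> ?m \<psi> \<tau> * f (st \<tau> i) + Kf * ?m \<psi> \<tau>" by (simp add: algebra_simps)
      qed
    qed measurable
    also have "(\<integral>\<^sup>+ \<tau>. ennreal (?m \<psi> \<tau> * f (st \<tau> i) + Kf * ?m \<psi> \<tau>) \<partial>T) = (\<integral>\<^sup>+ \<tau>. ennreal (f (st \<tau> i) + Kf) * ennreal (?m \<psi> \<tau>) \<partial>T)"
    proof (rule nn_integral_cong)
      fix \<tau> assume \<tau>: "\<tau> \<in> space T"
      have "0 \<le> f (st \<tau> i) + Kf" using fbT[OF \<tau>] by linarith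
      then show "ennreal (?m \<psi> \<tau> * f (st \<tau> i) + Kf * ?m \<psi> \<tau>) = ennreal (f (st \<tau> i) + Kf) * ennreal (?m \<psi> \<tau>)"
        using mix_dens_T(2)[OF \<tau>] by (simp add: ennreal_mult'[symmetric] algebra_simps)
    qed
    finally show ?thesis .
  qed
  have const: "(\<integral> \<tau>. ?m \<psi> \<tau> * f (st \<tau> i) \<partial>T) = (\<integral> \<tau>. ?m \<theta> \<tau> * f (st \<tau> i) \<partial>T)" for \<psi>
    using val[of \<psi>] val[of \<theta>] nn[of \<psi>] by simp
  have "GDERIV (\<lambda>\<psi>. \<integral> \<tau>. ?m \<psi> \<tau> * f (st \<tau> i) \<partial>T) \<theta> :> 0"
  proof -
    have "(\<lambda>\<psi>. \<integral> \<tau>. ?m \<psi> \<tau> * f (st \<tau> i) \<partial>T) = (\<lambda>_. \<integral> \<tau>. ?m \<theta> \<tau> * f (st \<tau> i) \<partial>T)"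
      by (rule ext) (rule const)
    then show ?thesis by (simp only: GDERIV_const)
  qed
  from trans[OF grad_eqI[OF D(1), symmetric] grad_eqI[OF this]] show "(\<integral> \<tau>. (traj_dens X \<theta> \<tau> * f (st \<tau> i)) *\<^sub>R score \<theta> (\<tau> i) \<partial>T) = 0"
    by (simp add: eq)
qed

section \<open>Bounds and unbiasedness of the gradient estimator\<close>

definition K :: real where "K = (R + b) / (1 - discount X)"

text \<open>The initial density has total mass one, so there is a state at which \<open>b\<close>
  bounds an absolute value.\<close>

lemma b_nonneg: "0 \<le> b"
proof -
  have "(\<integral>\<^sup>+ s. ennreal (init_dens X s) \<partial>S) = 1" using model by (simp add: wf_model_def)
  then have "space S \<noteq> {}" using nn_integral_empty by fastforce
  then obtain s where "s \<in> space S" by blast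
  then show ?thesis using baseline_bound[of s 0] by linarith
qed

lemma total_reward_bound:
  assumes \<tau>: "\<tau> \<in> space T" shows "\<bar>total_reward X \<tau>\<bar> \<le> R / (1 - discount X)"
proof -
  let ?g = "discount X"
  have "\<bar>total_reward X \<tau>\<bar> \<le> (\<Sum>t<H. \<bar>?g ^ t * reward X (st \<tau> t) (act \<tau> t)\<bar>)"
    unfolding total_reward_def by (rule sum_abs)
  also have "\<dots> \<le> (\<Sum>t<H. ?g ^ t * R)"
    using discount_bounds y_parts[OF space_T[OF \<tau>]] by (intro sum_mono) (auto simp: abs_mult intro!: mult_left_mono reward_bound)
  also have "\<dots> = R * (\<Sum>t<H. ?g ^ t)" by (simp add: sum_distrib_left mult.commute)
  also have "\<dots> = R * ((1 - ?g ^ H) / (1 - ?g))" using discount_bounds by (simp add: sum_gp_strict)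
  also have "\<dots> \<le> R * (1 / (1 - ?g))"
    using R_pos discount_bounds by (intro mult_left_mono divide_right_mono) auto
  finally show ?thesis by simp
qed

text \<open>The geometric series bounds the total reward by \<open>R / (1 - discount X)\<close>. The
  bound \<open>b\<close> on the baseline is enlarged by the same denominator, which is the form of
  the numerator \<open>R + b\<close> in the constants.\<close>

lemma advantage_bound:
  assumes \<tau>: "\<tau> \<in> space T" and t: "t < H" shows "\<bar>total_reward X \<tau> - baseline X k (st \<tau> t)\<bar> \<le> K"
proof -
  have "b * (1 - discount X) \<le> b * 1" using b_nonneg discount_bounds by (intro mult_left_mono) auto
  then have "b \<le> b / (1 - discount X)" using discount_bounds by (simp add: field_simps)
  then show ?thesis unfolding K_def add_divide_distrib
    using total_reward_bound[OF \<tau>] baseline_bound[OF y_parts(1)[OF space_T[OF \<tau> t]], of k] by linarith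
qed

lemma K_pos: "0 < K" using R_pos b_nonneg discount_bounds by (simp add: K_def)

lemma C_g_eq: "C_g H (discount X) G R b = real H * G * K"
  and L_g_eq: "L_g H (discount X) M R b = real H * M * K"
  by (simp_all add: C_g_def L_g_def K_def)

lemma reinforce_eq: "reinforce X \<tau> \<theta> = (\<Sum>t<H. (total_reward X \<tau> - baseline X t (st \<tau> t)) *\<^sub>R score \<theta> (\<tau> t))"
  by (simp add: reinforce_def score_def)

lemma norm_reinforce_le:
  assumes \<tau>: "\<tau> \<in> space T" shows "norm (reinforce X \<tau> \<theta>) \<le> C_g H (discount X) G R b"
proof -
  have "norm (reinforce X \<tau> \<theta>) \<le> real (card {..<H}) * (K * G)"
    unfolding reinforce_eq using advantage_bound[OF \<tau>] norm_score_le[OF space_T[OF \<tau>]] K_pos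
    by (intro sum_norm_bound) (auto intro!: mult_mono)
  then show ?thesis by (simp add: C_g_eq mult_ac)
qed

lemma reinforce_lipschitz:
  assumes \<tau>: "\<tau> \<in> space T"
  shows "norm (reinforce X \<tau> \<theta> - reinforce X \<tau> \<theta>') \<le> L_g H (discount X) M R b * norm (\<theta> - \<theta>')"
proof -
  have "reinforce X \<tau> \<theta> - reinforce X \<tau> \<theta>' = (\<Sum>t<H. (total_reward X \<tau> - baseline X t (st \<tau> t)) *\<^sub>R (score \<theta> (\<tau> t) - score \<theta>' (\<tau> t)))"
    by (simp add: reinforce_eq sum_subtractf scaleR_diff_right)
  also have "norm \<dots> \<le> real (card {..<H}) * (K * (M * norm (\<theta> - \<theta>')))"
    using advantage_bound[OF \<tau>] score_lipschitz[OF space_T[OF \<tau>]] K_pos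
    by (intro sum_norm_bound) (auto intro!: mult_mono)
  finally show ?thesis by (simp add: L_g_eq mult_ac)
qed

lemma measurable_total_reward [measurable]: "total_reward X \<in> borel_measurable T"
  unfolding total_reward_def
  by (intro borel_measurable_sum borel_measurable_times borel_measurable_const
      measurable_compose[OF measurable_coord_T measurable_reward]) auto

lemma measurable_st_T: "t < H \<Longrightarrow> (\<lambda>\<tau>. st \<tau> t) \<in> measurable T S"
  unfolding traj_space_eq by (rule measurable_st)

lemma measurable_reinforce [measurable]: "(\<lambda>\<tau>. reinforce X \<tau> \<theta>) \<in> borel_measurable T"
  unfolding reinforce_eq
  by (intro borel_measurable_sum borel_measurable_scaleR borel_measurable_diff measurable_total_reward
      measurable_compose[OF measurable_coord_T measurable_score] measurable_compose[OF measurable_st_T measurable_baseline]) auto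

text \<open>Differentiating under the integral yields the total reward times the sum of the scores.
  The baseline terms may be subtracted because each depends on the state of its own step only, where
  the score has mean zero.\<close>

lemma grad_objective: "grad (objective X) \<theta> = (\<integral> \<tau>. reinforce X \<tau> \<theta> \<partial>traj_law X \<theta>)"
proof -
  have all: "mix_dens (replace_at {..<H} \<theta> \<psi>) H = traj_dens X \<psi>" for \<psi>
    unfolding replace_at_all[OF refl] traj_dens_eq_mix ..
  have obj: "objective X \<psi> = (\<integral> \<tau>. traj_dens X \<psi> \<tau> * total_reward X \<tau> \<partial>T)" for \<psi>
    unfolding objective_def by (subst integral_traj_law) auto
  note D = GDERIV_integral_mix_dens[OF subset_refl measurable_total_reward total_reward_bound, of \<theta> \<theta>, unfolded all]
  have "grad (objective X) \<theta> = (\<integral> \<tau>. (traj_dens X \<theta> \<tau> * total_reward X \<tau>) *\<^sub>R (\<Sum>i<H. score \<theta> (\<tau> i)) \<partial>T)"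
    using D(1) unfolding obj[symmetric] by (rule grad_eqI)
  also have "\<dots> = (\<integral> \<tau>. (traj_dens X \<theta> \<tau> * total_reward X \<tau>) *\<^sub>R (\<Sum>i<H. score \<theta> (\<tau> i)) \<partial>T)
     - (\<Sum>i<H. \<integral> \<tau>. (traj_dens X \<theta> \<tau> * baseline X i (st \<tau> i)) *\<^sub>R score \<theta> (\<tau> i) \<partial>T)"
    using integral_score_state_zero(2)[OF _ measurable_baseline baseline_bound] by simp
  also have "\<dots> = (\<integral> \<tau>. (traj_dens X \<theta> \<tau> * total_reward X \<tau>) *\<^sub>R (\<Sum>i<H. score \<theta> (\<tau> i))
     - (\<Sum>i<H. (traj_dens X \<theta> \<tau> * baseline X i (st \<tau> i)) *\<^sub>R score \<theta> (\<tau> i)) \<partial>T)"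
    using D(2) integral_score_state_zero(1)[OF _ measurable_baseline baseline_bound]
    by (subst Bochner_Integration.integral_diff) (auto simp: Bochner_Integration.integral_sum)
  also have "\<dots> = (\<integral> \<tau>. traj_dens X \<theta> \<tau> *\<^sub>R reinforce X \<tau> \<theta> \<partial>T)"
    by (simp add: reinforce_eq scaleR_sum_right sum_subtractf[symmetric] algebra_simps)
  also have "\<dots> = (\<integral> \<tau>. reinforce X \<tau> \<theta> \<partial>traj_law X \<theta>)" by (rule integral_traj_law(1)[symmetric]) measurable
  finally show ?thesis .
qed

subsection \<open>Moments of the importance weight\<close>

text \<open>Initial and transition densities cancel in the importance weight; the remaining product
  of policy ratios is positive on all trajectories. It can differ from \<open>imp_weight\<close>
  only where the trajectory density at \<open>\<theta>\<close> vanishes and the quotient takes the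
  default value 0.\<close>

definition weight :: "real ^ 'q \<Rightarrow> real ^ 'q \<Rightarrow> ('s, 'a) traj \<Rightarrow> real" where
  "weight \<theta> \<theta>' \<tau> = (\<Prod>i<H. pratio \<theta> \<theta>' (\<tau> i))"

lemma measurable_weight [measurable]: "weight \<theta> \<theta>' \<in> borel_measurable T"
  unfolding weight_def
  by (intro borel_measurable_prod measurable_compose[OF measurable_coord_T measurable_pratio]) auto

lemma traj_dens_weight: "\<tau> \<in> space T \<Longrightarrow> traj_dens X \<theta>' \<tau> = traj_dens X \<theta> \<tau> * weight \<theta> \<theta>' \<tau>"
  using mix_dens_replace[OF subset_refl, of \<tau> \<theta> \<theta>' \<theta>]
  by (simp add: weight_def traj_dens_eq_mix replace_at_all[OF refl])

lemma imp_weight_eq: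
  "\<tau> \<in> space T \<Longrightarrow> traj_dens X \<theta> \<tau> \<noteq> 0 \<Longrightarrow> imp_weight X \<tau> \<theta> \<theta>' = weight \<theta> \<theta>' \<tau>"
  by (simp add: imp_weight_def traj_dens_weight[of _ \<theta>' \<theta>])

lemma AE_imp_weight_eq: "AE \<tau> in traj_law X \<theta>. imp_weight X \<tau> \<theta> \<theta>' = weight \<theta> \<theta>' \<tau>"
  unfolding traj_law_def by (subst AE_density) (auto intro!: AE_I2 imp_weight_eq)

lemma weight_eq_exp:
  assumes \<tau>: "\<tau> \<in> space T"
  shows "weight \<theta> \<theta>' \<tau> = exp (\<Sum>i<H. ln (pratio \<theta> \<theta>' (\<tau> i)))"
  unfolding weight_def exp_sum[OF finite_lessThan] using pratio_pos[OF space_T[OF \<tau>]] by (intro prod.cong) auto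

lemma weight_bounds:
  assumes \<tau>: "\<tau> \<in> space T"
  shows "exp (- (real H * G * norm (\<theta> - \<theta>'))) \<le> weight \<theta> \<theta>' \<tau>" "weight \<theta> \<theta>' \<tau> \<le> exp (real H * G * norm (\<theta> - \<theta>'))"
proof -
  have "norm (\<Sum>i<H. ln (pratio \<theta> \<theta>' (\<tau> i))) \<le> real (card {..<H}) * (G * norm (\<theta> - \<theta>'))"
    using abs_ln_pratio_le[OF space_T[OF \<tau>], of _ \<theta> \<theta>'] by (intro sum_norm_bound) (auto simp: norm_minus_commute)
  then have "\<bar>\<Sum>i<H. ln (pratio \<theta> \<theta>' (\<tau> i))\<bar> \<le> real H * G * norm (\<theta> - \<theta>')" by (simp add: mult.assoc)
  then show "exp (- (real H * G * norm (\<theta> - \<theta>'))) \<le> weight \<theta> \<theta>' \<tau>" "weight \<theta> \<theta>' \<tau> \<le> exp (real H * G * norm (\<theta> - \<theta>'))"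
    unfolding weight_eq_exp[OF \<tau>] by (auto simp: abs_le_iff)
qed

lemma weight_same:
  assumes \<tau>: "\<tau> \<in> space T" shows "weight \<theta> \<theta> \<tau> = 1"
  unfolding weight_def
proof (rule prod.neutral, rule ballI)
  fix i assume "i \<in> {..<H}"
  then show "pratio \<theta> \<theta> (\<tau> i) = 1"
    using policy_pos[OF y_parts[OF space_T[OF \<tau>, of i]], of \<theta>] by (simp add: pratio_def)
qed

text \<open>The reweighted density is that of a trajectory which follows \<open>\<theta>'\<close> at
  the steps of \<open>A\<close> and \<open>\<theta>\<close> elsewhere, so it has mass one. This is
  the hypothesis \<open>moments\<close> of the abstract weights.\<close>

lemma expectation_prod_pratio:
  assumes A: "A \<subseteq> {..<H}" shows "(\<integral> \<tau>. (\<Prod>i\<in>A. pratio \<theta> \<theta>' (\<tau> i)) \<partial>traj_law X \<theta>) = 1"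
proof -
  have "(\<lambda>\<tau>. \<Prod>i\<in>A. pratio \<theta> \<theta>' (\<tau> i)) \<in> borel_measurable T"
    using A by (intro borel_measurable_prod measurable_compose[OF measurable_coord_T measurable_pratio]) auto
  then have "(\<integral> \<tau>. (\<Prod>i\<in>A. pratio \<theta> \<theta>' (\<tau> i)) \<partial>traj_law X \<theta>)
    = (\<integral> \<tau>. traj_dens X \<theta> \<tau> * (\<Prod>i\<in>A. pratio \<theta> \<theta>' (\<tau> i)) \<partial>T)"
    by (subst integral_traj_law) auto
  also have "\<dots> = (\<integral> \<tau>. mix_dens (replace_at A \<theta> \<theta>') H \<tau> \<partial>T)"
  proof (rule Bochner_Integration.integral_cong[OF refl])
    fix \<tau> assume "\<tau> \<in> space T"
    then show "traj_dens X \<theta> \<tau> * (\<Prod>i\<in>A. pratio \<theta> \<theta>' (\<tau> i)) = mix_dens (replace_at A \<theta> \<theta>') H \<tau>"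
      using mix_dens_replace[OF A, of \<tau> \<theta> \<theta>' \<theta>] by (simp add: replace_at_same traj_dens_eq_mix)
  qed
  finally show ?thesis using mix_dens_T(4) by simp
qed

lemma expectation_weight: "(\<integral> \<tau>. weight \<theta> \<theta>' \<tau> \<partial>traj_law X \<theta>) = 1"
  unfolding weight_def by (rule expectation_prod_pratio) simp

lemma integral_weight_scaleR:
  fixes f :: "('s, 'a) traj \<Rightarrow> 'v::{banach, second_countable_topology}"
  assumes [measurable]: "f \<in> borel_measurable T"
  shows "(\<integral> \<tau>. weight \<theta> \<theta>' \<tau> *\<^sub>R f \<tau> \<partial>traj_law X \<theta>) = (\<integral> \<tau>. f \<tau> \<partial>traj_law X \<theta>')"
proof -
  have "(\<integral> \<tau>. weight \<theta> \<theta>' \<tau> *\<^sub>R f \<tau> \<partial>traj_law X \<theta>) = (\<integral> \<tau>. traj_dens X \<theta> \<tau> *\<^sub>R (weight \<theta> \<theta>' \<tau> *\<^sub>R f \<tau>) \<partial>T)"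
    by (subst integral_traj_law) auto
  also have "\<dots> = (\<integral> \<tau>. traj_dens X \<theta>' \<tau> *\<^sub>R f \<tau> \<partial>T)"
    by (intro Bochner_Integration.integral_cong) (auto simp: traj_dens_weight[of _ \<theta>' \<theta>])
  finally show ?thesis by (subst (2) integral_traj_law) auto
qed

lemma expectation_abs_one_minus_weight:
  assumes H2: "2 \<le> H"
  shows "(\<integral> \<tau>. \<bar>1 - weight \<theta> \<theta>' \<tau>\<bar> \<partial>traj_law X \<theta>) \<le> real H * G * norm (\<theta> - \<theta>') / 2"
proof (cases "\<theta> = \<theta>'")
  case True
  \<comment> \<open>Equal parameters would give \<open>z = 1\<close>, which the abstract setting
    excludes.\<close>
  have "(\<integral> \<tau>. \<bar>1 - weight \<theta>' \<theta>' \<tau>\<bar> \<partial>traj_law X \<theta>') = (\<integral> \<tau>. 0 \<partial>traj_law X \<theta>')"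
    by (intro Bochner_Integration.integral_cong) (auto simp: weight_same)
  then show ?thesis using True by simp
next
  case False
  let ?z = "exp (G * norm (\<theta> - \<theta>'))"
  interpret P: prob_space "traj_law X \<theta>" by (rule prob_space_traj_law)
  interpret unit_moment_weights "traj_law X \<theta>" "\<lambda>i \<tau>. pratio \<theta> \<theta>' (\<tau> i)" H ?z
  proof
    show "(\<lambda>\<tau>. pratio \<theta> \<theta>' (\<tau> i)) \<in> borel_measurable (traj_law X \<theta>)" if "i < H" for i
      using measurable_compose[OF measurable_coord_T[OF that] measurable_pratio] by simp
    show "1 < ?z" using False G_pos by simp
    show "1 / ?z \<le> pratio \<theta> \<theta>' (\<tau> i)" "pratio \<theta> \<theta>' (\<tau> i) \<le> ?z" if "i < H" "\<tau> \<in> space (traj_law X \<theta>)" for i \<tau>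
      using policy_ratio_bounds[OF space_T[OF _ that(1)], of \<tau> \<theta>' \<theta>] that(2)
      by (auto simp: pratio_def exp_minus inverse_eq_divide norm_minus_commute[of \<theta> \<theta>'])
    show "P.expectation (\<lambda>\<tau>. \<Prod>i\<in>A. pratio \<theta> \<theta>' (\<tau> i)) = 1" if "A \<subseteq> {..<H}" for A
      by (rule expectation_prod_pratio[OF that])
  qed
  show ?thesis using expectation_abs_one_minus_prod_le[OF H2 order_refl] by (simp add: weight_def)
qed

lemma C_\<omega>_pos: "0 < W \<Longrightarrow> 0 < C_\<omega> H G M W"
  using H_pos G_pos M_pos unfolding C_\<omega>_def by (intro mult_pos_pos add_nonneg_pos) auto

lemma C_bar_pos:
  assumes "0 < W" shows "0 < C_bar H (discount X) R G M W b"
proof -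
  have "0 < L_g H (discount X) M R b" unfolding L_g_eq using H_pos M_pos K_pos by simp
  then show ?thesis unfolding C_bar_def using C_\<omega>_pos[OF assms]
    by (intro add_nonneg_pos mult_nonneg_nonneg) auto
qed

text \<open>With a single step the estimator is the score times a scalar that does not involve the
  parameter, so everything reduces to the scores normalised by \<open>G\<close>. Their means vanish
  under the respective policies, as the case of a constant function of the state shows.\<close>

lemma second_moment_horizon_one:
  assumes H1: "H = 1" and ne: "\<theta> \<noteq> \<theta>'" and W: "(\<integral> \<tau>. (weight \<theta> \<theta>' \<tau>)\<^sup>2 \<partial>traj_law X \<theta>) \<le> 1 + W"
  shows "(\<integral> \<tau>. (norm (reinforce X \<tau> \<theta> - weight \<theta> \<theta>' \<tau> *\<^sub>R reinforce X \<tau> \<theta>'))\<^sup>2 \<partial>traj_law X \<theta>)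
    \<le> C_bar H (discount X) R G M W b * (norm (\<theta> - \<theta>'))\<^sup>2"
proof -
  interpret P: prob_space "traj_law X \<theta>" by (rule prob_space_traj_law)
  let ?d = "norm (\<theta>' - \<theta>)"
  have d: "0 < ?d" using ne by simp
  \<comment> \<open>\<open>k\<close> bounds the log-ratio, \<open>x\<close> the change of the
    normalised score, and \<open>e\<close> is the unit vector in the direction of the parameter
    step.\<close>
  define k where "k = G * ?d"
  define x where "x = M * ?d / G"
  define e where "e = (\<theta>' - \<theta>) /\<^sub>R ?d"
  define a where "a \<tau> = score \<theta> (\<tau> 0) /\<^sub>R G" for \<tau> :: "('s, 'a) traj"
  define a' where "a' \<tau> = score \<theta>' (\<tau> 0) /\<^sub>R G" for \<tau> :: "('s, 'a) traj"
  have y: "\<tau> 0 \<in> space (S \<Otimes>\<^sub>M Act)" if "\<tau> \<in> space T" for \<tau> using space_T[OF that] H1 by simp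
  have sc_meas: "(\<lambda>\<tau>. score \<theta> (\<tau> 0)) \<in> borel_measurable T" for \<theta>
    using H1 by (intro measurable_compose[OF measurable_coord_T measurable_score]) simp
  have [measurable]: "a \<in> borel_measurable T" "a' \<in> borel_measurable T"
    unfolding a_def a'_def using sc_meas by (intro borel_measurable_scaleR borel_measurable_const; simp)+
  have zero: "(\<integral> \<tau>. score \<theta> (\<tau> 0) \<partial>traj_law X \<theta>) = 0" for \<theta>
    using integral_score_state_zero(2)[of 0 "\<lambda>_. 1" 1 \<theta>] H1 by (subst integral_traj_law[OF sc_meas]) simp
  have w: "weight \<theta> \<theta>' \<tau> = pratio \<theta> \<theta>' (\<tau> 0)" for \<tau> by (simp add: weight_def H1 lessThan_Suc)
  have h4: "0 \<le> k" using G_pos by (simp add: k_def)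
  have h5: "exp (- k) \<le> weight \<theta> \<theta>' \<tau>" "weight \<theta> \<theta>' \<tau> \<le> exp k" if "\<tau> \<in> space (traj_law X \<theta>)" for \<tau>
    using weight_bounds[of \<tau> \<theta> \<theta>'] that H1 by (simp_all add: k_def norm_minus_commute)
  have h9: "norm (a \<tau>) \<le> 1" "norm (a' \<tau>) \<le> 1" if "\<tau> \<in> space (traj_law X \<theta>)" for \<tau>
    using norm_score_le[OF y, of \<tau>] that G_pos by (simp_all add: a_def a'_def field_simps)
  have h11: "norm (a \<tau> - a' \<tau>) \<le> x" if "\<tau> \<in> space (traj_law X \<theta>)" for \<tau>
  proof -
    have "norm (score \<theta> (\<tau> 0) - score \<theta>' (\<tau> 0)) \<le> M * ?d"
      using score_lipschitz[OF y, of \<tau> \<theta> \<theta>'] that by (simp add: norm_minus_commute[of \<theta>' \<theta>])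
    moreover have "a \<tau> - a' \<tau> = (score \<theta> (\<tau> 0) - score \<theta>' (\<tau> 0)) /\<^sub>R G" by (simp add: a_def a'_def scaleR_diff_right)
    then have "norm (a \<tau> - a' \<tau>) = norm (score \<theta> (\<tau> 0) - score \<theta>' (\<tau> 0)) / G"
      using G_pos by (simp add: divide_inverse mult.commute)
    ultimately show ?thesis using G_pos by (simp add: x_def divide_right_mono)
  qed
  have h12: "norm e = 1" using d by (simp add: e_def)
  have h13: "(\<integral> \<tau>. a \<tau> \<partial>traj_law X \<theta>) = 0" unfolding a_def using zero by simp
  have h14: "(\<integral> \<tau>. weight \<theta> \<theta>' \<tau> *\<^sub>R a' \<tau> \<partial>traj_law X \<theta>) = 0"
  proof -
    have "(\<integral> \<tau>. a' \<tau> \<partial>traj_law X \<theta>') = 0" unfolding a'_def using zero by simp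
    then show ?thesis by (subst integral_weight_scaleR) auto
  qed
  have h15: "\<bar>ln (weight \<theta> \<theta>' \<tau>) - k * inner e ((a \<tau> + a' \<tau>) /\<^sub>R 2)\<bar> \<le> k / 2 * sqrt (x\<^sup>2 - (norm (a \<tau> - a' \<tau>))\<^sup>2)"
    if "\<tau> \<in> space (traj_law X \<theta>)" for \<tau>
  proof -
    have \<tau>: "\<tau> \<in> space T" using that by simp
    let ?s = "score \<theta> (\<tau> 0)" and ?s' = "score \<theta>' (\<tau> 0)"
    have "\<bar>ln (weight \<theta> \<theta>' \<tau>) - inner (\<theta>' - \<theta>) (?s + ?s') / 2\<bar> \<le> ?d / 2 * sqrt ((M * ?d)\<^sup>2 - (norm (?s - ?s'))\<^sup>2)"
      unfolding w pratio_def ln_policy_ratio[OF y[OF \<tau>]]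
      using GDERIV_trapezoid_error[OF GDERIV_log_policy[OF y[OF \<tau>]] score_lipschitz[OF y[OF \<tau>]], of \<theta> "\<theta>' - \<theta>"] by simp
    moreover have "k * inner e ((a \<tau> + a' \<tau>) /\<^sub>R 2) = inner (\<theta>' - \<theta>) (?s + ?s') / 2"
    proof -
      have "a \<tau> + a' \<tau> = (?s + ?s') /\<^sub>R G" by (simp add: a_def a'_def scaleR_add_right)
      then have "k * inner e ((a \<tau> + a' \<tau>) /\<^sub>R 2) = (G * ?d) * (inverse 2 * (inverse G * (inverse ?d * inner (\<theta>' - \<theta>) (?s + ?s'))))"
        by (simp only: k_def e_def inner_scaleR_left inner_scaleR_right)
      also have "\<dots> = inner (\<theta>' - \<theta>) (?s + ?s') / 2"
      proof -
        have "(g * n) * (inverse 2 * (inverse g * (inverse n * v))) = v / 2" if "0 < g" "0 < n" for g n v :: real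
          using that by (simp add: field_simps)
        then show ?thesis using G_pos d by blast
      qed
      finally show ?thesis .
    qed
    moreover have "k / 2 * sqrt (x\<^sup>2 - (norm (a \<tau> - a' \<tau>))\<^sup>2) = ?d / 2 * sqrt ((M * ?d)\<^sup>2 - (norm (?s - ?s'))\<^sup>2)"
    proof -
      have "a \<tau> - a' \<tau> = (?s - ?s') /\<^sub>R G" by (simp add: a_def a'_def scaleR_diff_right)
      then have "norm (a \<tau> - a' \<tau>) = norm (?s - ?s') / G" using G_pos by (simp add: divide_inverse mult.commute)
      then have "x\<^sup>2 - (norm (a \<tau> - a' \<tau>))\<^sup>2 = ((M * ?d)\<^sup>2 - (norm (?s - ?s'))\<^sup>2) / G\<^sup>2"
        by (simp add: x_def power_divide diff_divide_distrib)
      then show ?thesis using G_pos by (simp add: k_def real_sqrt_divide)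
    qed
    ultimately show ?thesis by simp
  qed
  have meas: "weight \<theta> \<theta>' \<in> borel_measurable (traj_law X \<theta>)" "a \<in> borel_measurable (traj_law X \<theta>)" "a' \<in> borel_measurable (traj_law X \<theta>)"
    by measurable
  note single = P.expectation_norm_square_single_step_le[OF meas h4 h5 expectation_weight W h9 h11 h12 h13 h14 h15]
  have le: "(\<integral> \<tau>. (norm (a \<tau> - weight \<theta> \<theta>' \<tau> *\<^sub>R a' \<tau>))\<^sup>2 \<partial>traj_law X \<theta>) \<le> x\<^sup>2 + (x * k + 2 * k\<^sup>2) * (1 + W)"
    and Ia: "integrable (traj_law X \<theta>) (\<lambda>\<tau>. (norm (a \<tau> - weight \<theta> \<theta>' \<tau> *\<^sub>R a' \<tau>))\<^sup>2)"
    using single by auto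
  have bound: "(norm (reinforce X \<tau> \<theta> - weight \<theta> \<theta>' \<tau> *\<^sub>R reinforce X \<tau> \<theta>'))\<^sup>2 \<le> (K * G)\<^sup>2 * (norm (a \<tau> - weight \<theta> \<theta>' \<tau> *\<^sub>R a' \<tau>))\<^sup>2"
    if \<tau>: "\<tau> \<in> space T" for \<tau>
  proof -
    \<comment> \<open>The scalar is bounded pointwise and removed before integrating: the scores are
      centred, whereas their products with it need not be.\<close>
    let ?\<kappa> = "total_reward X \<tau> - baseline X 0 (st \<tau> 0)"
    have "reinforce X \<tau> \<theta> - weight \<theta> \<theta>' \<tau> *\<^sub>R reinforce X \<tau> \<theta>' = (?\<kappa> * G) *\<^sub>R (a \<tau> - weight \<theta> \<theta>' \<tau> *\<^sub>R a' \<tau>)"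
    proof -
      have "reinforce X \<tau> \<theta> = (?\<kappa> * G) *\<^sub>R a \<tau>" "reinforce X \<tau> \<theta>' = (?\<kappa> * G) *\<^sub>R a' \<tau>"
        using G_pos by (simp_all add: reinforce_eq H1 lessThan_Suc a_def a'_def)
      then show ?thesis by (simp add: scaleR_diff_right mult.commute)
    qed
    then have "norm (reinforce X \<tau> \<theta> - weight \<theta> \<theta>' \<tau> *\<^sub>R reinforce X \<tau> \<theta>') = (\<bar>?\<kappa>\<bar> * G) * norm (a \<tau> - weight \<theta> \<theta>' \<tau> *\<^sub>R a' \<tau>)"
      using G_pos by (simp add: abs_mult)
    also have "\<dots> \<le> (K * G) * norm (a \<tau> - weight \<theta> \<theta>' \<tau> *\<^sub>R a' \<tau>)"
      using advantage_bound[OF \<tau>, of 0 0] H1 G_pos by (intro mult_right_mono) auto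
    finally show ?thesis unfolding power_mult_distrib[symmetric] by (intro power_mono) auto
  qed
  have "(\<integral> \<tau>. (norm (reinforce X \<tau> \<theta> - weight \<theta> \<theta>' \<tau> *\<^sub>R reinforce X \<tau> \<theta>'))\<^sup>2 \<partial>traj_law X \<theta>)
    \<le> (\<integral> \<tau>. (K * G)\<^sup>2 * (norm (a \<tau> - weight \<theta> \<theta>' \<tau> *\<^sub>R a' \<tau>))\<^sup>2 \<partial>traj_law X \<theta>)"
  proof (rule integral_mono_AE')
    show "integrable (traj_law X \<theta>) (\<lambda>\<tau>. (K * G)\<^sup>2 * (norm (a \<tau> - weight \<theta> \<theta>' \<tau> *\<^sub>R a' \<tau>))\<^sup>2)" using Ia by simp
  qed (use bound in \<open>auto intro!: AE_I2\<close>)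
  also have "\<dots> \<le> (K * G)\<^sup>2 * (x\<^sup>2 + (x * k + 2 * k\<^sup>2) * (1 + W))"
    using le by (simp add: mult_left_mono)
  also have "\<dots> = C_bar H (discount X) R G M W b * (norm (\<theta> - \<theta>'))\<^sup>2"
  proof -
    \<comment> \<open>Here \<open>x * k = M * d^2\<close>, so the mixed term supplies the summand
      \<open>M\<close> of \<open>C_\<omega>\<close>, and \<open>2 * k^2\<close> supplies
      \<open>2 * G^2\<close>.\<close>
    have "(K * G)\<^sup>2 * (x\<^sup>2 + (x * k + 2 * k\<^sup>2) * (1 + W)) = ((G * K)\<^sup>2 * ((2 * G\<^sup>2 + M) * (W + 1)) + (M * K)\<^sup>2) * ?d\<^sup>2"
      using G_pos unfolding x_def k_def by (simp add: field_simps power2_eq_square)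
    then show ?thesis unfolding C_bar_def C_g_eq L_g_eq C_\<omega>_def by (simp add: H1 norm_minus_commute)
  qed
  finally show ?thesis .
qed

lemma second_moment:
  assumes W: "(\<integral> \<tau>. (weight \<theta> \<theta>' \<tau>)\<^sup>2 \<partial>traj_law X \<theta>) \<le> 1 + W" and W0: "0 < W"
  shows "(\<integral> \<tau>. (norm (reinforce X \<tau> \<theta> - weight \<theta> \<theta>' \<tau> *\<^sub>R reinforce X \<tau> \<theta>'))\<^sup>2 \<partial>traj_law X \<theta>)
    \<le> C_bar H (discount X) R G M W b * (norm (\<theta> - \<theta>'))\<^sup>2"
proof -
  \<comment> \<open>Horizon one needs a direction of the step, so equal parameters are split off
    there; for longer horizons the general estimate includes them.\<close>
  consider "\<theta> \<noteq> \<theta>'" "H = 1" | "\<theta> = \<theta>'" "H = 1" | "2 \<le> H" using H_pos by linarith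
  then show ?thesis
  proof cases
    case 1
    then show ?thesis using second_moment_horizon_one W by blast
  next
    case 2
    have "(\<integral> \<tau>. (norm (reinforce X \<tau> \<theta>' - weight \<theta>' \<theta>' \<tau> *\<^sub>R reinforce X \<tau> \<theta>'))\<^sup>2 \<partial>traj_law X \<theta>') = (\<integral> \<tau>. 0 \<partial>traj_law X \<theta>')"
      by (intro Bochner_Integration.integral_cong) (auto simp: weight_same)
    then show ?thesis using 2 by simp
  next
    case 3
    interpret P: prob_space "traj_law X \<theta>" by (rule prob_space_traj_law)
    let ?d = "norm (\<theta> - \<theta>')"
    let ?k = "real H * G * ?d" and ?C = "C_g H (discount X) G R b" and ?l = "L_g H (discount X) M R b * ?d"
    have "(\<integral> \<tau>. (norm (reinforce X \<tau> \<theta> - weight \<theta> \<theta>' \<tau> *\<^sub>R reinforce X \<tau> \<theta>'))\<^sup>2 \<partial>traj_law X \<theta>)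
      \<le> ?l\<^sup>2 + (?k * ?C * ?l + 2 * ?k\<^sup>2 * ?C\<^sup>2) * (1 + W)"
      using weight_bounds[of _ \<theta> \<theta>'] expectation_weight W norm_reinforce_le reinforce_lipschitz G_pos
        expectation_abs_one_minus_weight[OF 3, of \<theta> \<theta>']
      by (intro P.expectation_norm_square_weighted_difference_le[where \<omega>="weight \<theta> \<theta>'"]) simp_all
    also have "\<dots> = C_bar H (discount X) R G M W b * ?d\<^sup>2"
      by (simp add: C_bar_def C_\<omega>_def C_g_eq L_g_eq power2_eq_square algebra_simps)
    finally show ?thesis .
  qed
qed

section \<open>Joint measurability in trajectory and parameter\<close>

lemma measurable_traj_dens_param [measurable]:
  assumes [measurable]: "f \<in> measurable N T" "g \<in> borel_measurable N"
  shows "(\<lambda>x. traj_dens X (g x) (f x)) \<in> borel_measurable N"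
proof -
  have "(\<lambda>(\<tau>, \<theta>). traj_dens X \<theta> \<tau>) \<in> borel_measurable (T \<Otimes>\<^sub>M borel)"
  proof (rule borel_measurable_caratheodory)
    fix \<tau> assume \<tau>: "\<tau> \<in> space T"
    show "continuous_on UNIV (\<lambda>\<theta>. traj_dens X \<theta> \<tau>)"
      unfolding traj_dens_def by (intro continuous_intros continuous_on_policy space_T[OF \<tau>]) auto
  qed measurable
  from measurable_compose[of "\<lambda>x. (f x, g x)", OF _ this] show ?thesis by simp
qed

lemma measurable_reinforce_param [measurable]:
  assumes [measurable]: "f \<in> measurable N T" "g \<in> borel_measurable N"
  shows "(\<lambda>x. reinforce X (f x) (g x)) \<in> borel_measurable N"
proof -
  have "(\<lambda>(\<tau>, \<theta>). reinforce X \<tau> \<theta>) \<in> borel_measurable (T \<Otimes>\<^sub>M borel)"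
  proof (rule borel_measurable_caratheodory)
    fix \<tau> assume \<tau>: "\<tau> \<in> space T"
    show "continuous_on UNIV (reinforce X \<tau>)"
      unfolding reinforce_eq by (intro continuous_intros continuous_on_score space_T[OF \<tau>]) auto
  qed measurable
  from measurable_compose[of "\<lambda>x. (f x, g x)", OF _ this] show ?thesis by simp
qed

lemma measurable_imp_weight_param [measurable]:
  assumes [measurable]: "f \<in> measurable N T" "g \<in> borel_measurable N" "h \<in> borel_measurable N"
  shows "(\<lambda>x. imp_weight X (f x) (g x) (h x)) \<in> borel_measurable N"
  unfolding imp_weight_def by measurable

lemma measurable_grad_objective [measurable]: "grad (objective X) \<in> borel_measurable borel"
proof -
  interpret sigma_finite_measure T by (rule sigma_finite_T)
  have "(\<lambda>\<theta>. \<integral> \<tau>. traj_dens X \<theta> \<tau> *\<^sub>R reinforce X \<tau> \<theta> \<partial>T) \<in> borel_measurable borel" by measurable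
  moreover have "grad (objective X) = (\<lambda>\<theta>. \<integral> \<tau>. traj_dens X \<theta> \<tau> *\<^sub>R reinforce X \<tau> \<theta> \<partial>T)"
    unfolding grad_objective by (rule ext, rule integral_traj_law) measurable
  ultimately show ?thesis by simp
qed

lemma norm_grad_objective_le: "norm (grad (objective X) \<theta>) \<le> C_g H (discount X) G R b"
proof -
  interpret P: prob_space "traj_law X \<theta>" by (rule prob_space_traj_law)
  have "norm (grad (objective X) \<theta>) \<le> (\<integral> \<tau>. norm (reinforce X \<tau> \<theta>) \<partial>traj_law X \<theta>)"
    unfolding grad_objective by (rule integral_norm_bound)
  also have "\<dots> \<le> (\<integral> \<tau>. C_g H (discount X) G R b \<partial>traj_law X \<theta>)"
    using norm_reinforce_le H_pos G_pos K_pos by (intro integral_mono_AE') (auto intro!: AE_I2 simp: C_g_eq)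
  finally show ?thesis using P.prob_space by simp
qed

lemma C_g_nonneg: "0 \<le> C_g H (discount X) G R b"
  using H_pos G_pos K_pos by (simp add: C_g_eq)

definition weight_var_bounded :: "real ^ 'q \<Rightarrow> real ^ 'q \<Rightarrow> real \<Rightarrow> bool" where
  "weight_var_bounded \<theta> \<theta>' W \<longleftrightarrow> (let P = traj_law X \<theta>; \<omega> = (\<lambda>\<tau>. imp_weight X \<tau> \<theta> \<theta>')
     in integrable P (\<lambda>\<tau>. (\<omega> \<tau>)\<^sup>2) \<and> (\<integral>\<tau>. (\<omega> \<tau> - (\<integral>\<tau>. \<omega> \<tau> \<partial>P))\<^sup>2 \<partial>P) \<le> W)"

text \<open>The weight has mean one, so its second moment is its variance plus one;
  \<open>weight\<close> and \<open>imp_weight\<close> agree almost surely under the law of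
  \<open>\<theta>\<close>.\<close>

lemma weight_second_moment:
  assumes "weight_var_bounded \<theta> \<theta>' W"
  shows "integrable (traj_law X \<theta>) (weight \<theta> \<theta>')" "integrable (traj_law X \<theta>) (\<lambda>\<tau>. (weight \<theta> \<theta>' \<tau>)\<^sup>2)"
    and "(\<integral> \<tau>. (weight \<theta> \<theta>' \<tau>)\<^sup>2 \<partial>traj_law X \<theta>) \<le> 1 + W"
proof -
  interpret P: prob_space "traj_law X \<theta>" by (rule prob_space_traj_law)
  have meas: "weight \<theta> \<theta>' \<in> borel_measurable (traj_law X \<theta>)" by measurable
  show I: "integrable (traj_law X \<theta>) (weight \<theta> \<theta>')" "integrable (traj_law X \<theta>) (\<lambda>\<tau>. (weight \<theta> \<theta>' \<tau>)\<^sup>2)"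
    using P.expectation_square_weight_le(1,2)[OF meas _ _ expectation_weight, of "real H * G * norm (\<theta> - \<theta>')"] weight_bounds
    by auto
  have one: "(\<integral> \<tau>. imp_weight X \<tau> \<theta> \<theta>' \<partial>traj_law X \<theta>) = 1"
    using integral_cong_AE[OF _ _ AE_imp_weight_eq, of \<theta> \<theta>'] expectation_weight by simp
  have "(\<integral> \<tau>. (imp_weight X \<tau> \<theta> \<theta>' - 1)\<^sup>2 \<partial>traj_law X \<theta>) = (\<integral> \<tau>. (weight \<theta> \<theta>' \<tau> - 1)\<^sup>2 \<partial>traj_law X \<theta>)"
    using AE_imp_weight_eq[of \<theta> \<theta>'] by (intro integral_cong_AE) (auto elim: eventually_mono)
  also have "(\<lambda>\<tau>. (weight \<theta> \<theta>' \<tau> - 1)\<^sup>2) = (\<lambda>\<tau>. (weight \<theta> \<theta>' \<tau>)\<^sup>2 - 2 * weight \<theta> \<theta>' \<tau> + 1)"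
    by (auto simp: power2_eq_square algebra_simps)
  also have "(\<integral> \<tau>. (weight \<theta> \<theta>' \<tau>)\<^sup>2 - 2 * weight \<theta> \<theta>' \<tau> + 1 \<partial>traj_law X \<theta>) = (\<integral> \<tau>. (weight \<theta> \<theta>' \<tau>)\<^sup>2 \<partial>traj_law X \<theta>) - 1"
    using I expectation_weight P.prob_space by simp
  finally show "(\<integral> \<tau>. (weight \<theta> \<theta>' \<tau>)\<^sup>2 \<partial>traj_law X \<theta>) \<le> 1 + W"
    using assms by (simp add: weight_var_bounded_def Let_def one)
qed

lemma integrable_reinforce: "integrable (traj_law X \<theta>) (\<lambda>\<tau>. reinforce X \<tau> \<theta>')"
proof -
  interpret P: prob_space "traj_law X \<theta>" by (rule prob_space_traj_law)
  show ?thesis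
    using norm_reinforce_le by (intro P.integrable_const_bound[where B="C_g H (discount X) G R b"]) (auto intro!: AE_I2)
qed

lemma nn_integral_traj_law:
  assumes "f \<in> borel_measurable T"
  shows "(\<integral>\<^sup>+ \<tau>. f \<tau> \<partial>traj_law X \<theta>) = (\<integral>\<^sup>+ \<tau>. ennreal (traj_dens X \<theta> \<tau>) * f \<tau> \<partial>T)"
  unfolding traj_law_def using assms by (intro nn_integral_density) auto

text \<open>A summand of the first batch minus its conditional mean, for frozen parameters;
  \<open>fresh_part\<close> does the same for the second batch.\<close>

definition recursive_part :: "real ^ 'q \<Rightarrow> real ^ 'q \<Rightarrow> ('s, 'a) traj \<Rightarrow> real ^ 'q" where
  "recursive_part \<theta> \<theta>' \<tau> = reinforce X \<tau> \<theta> - imp_weight X \<tau> \<theta> \<theta>' *\<^sub>R reinforce X \<tau> \<theta>'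
     - (grad (objective X) \<theta> - grad (objective X) \<theta>')"

definition fresh_part :: "real ^ 'q \<Rightarrow> ('s, 'a) traj \<Rightarrow> real ^ 'q" where
  "fresh_part \<theta> \<tau> = reinforce X \<tau> \<theta> - grad (objective X) \<theta>"

text \<open>The mean vanishes because weighting turns the law of \<open>\<theta>\<close> into that
  of \<open>\<theta>'\<close>, where the estimator is unbiased. Of the two bounds in the minimum,
  the sharp one grows with the distance of the parameters; the other one follows from the bound on
  the estimator and \<open>1 + W\<close>, is uniform, and provides integrability.\<close>

lemma recursive_part_moments:
  assumes A4: "weight_var_bounded \<theta> \<theta>' W" and W: "0 < W"
  shows "(\<integral> \<tau>. recursive_part \<theta> \<theta>' \<tau> \<partial>traj_law X \<theta>) = 0"
    and "(\<integral>\<^sup>+ \<tau>. ennreal ((norm (recursive_part \<theta> \<theta>' \<tau>))\<^sup>2) \<partial>traj_law X \<theta>)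
      \<le> ennreal (min (2 * (C_g H (discount X) G R b)\<^sup>2 * (2 + W)) (C_bar H (discount X) R G M W b * (norm (\<theta> - \<theta>'))\<^sup>2))"
proof -
  interpret P: prob_space "traj_law X \<theta>" by (rule prob_space_traj_law)
  let ?C = "C_g H (discount X) G R b"
  note w = weight_second_moment[OF A4]
  let ?Z = "\<lambda>\<tau>. reinforce X \<tau> \<theta> - weight \<theta> \<theta>' \<tau> *\<^sub>R reinforce X \<tau> \<theta>'"
  let ?m = "grad (objective X) \<theta> - grad (objective X) \<theta>'"
  have Iw: "integrable (traj_law X \<theta>) (\<lambda>\<tau>. weight \<theta> \<theta>' \<tau> *\<^sub>R reinforce X \<tau> \<theta>')"
  proof (rule Bochner_Integration.integrable_bound)
    show "integrable (traj_law X \<theta>) (\<lambda>\<tau>. ?C * weight \<theta> \<theta>' \<tau>)" using w by simp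
    show "AE \<tau> in traj_law X \<theta>. norm (weight \<theta> \<theta>' \<tau> *\<^sub>R reinforce X \<tau> \<theta>') \<le> norm (?C * weight \<theta> \<theta>' \<tau>)"
      using norm_reinforce_le C_g_nonneg
      by (intro AE_I2) (auto simp: abs_mult mult.commute[of ?C] intro!: mult_left_mono)
  qed measurable
  have IZ: "integrable (traj_law X \<theta>) ?Z" using Iw integrable_reinforce by auto
  have EZ: "(\<integral> \<tau>. ?Z \<tau> \<partial>traj_law X \<theta>) = ?m"
    using Iw integrable_reinforce
    by (simp add: integral_weight_scaleR grad_objective[symmetric] del: scaleR_left_diff_distrib)
  have AEeq: "AE \<tau> in traj_law X \<theta>. recursive_part \<theta> \<theta>' \<tau> = ?Z \<tau> - ?m"
    using AE_imp_weight_eq[of \<theta> \<theta>'] by eventually_elim (simp add: recursive_part_def)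
  have [measurable]: "recursive_part \<theta> \<theta>' \<in> borel_measurable T" unfolding recursive_part_def by measurable
  have "(\<integral> \<tau>. recursive_part \<theta> \<theta>' \<tau> \<partial>traj_law X \<theta>) = (\<integral> \<tau>. ?Z \<tau> - ?m \<partial>traj_law X \<theta>)"
    using AEeq by (intro integral_cong_AE) auto
  also have "\<dots> = 0" using IZ EZ P.prob_space by (simp del: space_traj_law)
  finally show "(\<integral> \<tau>. recursive_part \<theta> \<theta>' \<tau> \<partial>traj_law X \<theta>) = 0" .
  have le: "(norm (?Z \<tau>))\<^sup>2 \<le> 2 * ?C\<^sup>2 + 2 * ?C\<^sup>2 * (weight \<theta> \<theta>' \<tau>)\<^sup>2" if \<tau>: "\<tau> \<in> space T" for \<tau>
  proof -
    have "norm (?Z \<tau>) \<le> norm (reinforce X \<tau> \<theta>) + \<bar>weight \<theta> \<theta>' \<tau>\<bar> * norm (reinforce X \<tau> \<theta>')"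
      by (metis norm_triangle_ineq4 norm_scaleR)
    also have "\<dots> \<le> ?C + \<bar>weight \<theta> \<theta>' \<tau>\<bar> * ?C" using norm_reinforce_le[OF \<tau>] by (intro add_mono mult_left_mono) auto
    finally have "(norm (?Z \<tau>))\<^sup>2 \<le> (?C + \<bar>weight \<theta> \<theta>' \<tau>\<bar> * ?C)\<^sup>2" by (intro power_mono) auto
    also have "\<dots> \<le> 2 * ?C\<^sup>2 + 2 * (\<bar>weight \<theta> \<theta>' \<tau>\<bar> * ?C)\<^sup>2"
      using sum_squares_bound[of ?C "\<bar>weight \<theta> \<theta>' \<tau>\<bar> * ?C"] unfolding power2_sum by linarith
    finally show ?thesis by (simp add: power_mult_distrib mult_ac)
  qed
  have I2: "integrable (traj_law X \<theta>) (\<lambda>\<tau>. 2 * ?C\<^sup>2 + 2 * ?C\<^sup>2 * (weight \<theta> \<theta>' \<tau>)\<^sup>2)" using w by simp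
  have IZ2: "integrable (traj_law X \<theta>) (\<lambda>\<tau>. (norm (?Z \<tau>))\<^sup>2)"
    using le by (intro Bochner_Integration.integrable_bound[OF I2]) (auto intro!: AE_I2 order_trans[OF _ abs_ge_self])
  have "(\<integral> \<tau>. (norm (?Z \<tau>))\<^sup>2 \<partial>traj_law X \<theta>) \<le> (\<integral> \<tau>. 2 * ?C\<^sup>2 + 2 * ?C\<^sup>2 * (weight \<theta> \<theta>' \<tau>)\<^sup>2 \<partial>traj_law X \<theta>)"
    using le by (intro integral_mono IZ2 I2) auto
  also have "\<dots> = 2 * ?C\<^sup>2 * (1 + (\<integral> \<tau>. (weight \<theta> \<theta>' \<tau>)\<^sup>2 \<partial>traj_law X \<theta>))"
    using w P.prob_space by (simp add: algebra_simps del: space_traj_law)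
  also have "\<dots> \<le> 2 * ?C\<^sup>2 * (2 + W)" using w(3) by (intro mult_left_mono) auto
  finally have b1: "(\<integral> \<tau>. (norm (?Z \<tau>))\<^sup>2 \<partial>traj_law X \<theta>) \<le> 2 * ?C\<^sup>2 * (2 + W)" .
  note b2 = second_moment[OF w(3) W]
  note c = P.expectation_norm_square_centered[OF IZ IZ2, unfolded EZ]
  have "(\<integral>\<^sup>+ \<tau>. ennreal ((norm (recursive_part \<theta> \<theta>' \<tau>))\<^sup>2) \<partial>traj_law X \<theta>) = (\<integral>\<^sup>+ \<tau>. ennreal ((norm (?Z \<tau> - ?m))\<^sup>2) \<partial>traj_law X \<theta>)"
    using AEeq by (intro nn_integral_cong_AE) (auto elim: eventually_mono)
  also have "\<dots> = ennreal (\<integral> \<tau>. (norm (?Z \<tau> - ?m))\<^sup>2 \<partial>traj_law X \<theta>)"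
    using c(1) by (intro nn_integral_eq_integral) auto
  also have "\<dots> \<le> ennreal (min (2 * ?C\<^sup>2 * (2 + W)) (C_bar H (discount X) R G M W b * (norm (\<theta> - \<theta>'))\<^sup>2))"
    using c(2) b1 b2 by (intro ennreal_leI) auto
  finally show "(\<integral>\<^sup>+ \<tau>. ennreal ((norm (recursive_part \<theta> \<theta>' \<tau>))\<^sup>2) \<partial>traj_law X \<theta>)
      \<le> ennreal (min (2 * ?C\<^sup>2 * (2 + W)) (C_bar H (discount X) R G M W b * (norm (\<theta> - \<theta>'))\<^sup>2))" .
qed

lemma fresh_part_moments:
  assumes \<sigma>: "\<And>\<tau>. \<tau> \<in> space T \<Longrightarrow> (norm (reinforce X \<tau> \<theta> - grad (objective X) \<theta>))\<^sup>2 \<le> \<sigma>\<^sup>2"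
  shows "(\<integral> \<tau>. fresh_part \<theta> \<tau> \<partial>traj_law X \<theta>) = 0"
    and "(\<integral>\<^sup>+ \<tau>. ennreal ((norm (fresh_part \<theta> \<tau>))\<^sup>2) \<partial>traj_law X \<theta>) \<le> ennreal (\<sigma>\<^sup>2)"
proof -
  interpret P: prob_space "traj_law X \<theta>" by (rule prob_space_traj_law)
  show "(\<integral> \<tau>. fresh_part \<theta> \<tau> \<partial>traj_law X \<theta>) = 0"
    unfolding fresh_part_def using integrable_reinforce P.prob_space
    by (simp add: grad_objective[symmetric] del: space_traj_law)
  have "(\<integral>\<^sup>+ \<tau>. ennreal ((norm (fresh_part \<theta> \<tau>))\<^sup>2) \<partial>traj_law X \<theta>) \<le> (\<integral>\<^sup>+ \<tau>. ennreal (\<sigma>\<^sup>2) \<partial>traj_law X \<theta>)"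
    using \<sigma> by (intro nn_integral_mono ennreal_leI) (auto simp: fresh_part_def)
  then show "(\<integral>\<^sup>+ \<tau>. ennreal ((norm (fresh_part \<theta> \<tau>))\<^sup>2) \<partial>traj_law X \<theta>) \<le> ennreal (\<sigma>\<^sup>2)"
    using P.emeasure_space_1 by (simp del: space_traj_law)
qed

subsection \<open>One iteration of the hybrid estimator\<close>

text \<open>The disjoint sum makes one family out of both batches, conditionally independent by
  \<open>batch\<close>. The error splits into an \<open>F\<close>-measurable part and centred
  summands, one for each trajectory, as the second-moment lemma requires.\<close>

lemma hybrid_step:
  fixes \<Omega> F :: "'w measure" and Y :: "nat + nat \<Rightarrow> 'w \<Rightarrow> ('s, 'a) traj" and \<theta> \<theta>' V v :: "'w \<Rightarrow> real ^ 'q"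
  assumes prob: "prob_space \<Omega>" and sub: "subalgebra \<Omega> F"
    and Y: "\<And>i. i \<in> {..<B} <+> {..<B} \<Longrightarrow> Y i \<in> measurable \<Omega> T"
    and \<theta>: "\<theta> \<in> borel_measurable F" and \<theta>': "\<theta>' \<in> borel_measurable F" and V: "V \<in> borel_measurable F"
    and batch: "\<And>E. (\<And>i. i \<in> {..<B} <+> {..<B} \<Longrightarrow> E i \<in> sets T) \<Longrightarrow>
       AE w in \<Omega>. real_cond_exp \<Omega> F (indicator {w \<in> space \<Omega>. \<forall>i\<in>{..<B} <+> {..<B}. Y i w \<in> E i}) w
         = (\<Prod>i\<in>{..<B} <+> {..<B}. measure (traj_law X (\<theta> w)) (E i))"
    and \<beta>: "0 \<le> \<beta>" "\<beta> \<le> 1" and B: "1 \<le> B"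
    and \<sigma>: "\<And>\<theta> \<tau>. \<tau> \<in> space T \<Longrightarrow> (norm (reinforce X \<tau> \<theta> - grad (objective X) \<theta>))\<^sup>2 \<le> \<sigma>\<^sup>2"
    and W: "0 < W" and A4: "AE w in \<Omega>. weight_var_bounded (\<theta> w) (\<theta>' w) W"
    and V2: "integrable \<Omega> (\<lambda>w. (norm (V w - grad (objective X) (\<theta>' w)))\<^sup>2)"
    and v: "\<And>w. w \<in> space \<Omega> \<Longrightarrow> v w = \<beta> *\<^sub>R V w
        + (\<beta> / real B) *\<^sub>R (\<Sum>j<B. reinforce X (Y (Inl j) w) (\<theta> w)
            - imp_weight X (Y (Inl j) w) (\<theta> w) (\<theta>' w) *\<^sub>R reinforce X (Y (Inl j) w) (\<theta>' w))
        + ((1 - \<beta>) / real B) *\<^sub>R (\<Sum>j<B. reinforce X (Y (Inr j) w) (\<theta> w))"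
  shows "integrable \<Omega> v"
    and "AE w in \<Omega>. vec_cond_exp \<Omega> F v w = grad (objective X) (\<theta> w) + \<beta> *\<^sub>R (V w - grad (objective X) (\<theta>' w))"
    and "integrable \<Omega> (\<lambda>w. (norm (v w - grad (objective X) (\<theta> w)))\<^sup>2)"
    and "AE w in \<Omega>. real_cond_exp \<Omega> F (\<lambda>w. (norm (v w - grad (objective X) (\<theta> w)))\<^sup>2) w
       \<le> \<beta>\<^sup>2 * (norm (V w - grad (objective X) (\<theta>' w)))\<^sup>2
         + \<beta>\<^sup>2 * C_bar H (discount X) R G M W b / real B * (norm (\<theta> w - \<theta>' w))\<^sup>2 + (1 - \<beta>)\<^sup>2 * \<sigma>\<^sup>2 / real B"
proof -
  interpret prob_space \<Omega> by (rule prob)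
  interpret S: finite_measure_subalgebra \<Omega> F by (rule finite_measure_subalgebraI[OF sub])
  interpret T: sigma_finite_measure T by (rule sigma_finite_T)
  interpret TT: pair_sigma_finite T T by unfold_locales
  let ?I = "{..<B} <+> {..<B}"
  let ?C = "C_bar H (discount X) R G M W b"
  let ?J = "grad (objective X)"
  define P where "P = restr_to_subalg \<Omega> F"
  \<comment> \<open>Cutting at zero makes the density nonnegative at every argument, also outside
    the trajectory space; on trajectories nothing changes.\<close>
  define p where "p z = max 0 (traj_dens X (\<theta> (fst z)) (snd z))" for z
  define \<xi> where "\<xi> i z = (case i of
      Inl (j::nat) \<Rightarrow> (\<beta> / real B) *\<^sub>R recursive_part (\<theta> (fst z)) (\<theta>' (fst z)) (snd z)
    | Inr (j::nat) \<Rightarrow> ((1 - \<beta>) / real B) *\<^sub>R fresh_part (\<theta> (fst z)) (snd z))" for i z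
  define A where "A w = \<beta> *\<^sub>R (V w - ?J (\<theta>' w))" for w
  define c where "c i w = (case i of
      Inl (j::nat) \<Rightarrow> (\<beta> / real B)\<^sup>2 * (?C * (norm (\<theta> w - \<theta>' w))\<^sup>2)
    | Inr (j::nat) \<Rightarrow> ((1 - \<beta>) / real B)\<^sup>2 * \<sigma>\<^sup>2)" for i w
  \<comment> \<open>A common constant for both kinds of summands; the coefficients
    \<open>\<beta> / B\<close> and \<open>(1 - \<beta>) / B\<close> are at most one and do not
    increase it.\<close>
  define K' where "K' = 2 * (C_g H (discount X) G R b)\<^sup>2 * (2 + W) + \<sigma>\<^sup>2"
  have finI: "finite ?I" by simp
  have toP: "f \<in> borel_measurable P" if "f \<in> borel_measurable F" for f :: "'w \<Rightarrow> real ^ 'q"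
    using that by (subst measurable_cong_sets[OF _ refl]) (auto simp: P_def sets_restr_to_subalg[OF sub])
  have [measurable]: "\<theta> \<in> borel_measurable P" "\<theta>' \<in> borel_measurable P" using \<theta> \<theta>' by (auto intro: toP)
  have p_meas: "p \<in> borel_measurable (P \<Otimes>\<^sub>M T)" unfolding p_def by measurable
  have p_nn: "0 \<le> p z" for z by (simp add: p_def)
  have p_eq: "p (w, \<tau>) = traj_dens X (\<theta> w) \<tau>" if "\<tau> \<in> space T" for w \<tau>
    using traj_dens_nonneg[OF that] by (simp add: p_def)
  have p_int: "(\<integral>\<^sup>+ \<tau>. ennreal (p (w, \<tau>)) * f \<tau> \<partial>T) = (\<integral>\<^sup>+ \<tau>. f \<tau> \<partial>traj_law X (\<theta> w))" if "f \<in> borel_measurable T" for f w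
    unfolding nn_integral_traj_law[OF that] by (intro nn_integral_cong) (simp add: p_eq)
  have p_ind: "(\<integral>\<^sup>+ \<tau>. ennreal (p (w, \<tau>)) * indicator E \<tau> \<partial>T) = ennreal (measure (traj_law X (\<theta> w)) E)" if "E \<in> sets T" for E w
  proof -
    interpret L: prob_space "traj_law X (\<theta> w)" by (rule prob_space_traj_law)
    show ?thesis using that by (subst p_int) (auto simp: L.emeasure_eq_measure)
  qed
  have prob_top: "measure (traj_law X \<theta>) (space T) = 1" for \<theta>
    using prob_space.prob_space[OF prob_space_traj_law[of \<theta>]] by simp
  have law1: "distr \<Omega> (P \<Otimes>\<^sub>M T) (\<lambda>w. (w, Y i w)) = density (P \<Otimes>\<^sub>M T) (\<lambda>z. ennreal (p z))" if i: "i \<in> ?I" for i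
    unfolding P_def
  proof (rule joint_law_eq_density[OF sub sigma_finite_T Y[OF i], where G="sets T"])
    show "(\<lambda>z. ennreal (p z)) \<in> borel_measurable (restr_to_subalg \<Omega> F \<Otimes>\<^sub>M T)" using p_meas unfolding P_def by measurable
    show "Int_stable (sets T)" by (rule sets.Int_stable)
    show "sets T \<subseteq> Pow (space T)" by (rule sets.space_closed)
    show "sets T = sigma_sets (space T) (sets T)" by (rule sets.sigma_sets_eq[symmetric])
    fix E assume E: "E \<in> sets T"
    \<comment> \<open>Filling the other coordinates with the whole space extracts the conditional
      law of one sample from that of the batches.\<close>
    let ?E = "\<lambda>k. if k = i then E else space T"
    have set: "{w \<in> space \<Omega>. \<forall>k\<in>?I. Y k w \<in> ?E k} = Y i -` E \<inter> space \<Omega>"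
      using i measurable_space[OF Y] by (auto split: if_splits)
    have prod: "(\<Prod>k\<in>?I. measure (traj_law X (\<theta> w)) (?E k)) = measure (traj_law X (\<theta> w)) E" for w
    proof -
      have "(\<Prod>k\<in>?I. measure (traj_law X (\<theta> w)) (?E k)) = (\<Prod>k\<in>?I. if k = i then measure (traj_law X (\<theta> w)) E else 1)"
        by (intro prod.cong) (auto simp: prob_top)
      then show ?thesis using finI i by simp
    qed
    have Em: "?E k \<in> sets T" for k using E by simp
    from batch[of ?E, OF Em] show "AE w in \<Omega>. ennreal (real_cond_exp \<Omega> F (indicator (Y i -` E \<inter> space \<Omega>)) w) = (\<integral>\<^sup>+ y. ennreal (p (w, y)) * indicator E y \<partial>T)"
      unfolding set prod by eventually_elim (simp add: p_ind[OF E])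
  qed simp
  have law2: "distr \<Omega> (P \<Otimes>\<^sub>M (T \<Otimes>\<^sub>M T)) (\<lambda>w. (w, (Y i w, Y j w)))
      = density (P \<Otimes>\<^sub>M (T \<Otimes>\<^sub>M T)) (\<lambda>z. ennreal (p (fst z, fst (snd z)) * p (fst z, snd (snd z))))"
    if i: "i \<in> ?I" and j: "j \<in> ?I" and ij: "i \<noteq> j" for i j
    unfolding P_def
  proof (rule joint_law_eq_density[OF sub, where G="{E \<times> E' | E E'. E \<in> sets T \<and> E' \<in> sets T}"])
    show "sigma_finite_measure (T \<Otimes>\<^sub>M T)" by unfold_locales
    show "(\<lambda>w. (Y i w, Y j w)) \<in> measurable \<Omega> (T \<Otimes>\<^sub>M T)" using Y[OF i] Y[OF j] by simp
    note p_meas[measurable]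
    have "(\<lambda>z. ennreal (p (fst z, fst (snd z)) * p (fst z, snd (snd z)))) \<in> borel_measurable (P \<Otimes>\<^sub>M (T \<Otimes>\<^sub>M T))" by measurable
    then show "(\<lambda>z. ennreal (p (fst z, fst (snd z)) * p (fst z, snd (snd z)))) \<in> borel_measurable (restr_to_subalg \<Omega> F \<Otimes>\<^sub>M (T \<Otimes>\<^sub>M T))"
      unfolding P_def .
    show "Int_stable {E \<times> E' | E E'. E \<in> sets T \<and> E' \<in> sets T}" by (rule Int_stable_pair_measure_generator)
    show "{E \<times> E' | E E'. E \<in> sets T \<and> E' \<in> sets T} \<subseteq> Pow (space (T \<Otimes>\<^sub>M T))"
      unfolding space_pair_measure by (rule pair_measure_closed)
    show "sets (T \<Otimes>\<^sub>M T) = sigma_sets (space (T \<Otimes>\<^sub>M T)) {E \<times> E' | E E'. E \<in> sets T \<and> E' \<in> sets T}"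
      unfolding space_pair_measure by (rule sets_pair_measure)
    show "space (T \<Otimes>\<^sub>M T) \<in> {E \<times> E' | E E'. E \<in> sets T \<and> E' \<in> sets T}" by (auto simp: space_pair_measure)
    fix Q assume "Q \<in> {E \<times> E' | E E'. E \<in> sets T \<and> E' \<in> sets T}"
    then obtain E E' where Q: "Q = E \<times> E'" and E: "E \<in> sets T" "E' \<in> sets T" by blast
    \<comment> \<open>Two prescribed events and whole spaces elsewhere: any two samples are
      conditionally independent, also across the batches.\<close>
    let ?E = "\<lambda>k. if k = i then E else if k = j then E' else space T"
    have set: "{w \<in> space \<Omega>. \<forall>k\<in>?I. Y k w \<in> ?E k} = (\<lambda>w. (Y i w, Y j w)) -` Q \<inter> space \<Omega>"
      using i j ij measurable_space[OF Y] by (auto simp: Q split: if_splits)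
    have prod: "(\<Prod>k\<in>?I. measure (traj_law X (\<theta> w)) (?E k)) = measure (traj_law X (\<theta> w)) E * measure (traj_law X (\<theta> w)) E'" for w
    proof -
      have rem: "prod g ?I = g i * (g j * prod g (?I - {i} - {j}))" for g :: "nat + nat \<Rightarrow> real"
        using prod.remove[OF finI i, of g] prod.remove[of "?I - {i}" j g] finI j ij by simp
      have "(\<Prod>k\<in>?I. measure (traj_law X (\<theta> w)) (?E k)) = measure (traj_law X (\<theta> w)) (?E i) * (measure (traj_law X (\<theta> w)) (?E j)
          * (\<Prod>k\<in>?I - {i} - {j}. measure (traj_law X (\<theta> w)) (?E k)))"
        by (rule rem)
      also have "(\<Prod>k\<in>?I - {i} - {j}. measure (traj_law X (\<theta> w)) (?E k)) = 1"
        by (intro prod.neutral) (auto simp: prob_top)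
      finally show ?thesis using ij by simp
    qed
    have int: "(\<integral>\<^sup>+ y. ennreal (p (fst (w, y), fst (snd (w, y))) * p (fst (w, y), snd (snd (w, y)))) * indicator Q y \<partial>(T \<Otimes>\<^sub>M T))
      = ennreal (measure (traj_law X (\<theta> w)) E * measure (traj_law X (\<theta> w)) E')" if w: "w \<in> space P" for w
    proof -
      let ?f = "\<lambda>E y. ennreal (p (w, y)) * indicator E y"
      have m: "?f E \<in> borel_measurable T" if "E \<in> sets T" for E
        using measurable_compose[OF measurable_Pair1'[OF w] p_meas] that
        by (intro borel_measurable_times_ennreal borel_measurable_indicator) (auto intro: measurable_compose[OF _ measurable_ennreal])
      have "(\<integral>\<^sup>+ y. ennreal (p (fst (w, y), fst (snd (w, y))) * p (fst (w, y), snd (snd (w, y)))) * indicator Q y \<partial>(T \<Otimes>\<^sub>M T))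
        = (\<integral>\<^sup>+ y. ?f E (fst y) * ?f E' (snd y) \<partial>(T \<Otimes>\<^sub>M T))"
        unfolding Q using p_nn by (intro nn_integral_cong) (auto simp: ennreal_mult indicator_def mult_ac)
      also have "\<dots> = (\<integral>\<^sup>+ y. ?f E y \<partial>T) * (\<integral>\<^sup>+ y'. ?f E' y' \<partial>T)"
        by (rule T.nn_integral_pair_mult[OF m[OF E(1)] m[OF E(2)]])
      finally show ?thesis using E by (simp add: p_ind ennreal_mult)
    qed
    have Em: "?E k \<in> sets T" for k using E by simp
    from batch[of ?E, OF Em] AE_space
    show "AE w in \<Omega>. ennreal (real_cond_exp \<Omega> F (indicator ((\<lambda>w. (Y i w, Y j w)) -` Q \<inter> space \<Omega>)) w)
      = (\<integral>\<^sup>+ y. ennreal (p (fst (w, y), fst (snd (w, y))) * p (fst (w, y), snd (snd (w, y)))) * indicator Q y \<partial>(T \<Otimes>\<^sub>M T))"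
      unfolding set prod
    proof eventually_elim
      case (elim w)
      then have w: "w \<in> space P" by (simp add: P_def space_restr_to_subalg)
      show ?case unfolding elim(1) int[OF w] ..
    qed
  qed
  have \<xi>_meas: "\<xi> i \<in> borel_measurable (P \<Otimes>\<^sub>M T)" for i
    unfolding \<xi>_def recursive_part_def fresh_part_def by (cases i; simp; measurable)
  have part_meas [measurable]: "recursive_part \<theta> \<theta>' \<in> borel_measurable T" "fresh_part \<theta> \<in> borel_measurable T" for \<theta> \<theta>'
    unfolding recursive_part_def fresh_part_def by measurable
  have p_bochner: "(\<integral> \<tau>. p (w, \<tau>) *\<^sub>R f \<tau> \<partial>T) = (\<integral> \<tau>. f \<tau> \<partial>traj_law X (\<theta> w))" if "f \<in> borel_measurable T" for f :: "_ \<Rightarrow> real ^ 'q" and w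
    unfolding integral_traj_law(1)[OF that] by (intro Bochner_Integration.integral_cong) (simp_all add: p_eq)
  have mean: "AE w in \<Omega>. (\<integral> \<tau>. p (w, \<tau>) *\<^sub>R \<xi> i (w, \<tau>) \<partial>T) = 0" for i
    using A4
  proof eventually_elim
    case (elim w)
    show ?case
    proof (cases i)
      case (Inl j)
      have "(\<integral> \<tau>. p (w, \<tau>) *\<^sub>R \<xi> i (w, \<tau>) \<partial>T) = (\<integral> \<tau>. p (w, \<tau>) *\<^sub>R ((\<beta> / real B) *\<^sub>R recursive_part (\<theta> w) (\<theta>' w) \<tau>) \<partial>T)"
        by (simp add: \<xi>_def Inl)
      also have "\<dots> = (\<integral> \<tau>. (\<beta> / real B) *\<^sub>R recursive_part (\<theta> w) (\<theta>' w) \<tau> \<partial>traj_law X (\<theta> w))"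
        by (rule p_bochner) measurable
      finally show ?thesis using recursive_part_moments(1)[OF elim W] by simp
    next
      case (Inr j)
      have "(\<integral> \<tau>. p (w, \<tau>) *\<^sub>R \<xi> i (w, \<tau>) \<partial>T) = (\<integral> \<tau>. p (w, \<tau>) *\<^sub>R (((1 - \<beta>) / real B) *\<^sub>R fresh_part (\<theta> w) \<tau>) \<partial>T)"
        by (simp add: \<xi>_def Inr)
      also have "\<dots> = (\<integral> \<tau>. ((1 - \<beta>) / real B) *\<^sub>R fresh_part (\<theta> w) \<tau> \<partial>traj_law X (\<theta> w))"
        by (rule p_bochner) measurable
      finally show ?thesis using fresh_part_moments(1)[OF \<sigma>, of "\<theta> w"] by simp
    qed
  qed
  have r1: "0 \<le> r / real B" "(r / real B)\<^sup>2 \<le> 1" if "0 \<le> r" "r \<le> 1" for r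
  proof -
    show "0 \<le> r / real B" using that by simp
    have "r / real B \<le> 1" using that B by (simp add: field_simps)
    then show "(r / real B)\<^sup>2 \<le> 1" using that by (simp add: power_le_one)
  qed
  have K0: "0 \<le> K'" using W by (simp add: K'_def)
  have Kge: "2 * (C_g H (discount X) G R b)\<^sup>2 * (2 + W) \<le> K'" "\<sigma>\<^sup>2 \<le> K'" using W by (auto simp: K'_def)
  have scaled: "(\<integral>\<^sup>+ \<tau>. ennreal (p (w, \<tau>) * (norm (r *\<^sub>R f \<tau>))\<^sup>2) \<partial>T) \<le> ennreal (min K' (r\<^sup>2 * C))"
    if f [measurable]: "f \<in> borel_measurable T" and le: "(\<integral>\<^sup>+ \<tau>. ennreal ((norm (f \<tau>))\<^sup>2) \<partial>traj_law X (\<theta> w)) \<le> ennreal (min K' C)"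
      and r: "r\<^sup>2 \<le> 1" and C: "0 \<le> C" for f :: "_ \<Rightarrow> real ^ 'q" and w r C
  proof -
    have "(\<integral>\<^sup>+ \<tau>. ennreal (p (w, \<tau>) * (norm (r *\<^sub>R f \<tau>))\<^sup>2) \<partial>T) = (\<integral>\<^sup>+ \<tau>. ennreal (p (w, \<tau>)) * (ennreal (r\<^sup>2) * ennreal ((norm (f \<tau>))\<^sup>2)) \<partial>T)"
      using p_nn by (intro nn_integral_cong) (simp add: power_mult_distrib ennreal_mult[symmetric])
    also have "\<dots> = (\<integral>\<^sup>+ \<tau>. ennreal (r\<^sup>2) * ennreal ((norm (f \<tau>))\<^sup>2) \<partial>traj_law X (\<theta> w))" by (rule p_int) measurable
    also have "\<dots> = ennreal (r\<^sup>2) * (\<integral>\<^sup>+ \<tau>. ennreal ((norm (f \<tau>))\<^sup>2) \<partial>traj_law X (\<theta> w))" by (rule nn_integral_cmult) measurable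
    also have "\<dots> \<le> ennreal (r\<^sup>2) * ennreal (min K' C)" using le by (intro mult_left_mono) auto
    also have "\<dots> = ennreal (r\<^sup>2 * min K' C)" using K0 C by (simp add: ennreal_mult)
    also have "\<dots> \<le> ennreal (min K' (r\<^sup>2 * C))"
    proof (rule ennreal_leI)
      have "r\<^sup>2 * min K' C \<le> 1 * K'" using r K0 C by (intro mult_mono) auto
      moreover have "r\<^sup>2 * min K' C \<le> r\<^sup>2 * C" by (intro mult_left_mono) auto
      ultimately show "r\<^sup>2 * min K' C \<le> min K' (r\<^sup>2 * C)" by simp
    qed
    finally show ?thesis .
  qed
  have second: "AE w in \<Omega>. (\<integral>\<^sup>+ \<tau>. ennreal (p (w, \<tau>) * (norm (\<xi> i (w, \<tau>)))\<^sup>2) \<partial>T) \<le> ennreal (min K' (c i w))" for i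
    using A4
  proof eventually_elim
    case (elim w)
    show ?case
    proof (cases i)
      case (Inl j)
      have "(\<integral>\<^sup>+ \<tau>. ennreal ((norm (recursive_part (\<theta> w) (\<theta>' w) \<tau>))\<^sup>2) \<partial>traj_law X (\<theta> w)) \<le> ennreal (min K' (?C * (norm (\<theta> w - \<theta>' w))\<^sup>2))"
        by (rule order_trans[OF recursive_part_moments(2)[OF elim W]]) (intro ennreal_leI min.mono Kge order_refl)
      from scaled[OF part_meas(1) this r1(2)[OF \<beta>]] show ?thesis
        using C_bar_pos[OF W] by (simp add: \<xi>_def c_def Inl del: norm_scaleR)
    next
      case (Inr j)
      have "(\<integral>\<^sup>+ \<tau>. ennreal ((norm (fresh_part (\<theta> w) \<tau>))\<^sup>2) \<partial>traj_law X (\<theta> w)) \<le> ennreal (min K' (\<sigma>\<^sup>2))"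
        by (rule order_trans[OF fresh_part_moments(2)[OF \<sigma>]]) (use Kge(2) in \<open>auto intro!: ennreal_leI\<close>)
      from scaled[OF part_meas(2) this r1(2)[of "1 - \<beta>"]] show ?thesis
        using \<beta> by (simp add: \<xi>_def c_def Inr del: norm_scaleR)
    qed
  qed
  have c0: "0 \<le> c i w" for i w unfolding c_def using C_bar_pos[OF W] by (auto split: sum.split)
  have A_meas: "A \<in> borel_measurable F"
    unfolding A_def using V measurable_compose[OF \<theta>' measurable_grad_objective]
    by (intro borel_measurable_scaleR borel_measurable_diff borel_measurable_const)
  have A2: "integrable \<Omega> (\<lambda>w. (norm (A w))\<^sup>2)"
    unfolding A_def using V2 by (simp add: power_mult_distrib)
  have split: "v w - ?J (\<theta> w) = A w + (\<Sum>i\<in>?I. \<xi> i (w, Y i w))" if "w \<in> space \<Omega>" for w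
  proof -
    \<comment> \<open>Averaging over \<open>B\<close> terms restores the full multiple
      \<open>r\<close> of the subtracted constant.\<close>
    have avg: "(\<Sum>j<B. (r / real B) *\<^sub>R (f j - z)) = (r / real B) *\<^sub>R (\<Sum>j<B. f j) - r *\<^sub>R z" for r and f :: "nat \<Rightarrow> real ^ 'q" and z
    proof -
      have "(\<Sum>j<B. (r / real B) *\<^sub>R (f j - z)) = (r / real B) *\<^sub>R ((\<Sum>j<B. f j) - (\<Sum>j<B. z))"
        by (simp only: scaleR_sum_right[symmetric] sum_subtractf)
      also have "\<dots> = (r / real B) *\<^sub>R (\<Sum>j<B. f j) - r *\<^sub>R z"
        unfolding sum_constant_scaleR card_lessThan using B by (simp add: scaleR_diff_right)
      finally show ?thesis .
    qed
    have "(\<Sum>i\<in>?I. \<xi> i (w, Y i w)) = (\<Sum>j<B. \<xi> (Inl j) (w, Y (Inl j) w)) + (\<Sum>j<B. \<xi> (Inr j) (w, Y (Inr j) w))"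
      by (simp add: sum.Plus)
    also have "(\<Sum>j<B. \<xi> (Inl j) (w, Y (Inl j) w)) = (\<beta> / real B) *\<^sub>R (\<Sum>j<B. reinforce X (Y (Inl j) w) (\<theta> w)
            - imp_weight X (Y (Inl j) w) (\<theta> w) (\<theta>' w) *\<^sub>R reinforce X (Y (Inl j) w) (\<theta>' w))
        - \<beta> *\<^sub>R (?J (\<theta> w) - ?J (\<theta>' w))"
      unfolding avg[symmetric] by (simp add: \<xi>_def recursive_part_def)
    also have "(\<Sum>j<B. \<xi> (Inr j) (w, Y (Inr j) w)) = ((1 - \<beta>) / real B) *\<^sub>R (\<Sum>j<B. reinforce X (Y (Inr j) w) (\<theta> w)) - (1 - \<beta>) *\<^sub>R ?J (\<theta> w)"
      unfolding avg[symmetric] by (simp add: \<xi>_def fresh_part_def)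
    \<comment> \<open>The gradient at \<open>\<theta>'\<close> cancels against the one in
      \<open>A\<close>, and the multiples \<open>\<beta>\<close> and \<open>1 - \<beta>\<close> of
      the gradient at \<open>\<theta>\<close> add up to one.\<close>
    finally show ?thesis unfolding v[OF that] A_def by (simp add: algebra_simps)
  qed
  note main = conditional_second_moment_sum[where I="?I" and Y=Y and p=p and \<xi>=\<xi> and A=A and c=c and K=K' and F=F and N=T, folded P_def,
      OF sub sigma_finite_T finI Y p_meas p_nn law1 law2 A_meas A2 \<xi>_meas mean second c0 K0]
  have int: "integrable \<Omega> (\<lambda>w. v w - ?J (\<theta> w))"
    using main(4) by (subst Bochner_Integration.integrable_cong[OF refl split]) auto
  show "integrable \<Omega> (\<lambda>w. (norm (v w - ?J (\<theta> w)))\<^sup>2)"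
    using main(1) by (subst Bochner_Integration.integrable_cong[OF refl, of _ _ "\<lambda>w. (norm (A w + (\<Sum>i\<in>?I. \<xi> i (w, Y i w))))\<^sup>2"]) (auto simp: split)
  have J_F: "(\<lambda>w. ?J (\<theta> w)) \<in> borel_measurable F" by (rule measurable_compose[OF \<theta> measurable_grad_objective])
  have IJ: "integrable \<Omega> (\<lambda>w. ?J (\<theta> w))"
    using norm_grad_objective_le measurable_from_subalg[OF sub J_F]
    by (intro integrable_const_bound[where B="C_g H (discount X) G R b"]) auto
  then show Iv: "integrable \<Omega> v" using Bochner_Integration.integrable_add[OF int IJ] by simp
  have comp: "AE w in \<Omega>. real_cond_exp \<Omega> F (\<lambda>w. v w $ k) w = (?J (\<theta> w) + A w) $ k" for k
  proof -
    have Ik: "integrable \<Omega> (\<lambda>w. inner (axis k 1) (v w - ?J (\<theta> w)))" "integrable \<Omega> (\<lambda>w. inner (axis k 1) (?J (\<theta> w)))"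
      using int IJ by auto
    have "AE w in \<Omega>. real_cond_exp \<Omega> F (\<lambda>w. inner (axis k 1) (v w - ?J (\<theta> w))) w = inner (axis k 1) (A w)"
    proof -
      have "AE w in \<Omega>. real_cond_exp \<Omega> F (\<lambda>w. inner (axis k 1) (v w - ?J (\<theta> w))) w
        = real_cond_exp \<Omega> F (\<lambda>w. inner (axis k 1) (A w + (\<Sum>i\<in>?I. \<xi> i (w, Y i w)))) w"
        using Ik(1) main(4) by (intro S.real_cond_exp_cong) (auto simp: split intro!: AE_I2 borel_measurable_integrable)
      with main(3)[of "axis k 1"] show ?thesis by (auto elim!: eventually_elim2)
    qed
    moreover have "AE w in \<Omega>. real_cond_exp \<Omega> F (\<lambda>w. inner (axis k 1) (?J (\<theta> w))) w = inner (axis k 1) (?J (\<theta> w))"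
      by (intro S.real_cond_exp_F_meas Ik(2) borel_measurable_inner borel_measurable_const J_F)
    moreover have "AE w in \<Omega>. real_cond_exp \<Omega> F (\<lambda>w. inner (axis k 1) (v w - ?J (\<theta> w)) + inner (axis k 1) (?J (\<theta> w))) w
      = real_cond_exp \<Omega> F (\<lambda>w. inner (axis k 1) (v w - ?J (\<theta> w))) w + real_cond_exp \<Omega> F (\<lambda>w. inner (axis k 1) (?J (\<theta> w))) w"
      by (rule S.real_cond_exp_add[OF Ik])
    ultimately show ?thesis by eventually_elim (simp add: inner_axis' inner_diff_right)
  qed
  have "AE w in \<Omega>. \<forall>k\<in>UNIV. real_cond_exp \<Omega> F (\<lambda>w. v w $ k) w = (?J (\<theta> w) + A w) $ k"
    by (intro AE_finite_allI comp) simp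
  then show "AE w in \<Omega>. vec_cond_exp \<Omega> F v w = ?J (\<theta> w) + \<beta> *\<^sub>R (V w - ?J (\<theta>' w))"
    by eventually_elim (simp add: vec_cond_exp_def vec_eq_iff A_def)
  \<comment> \<open>Each kind has \<open>B\<close> summands with coefficient \<open>1 / B^2\<close>,
    hence the gain \<open>1 / B\<close>.\<close>
  have sum_c: "(\<Sum>i\<in>?I. c i w) = \<beta>\<^sup>2 * ?C / real B * (norm (\<theta> w - \<theta>' w))\<^sup>2 + (1 - \<beta>)\<^sup>2 * \<sigma>\<^sup>2 / real B" for w
    using B by (simp add: sum.Plus c_def power_divide power2_eq_square)
  have "AE w in \<Omega>. real_cond_exp \<Omega> F (\<lambda>w. (norm (v w - ?J (\<theta> w)))\<^sup>2) w
    = real_cond_exp \<Omega> F (\<lambda>w. (norm (A w + (\<Sum>i\<in>?I. \<xi> i (w, Y i w))))\<^sup>2) w"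
    using int main(1) by (intro S.real_cond_exp_cong) (auto simp: split intro!: AE_I2 borel_measurable_integrable)
  then show "AE w in \<Omega>. real_cond_exp \<Omega> F (\<lambda>w. (norm (v w - ?J (\<theta> w)))\<^sup>2) w
       \<le> \<beta>\<^sup>2 * (norm (V w - ?J (\<theta>' w)))\<^sup>2 + \<beta>\<^sup>2 * ?C / real B * (norm (\<theta> w - \<theta>' w))\<^sup>2 + (1 - \<beta>)\<^sup>2 * \<sigma>\<^sup>2 / real B"
    using main(2) unfolding sum_c
    by (auto elim!: eventually_elim2 simp: A_def power_mult_distrib)
qed

end

section \<open>The hybrid estimator along the iterates\<close>

theorem lemma4p1:
  fixes X :: "('s, 'a, 'q::finite) pg_model"
    and R G M W b \<sigma> \<alpha> \<beta> \<eta> :: real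
    and B N t :: nat
    and Q :: "real ^ 'q \<Rightarrow> ereal"
    and \<Omega> :: "'w measure"
    and \<B>0 :: "nat \<Rightarrow> 'w \<Rightarrow> ('s, 'a) traj"
    and \<B> \<B>' :: "nat \<Rightarrow> nat \<Rightarrow> 'w \<Rightarrow> ('s, 'a) traj"
    and \<theta>0 :: "real ^ 'q"
    and \<theta> v :: "nat \<Rightarrow> 'w \<Rightarrow> real ^ 'q"
  assumes model: "wf_model X"
    and baseline_bound: "\<And>k s. s \<in> space (states X) \<Longrightarrow> \<bar>baseline X k s\<bar> \<le> b"
    and A2: "R > 0"
      "\<And>s a. \<lbrakk>s \<in> space (states X); a \<in> space (actions X)\<rbrakk> \<Longrightarrow> \<bar>reward X s a\<bar> \<le> R"
    and A3: "G > 0" "M > 0"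
      "\<And>\<theta> s a. \<lbrakk>s \<in> space (states X); a \<in> space (actions X)\<rbrakk> \<Longrightarrow>
         norm (grad (log_policy X s a) \<theta>) \<le> G"
      "\<And>\<theta> s a. \<lbrakk>s \<in> space (states X); a \<in> space (actions X)\<rbrakk> \<Longrightarrow>
         onorm (hessian (log_policy X s a) \<theta>) \<le> M"
    and sigma: "\<sigma> > 0"
      "\<And>\<theta> \<tau>. \<tau> \<in> space (traj_space X) \<Longrightarrow> (norm (reinforce X \<tau> \<theta> - grad (objective X) \<theta>))\<^sup>2 \<le> \<sigma>\<^sup>2"
    and params: "0 \<le> \<beta>" "\<beta> \<le> 1" "B \<ge> 1" "N \<ge> 1" "0 < \<alpha>" "\<alpha> \<le> 1" "\<eta> > 0"
    and Q: "proper_closed_convex Q"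
    and prob: "prob_space \<Omega>"
    and meas: "\<And>j. j < N \<Longrightarrow> \<B>0 j \<in> measurable \<Omega> (traj_space X)"
      "\<And>s j. \<lbrakk>1 \<le> s; j < B\<rbrakk> \<Longrightarrow> \<B> s j \<in> measurable \<Omega> (traj_space X)"
      "\<And>s j. \<lbrakk>1 \<le> s; j < B\<rbrakk> \<Longrightarrow> \<B>' s j \<in> measurable \<Omega> (traj_space X)"
    and initial_batch: "prob_space.indep_vars \<Omega> (\<lambda>_. traj_space X) \<B>0 {..<N}"
      "\<And>j. j < N \<Longrightarrow> distr \<Omega> (traj_space X) (\<B>0 j) = traj_law X \<theta>0"
    and batches: "\<And>s E E'. \<lbrakk>1 \<le> s;
           \<And>j. j < B \<Longrightarrow> E j \<in> sets (traj_space X); \<And>j. j < B \<Longrightarrow> E' j \<in> sets (traj_space X)\<rbrakk> \<Longrightarrow>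
         AE w in \<Omega>. real_cond_exp \<Omega> (past X \<Omega> N B \<B>0 \<B> \<B>' s)
             (indicator {w \<in> space \<Omega>. \<forall>j<B. \<B> s j w \<in> E j \<and> \<B>' s j w \<in> E' j}) w =
           (\<Prod>j<B. measure (traj_law X (\<theta> s w)) (E j)) *
           (\<Prod>j<B. measure (traj_law X (\<theta> s w)) (E' j))"
    and theta_0: "\<And>w. w \<in> space \<Omega> \<Longrightarrow> \<theta> 0 w = \<theta>0"
    and theta_step: "\<And>s w. w \<in> space \<Omega> \<Longrightarrow>
         \<theta> (Suc s) w =
           (1 - \<alpha>) *\<^sub>R \<theta> s w + \<alpha> *\<^sub>R prox (\<lambda>x. ereal \<eta> * Q x) (\<theta> s w + \<eta> *\<^sub>R v s w)"
    and v_0: "\<And>w. w \<in> space \<Omega> \<Longrightarrow> v 0 w = (1 / real N) *\<^sub>R (\<Sum>j<N. reinforce X (\<B>0 j w) (\<theta> 0 w))"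
    and v_step: "\<And>s w. \<lbrakk>1 \<le> s; w \<in> space \<Omega>\<rbrakk> \<Longrightarrow>
         v s w = \<beta> *\<^sub>R v (s - 1) w
           + (\<beta> / real B) *\<^sub>R (\<Sum>j<B. reinforce X (\<B> s j w) (\<theta> s w)
               - imp_weight X (\<B> s j w) (\<theta> s w) (\<theta> (s - 1) w) *\<^sub>R
                   reinforce X (\<B> s j w) (\<theta> (s - 1) w))
           + ((1 - \<beta>) / real B) *\<^sub>R (\<Sum>j<B. reinforce X (\<B>' s j w) (\<theta> s w))"
    and A4: "W > 0"
      "AE w in \<Omega>. \<forall>s\<ge>1.
         (let P = traj_law X (\<theta> s w); \<omega> = (\<lambda>\<tau>. imp_weight X \<tau> (\<theta> s w) (\<theta> (s - 1) w))
          in integrable P (\<lambda>\<tau>. (\<omega> \<tau>)\<^sup>2) \<and> (\<integral>\<tau>. (\<omega> \<tau> - (\<integral>\<tau>. \<omega> \<tau> \<partial>P))\<^sup>2 \<partial>P) \<le> W)"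
    and t: "t \<ge> 1"
  shows "let F = past X \<Omega> N B \<B>0 \<B> \<B>' t;
             gradJ = (\<lambda>w. grad (objective X) (\<theta> t w));
             \<Delta>v = grad_error X \<theta> v;
             C = C_bar (horizon X) (discount X) R G M W b
         in integrable \<Omega> (v t) \<and>
            (AE w in \<Omega>. vec_cond_exp \<Omega> F (v t) w = gradJ w + \<beta> *\<^sub>R \<Delta>v (t - 1) w) \<and>
            (\<beta> \<noteq> 0 \<longrightarrow>
               (AE w in \<Omega>. cond_bias \<Omega> F (v t) gradJ w = \<beta> *\<^sub>R \<Delta>v (t - 1) w \<and>
                  (\<Delta>v (t - 1) w \<noteq> 0 \<longrightarrow> cond_bias \<Omega> F (v t) gradJ w \<noteq> 0))) \<and>
            C > 0 \<and>
            integrable \<Omega> (\<lambda>w. (norm (\<Delta>v t w))\<^sup>2) \<and>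
            (AE w in \<Omega>. real_cond_exp \<Omega> F (\<lambda>w. (norm (\<Delta>v t w))\<^sup>2) w
               \<le> \<beta>\<^sup>2 * (norm (\<Delta>v (t - 1) w))\<^sup>2
                 + \<beta>\<^sup>2 * C / real B * (norm (\<theta> t w - \<theta> (t - 1) w))\<^sup>2
                 + (1 - \<beta>)\<^sup>2 * \<sigma>\<^sup>2 / real B)"
proof -
  interpret policy_gradient X R G M b
    by unfold_locales (fact model baseline_bound A2 A3)+
  interpret prob_space \<Omega> by (rule prob)
  let ?F = "past X \<Omega> N B \<B>0 \<B> \<B>'"
  let ?Xs = "past_samples N B \<B>0 \<B> \<B>'"
  let ?J = "grad (objective X)"
  have Xs: "Y \<in> measurable \<Omega> T" if "Y \<in> ?Xs s" for Y s
    using that meas by (auto simp: past_samples_def)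
  have sub: "subalgebra \<Omega> (?F s)" for s unfolding past_def by (rule subalgebra_gen_field[OF Xs])
  have spF: "space (?F s) = space \<Omega>" for s unfolding past_def by (rule space_gen_field)
  have sample: "Y \<in> measurable (?F s) T" if "Y \<in> ?Xs s" for Y s
    unfolding past_def by (rule measurable_gen_field[OF that Xs[OF that]])
  have mono: "f \<in> borel_measurable (?F (Suc s))" if "f \<in> borel_measurable (?F s)" for f :: "'w \<Rightarrow> real ^ 'q" and s
    using that unfolding past_def
    by (rule measurable_gen_field_mono[rotated]) (auto simp: past_samples_def less_Suc_eq)
  have prox_meas [measurable]: "prox (\<lambda>x. ereal \<eta> * Q x) \<in> borel_measurable borel"
    by (rule borel_measurable_prox[OF proper_closed_convex_scale[OF Q params(7)]])
  have \<theta>_step: "\<theta> (Suc s) \<in> borel_measurable (?F u)"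
    if [measurable]: "\<theta> s \<in> borel_measurable (?F u)" "v s \<in> borel_measurable (?F u)" for s u
    by (subst measurable_cong[OF theta_step]) (simp add: spF, measurable)
  \<comment> \<open>\<open>\<theta> s\<close> is computed from \<open>v (s - 1)\<close>, hence from
    batches of index below \<open>s\<close>; the bookkeeping starts at 1, where the past consists of
    the initial batch.\<close>
  have adapted: "\<theta> s \<in> borel_measurable (?F s) \<and> \<theta> (s - 1) \<in> borel_measurable (?F s) \<and> v (s - 1) \<in> borel_measurable (?F s)"
    if "1 \<le> s" for s
    using that
  proof (induction s rule: nat_induct_at_least)
    case base
    have \<theta>0': "\<theta> 0 \<in> borel_measurable (?F 1)"
      by (subst measurable_cong[where g="\<lambda>_. \<theta>0"]) (auto simp: spF theta_0)
    have B0m: "\<B>0 j \<in> measurable (?F 1) T" if "j < N" for j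
      using that by (intro sample) (auto simp: past_samples_def)
    have "(\<lambda>w. (1 / real N) *\<^sub>R (\<Sum>j<N. reinforce X (\<B>0 j w) (\<theta> 0 w))) \<in> borel_measurable (?F 1)"
      using \<theta>0' B0m by (intro borel_measurable_scaleR borel_measurable_const borel_measurable_sum measurable_reinforce_param) auto
    then have v0': "v 0 \<in> borel_measurable (?F 1)"
      by (subst measurable_cong[OF v_0]) (simp_all add: spF)
    show ?case using \<theta>0' v0' \<theta>_step[OF \<theta>0' v0'] by simp
  next
    case (Suc s)
    then have IH: "\<theta> s \<in> borel_measurable (?F (Suc s))" "\<theta> (s - 1) \<in> borel_measurable (?F (Suc s))" "v (s - 1) \<in> borel_measurable (?F (Suc s))"
      using mono by blast+
    \<comment> \<open>The batches of iteration \<open>s\<close> enter the past only at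
      \<open>Suc s\<close>, so this is the first field for which \<open>v s\<close> is
      measurable.\<close>
    have new: "\<B> s j \<in> measurable (?F (Suc s)) T" "\<B>' s j \<in> measurable (?F (Suc s)) T" if "j < B" for j
    proof -
      have "\<B> s j \<in> ?Xs (Suc s)" "\<B>' s j \<in> ?Xs (Suc s)"
        unfolding past_samples_def using that Suc.hyps lessI by blast+
      then show "\<B> s j \<in> measurable (?F (Suc s)) T" "\<B>' s j \<in> measurable (?F (Suc s)) T" by (blast intro: sample)+
    qed
    have "(\<lambda>w. \<beta> *\<^sub>R v (s - 1) w
           + (\<beta> / real B) *\<^sub>R (\<Sum>j<B. reinforce X (\<B> s j w) (\<theta> s w)
               - imp_weight X (\<B> s j w) (\<theta> s w) (\<theta> (s - 1) w) *\<^sub>R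
                   reinforce X (\<B> s j w) (\<theta> (s - 1) w))
           + ((1 - \<beta>) / real B) *\<^sub>R (\<Sum>j<B. reinforce X (\<B>' s j w) (\<theta> s w))) \<in> borel_measurable (?F (Suc s))"
      using IH new
      by (intro borel_measurable_add borel_measurable_diff borel_measurable_scaleR borel_measurable_const borel_measurable_sum
          measurable_reinforce_param measurable_imp_weight_param) auto
    then have vs: "v s \<in> borel_measurable (?F (Suc s))"
      using Suc.hyps by (subst measurable_cong[OF v_step]) (simp_all add: spF)
    show ?case using IH(1) vs \<theta>_step[OF IH(1) vs] by simp
  qed
  let ?I = "{..<B} <+> {..<B}"
  have batch: "AE w in \<Omega>. real_cond_exp \<Omega> (?F s) (indicator {w \<in> space \<Omega>. \<forall>i\<in>?I. case_sum (\<B> s) (\<B>' s) i w \<in> E i}) w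
      = (\<Prod>i\<in>?I. measure (traj_law X (\<theta> s w)) (E i))"
    if s: "1 \<le> s" and E: "\<And>i. i \<in> ?I \<Longrightarrow> E i \<in> sets T" for s E
  proof -
    have "{w \<in> space \<Omega>. \<forall>i\<in>?I. case_sum (\<B> s) (\<B>' s) i w \<in> E i} = {w \<in> space \<Omega>. \<forall>j<B. \<B> s j w \<in> E (Inl j) \<and> \<B>' s j w \<in> E (Inr j)}"
      by (auto simp: Plus_def ball_Un)
    moreover have "(\<Prod>i\<in>?I. measure (traj_law X \<theta>) (E i)) = (\<Prod>j<B. measure (traj_law X \<theta>) (E (Inl j))) * (\<Prod>j<B. measure (traj_law X \<theta>) (E (Inr j)))" for \<theta>
      by (simp add: prod.Plus)
    ultimately show ?thesis
      using batches[OF s, of "\<lambda>j. E (Inl j)" "\<lambda>j. E (Inr j)"] E[OF InlI] E[OF InrI] by simp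
  qed
  have var: "AE w in \<Omega>. weight_var_bounded (\<theta> s w) (\<theta> (s - 1) w) W" if "1 \<le> s" for s
    using A4(2) by eventually_elim (use that in \<open>simp add: weight_var_bounded_def\<close>)
  have Ym: "case_sum (\<B> s) (\<B>' s) i \<in> measurable \<Omega> T" if "1 \<le> s" "i \<in> ?I" for s i
    using that(2) meas(2,3)[OF that(1)] by (auto elim!: PlusE)
  have step: "integrable \<Omega> (v s)
    \<and> (AE w in \<Omega>. vec_cond_exp \<Omega> (?F s) (v s) w = ?J (\<theta> s w) + \<beta> *\<^sub>R (v (s - 1) w - ?J (\<theta> (s - 1) w)))
    \<and> integrable \<Omega> (\<lambda>w. (norm (v s w - ?J (\<theta> s w)))\<^sup>2)
    \<and> (AE w in \<Omega>. real_cond_exp \<Omega> (?F s) (\<lambda>w. (norm (v s w - ?J (\<theta> s w)))\<^sup>2) w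
       \<le> \<beta>\<^sup>2 * (norm (v (s - 1) w - ?J (\<theta> (s - 1) w)))\<^sup>2
         + \<beta>\<^sup>2 * C_bar H (discount X) R G M W b / real B * (norm (\<theta> s w - \<theta> (s - 1) w))\<^sup>2 + (1 - \<beta>)\<^sup>2 * \<sigma>\<^sup>2 / real B)"
    if s: "1 \<le> s" and int: "integrable \<Omega> (\<lambda>w. (norm (v (s - 1) w - ?J (\<theta> (s - 1) w)))\<^sup>2)" for s
  proof -
    note ad = adapted[OF s]
    have "v s w = \<beta> *\<^sub>R v (s - 1) w
        + (\<beta> / real B) *\<^sub>R (\<Sum>j<B. reinforce X (case_sum (\<B> s) (\<B>' s) (Inl j) w) (\<theta> s w)
            - imp_weight X (case_sum (\<B> s) (\<B>' s) (Inl j) w) (\<theta> s w) (\<theta> (s - 1) w) *\<^sub>R reinforce X (case_sum (\<B> s) (\<B>' s) (Inl j) w) (\<theta> (s - 1) w))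
        + ((1 - \<beta>) / real B) *\<^sub>R (\<Sum>j<B. reinforce X (case_sum (\<B> s) (\<B>' s) (Inr j) w) (\<theta> s w))" if "w \<in> space \<Omega>" for w
      using v_step[OF s that] by simp
    note h = hybrid_step[OF prob sub Ym[OF s] _ _ _ batch[OF s] params(1-3) sigma(2) A4(1) var[OF s] int this]
    show ?thesis using h ad by blast
  qed
  \<comment> \<open>Each step needs square integrability of the previous error, so this is
    propagated by induction. It starts from a bounded error: \<open>v 0\<close> averages finitely
    many bounded estimators, and the gradient is bounded as well.\<close>
  have L2: "integrable \<Omega> (\<lambda>w. (norm (v s w - ?J (\<theta> s w)))\<^sup>2)" for s
  proof (induction s)
    case 0
    let ?C = "C_g H (discount X) G R b"
    have "v 0 \<in> borel_measurable \<Omega>" "\<theta> 0 \<in> borel_measurable \<Omega>"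
      using adapted[of 1] measurable_from_subalg[OF sub] by auto
    then have m: "(\<lambda>w. (norm (v 0 w - ?J (\<theta> 0 w)))\<^sup>2) \<in> borel_measurable \<Omega>" by measurable
    have "norm ((norm (v 0 w - ?J (\<theta> 0 w)))\<^sup>2) \<le> (?C + ?C)\<^sup>2" if w: "w \<in> space \<Omega>" for w
    proof -
      have "norm (\<Sum>j<N. reinforce X (\<B>0 j w) (\<theta> 0 w)) \<le> real (card {..<N}) * ?C"
        using measurable_space[OF meas(1) w] by (intro sum_norm_bound norm_reinforce_le) auto
      then have "norm (v 0 w) \<le> ?C" unfolding v_0[OF w] using params(4) by (simp add: field_simps)
      then have "norm (v 0 w - ?J (\<theta> 0 w)) \<le> ?C + ?C"
        using norm_grad_objective_le by (intro order_trans[OF norm_triangle_ineq4] add_mono) auto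
      then have "(norm (v 0 w - ?J (\<theta> 0 w)))\<^sup>2 \<le> (?C + ?C)\<^sup>2" by (rule power_mono) simp
      then show ?thesis by simp
    qed
    then show ?case by (intro integrable_const_bound[where B="(?C + ?C)\<^sup>2"] m AE_I2)
  next
    case (Suc s)
    then show ?case using step[of "Suc s"] by simp
  qed
  note main = step[OF t L2]
  have bias: "AE w in \<Omega>. cond_bias \<Omega> (?F t) (v t) (\<lambda>w. ?J (\<theta> t w)) w = \<beta> *\<^sub>R grad_error X \<theta> v (t - 1) w"
    using main by (auto simp: cond_bias_def grad_error_def elim!: eventually_mono)
  \<comment> \<open>A nonzero multiple of a nonzero error does not vanish, so the bias is genuine
    wherever the previous error is nonzero.\<close>
  then have "\<beta> \<noteq> 0 \<longrightarrow> (AE w in \<Omega>. cond_bias \<Omega> (?F t) (v t) (\<lambda>w. ?J (\<theta> t w)) w = \<beta> *\<^sub>R grad_error X \<theta> v (t - 1) w \<and>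
      (grad_error X \<theta> v (t - 1) w \<noteq> 0 \<longrightarrow> cond_bias \<Omega> (?F t) (v t) (\<lambda>w. ?J (\<theta> t w)) w \<noteq> 0))"
    by (auto elim!: eventually_mono)
  with main C_bar_pos[OF A4(1)] show ?thesis
    unfolding Let_def grad_error_def by blast
qed

end
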